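(* Let $E$ be a finite extension of $\mathbb{Q}_p$ and $m$ a positive integer. There exists a finite set $\mathcal{E}$ of finite extensions of $E$, depending only on $E$ and $m$, such that every standard subset $X\subset\bar{\mathbb{Q}}_p$ defined over $E$ with $c_E(X)\leq m$ is entirely determined by the sets $X\cap F$, $F\in\mathcal{E}$: that is, if $X,X'\subset\bar{\mathbb{Q}}_p$ are standard subsets defined over $E$ with $c_E(X)\leq m$, $c_E(X')\leq m$ and $X\cap F=X'\cap F$ for all $F\in\mathcal{E}$, then $X=X'$.
   Context: Rational disks: $D(a,r)^-=\{x\in\bar{\mathbb{Q}}_p:|x-a|<r\}$ (open) and $D(a,r)^+=\{x:|x-a|\leq r\}$ (closed), with $a\in\bar{\mathbb{Q}}_p$, $r\in|\bar{\mathbb{Q}}_p^\times|$. A connected standard subset of $\mathbb{P}^1(\bar{\mathbb{Q}}_p)$ is either $D_0\setminus\bigcup_{i=1}^nD_i$ with $D_0$ an open rational disk and $D_1,\dots,D_n$ pairwise disjoint closed rational disks contained in and different from $D_0$, or $\mathbb{P}^1(\bar{\mathbb{Q}}_p)\setminus\bigcup_{i=1}^nD_i$ with $D_i$ pairwise disjoint closed rational disks. A standard subset is a finite disjoint union of connected standard subsets (its connected components). $G_E=\operatorname{Gal}(\bar{\mathbb{Q}}_p/E)$ acts on $\mathbb{P}^1(\bar{\mathbb{Q}}_p)$; a subset is defined over $E$ if it is $G_E$-stable; the field of definition over $E$ of a subset is the fixed field of its stabilizer in $G_E$. $v_E$ is the normalized valuation of $E$ extended to $\bar{\mathbb{Q}}_p$.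 Complexity $c_E$: for a rational disk $D$ (open or closed), let $F$ be its field of definition over $E$, let $s$ be the smallest ramification index $e_{K/F}$ of a finite extension $K/F$ with $K\cap D\neq\emptyset$, and let $t$ be the smallest positive integer such that, for such a $K$, $D$ can be written as $\{x: st\,v_E(x-a)\geq v_E(b)\}$ or $\{x: st\,v_E(x-a)>v_E(b)\}$ with $a,b\in K$; set $c_E(D)=st$ and $c_E(\mathbb{P}^1(\bar{\mathbb{Q}}_p))=0$. For a connected standard subset $D_0\setminus\bigcup_{j=1}^nD_j$ (with $D_0$ an open disk or $\mathbb{P}^1$), $c_E=\sum_{j=0}^nc_E(D_j)$; for a standard subset, $c_E$ is the sum over its connected components. *)

theory Defs
  imports
    Complex_Main
    "HOL-Computational_Algebra.Polynomial"
    "HOL-Library.Extended_Real"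
    "HOL-Library.Disjoint_Sets"
begin

text \<open>
  The field of \<open>p\<close>-adic numbers and its algebraic closure are described up to isometric
  isomorphism.  The ambient type \<open>'a\<close> is an algebraically closed field with a non-archimedean
  absolute value \<open>absv\<close> normalised by \<open>absv p = 1/p\<close>; hence \<open>absv\<close> restricts to the \<open>p\<close>-adic
  absolute value on the rationals.  The closure of the rationals is required to be complete, so it
  is the completion of the rationals, that is, the field of \<open>p\<close>-adic numbers; and \<open>'a\<close> is required
  to be algebraic over it.
\<close>

definition Qp :: "('a::field_char_0 \<Rightarrow> real) \<Rightarrow> 'a set" where
  "Qp absv = {x. \<forall>e>0. \<exists>q::rat. absv (x - of_rat q) < e}"

locale Qp_algebraic_closure =
  fixes p :: nat
    and absv :: "'a::{alg_closed_field, field_char_0} \<Rightarrow> real"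
  assumes prime_p: "prime p"
    and absv_nonneg: "0 \<le> absv x"
    and absv_eq_0_iff: "absv x = 0 \<longleftrightarrow> x = 0"
    and absv_mult: "absv (x * y) = absv x * absv y"
    and absv_add_le_max: "absv (x + y) \<le> max (absv x) (absv y)"
    and absv_p: "absv (of_nat p) = 1 / real p"
    and Qp_complete:
      "\<lbrakk>\<And>n. X n \<in> Qp absv; \<And>e. 0 < e \<Longrightarrow> \<exists>N::nat. \<forall>m\<ge>N. \<forall>n\<ge>N. absv (X m - X n) < e\<rbrakk>
        \<Longrightarrow> \<exists>x\<in>Qp absv. (\<lambda>n. absv (X n - x)) \<longlonglongrightarrow> 0"
    and algebraic_over_Qp:
      "\<exists>f. f \<noteq> 0 \<and> (\<forall>i. coeff f i \<in> Qp absv) \<and> poly f x = 0"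


definition is_subfield :: "'a::field set \<Rightarrow> bool" where
  "is_subfield F \<longleftrightarrow> 0 \<in> F \<and> 1 \<in> F \<and>
    (\<forall>x\<in>F. \<forall>y\<in>F. x - y \<in> F \<and> x * y \<in> F) \<and> (\<forall>x\<in>F. inverse x \<in> F)"

definition finite_extension :: "'a::field set \<Rightarrow> 'a set \<Rightarrow> bool" where
  "finite_extension F K \<longleftrightarrow> is_subfield F \<and> is_subfield K \<and> F \<subseteq> K \<and>
    (\<exists>B. finite B \<and> B \<subseteq> K \<and> (\<forall>x\<in>K. \<exists>c. (\<forall>b\<in>B. c b \<in> F) \<and> x = (\<Sum>b\<in>B. c b * b)))"

definition Gal :: "'a::field set \<Rightarrow> ('a \<Rightarrow> 'a) set" where
  "Gal E = {\<sigma>. bij \<sigma> \<and> (\<forall>x y. \<sigma> (x + y) = \<sigma> x + \<sigma> y) \<and> (\<forall>x y. \<sigma> (x * y) = \<sigma> x * \<sigma> y) \<and>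
    (\<forall>x\<in>E. \<sigma> x = x)}"


text \<open>
  The projective line is \<open>'a option\<close>, with \<open>None\<close> as the point at infinity; automorphisms act on it
  by \<open>map_option\<close>.
\<close>

definition defined_over :: "'a::field set \<Rightarrow> 'a option set \<Rightarrow> bool" where
  "defined_over E X \<longleftrightarrow> (\<forall>\<sigma>\<in>Gal E. map_option \<sigma> ` X = X)"

definition field_of_definition :: "'a::field set \<Rightarrow> 'a option set \<Rightarrow> 'a set" where
  "field_of_definition E X = {x. \<forall>\<sigma>\<in>Gal E. map_option \<sigma> ` X = X \<longrightarrow> \<sigma> x = x}"


definition value_group :: "('a::field \<Rightarrow> real) \<Rightarrow> 'a set \<Rightarrow> real set" where
  "value_group absv K = absv ` (K - {0})"

text \<open>The ramification index is the index of the value group of \<open>F\<close> in that of \<open>K\<close>.\<close>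

definition ramification_index :: "('a::field \<Rightarrow> real) \<Rightarrow> 'a set \<Rightarrow> 'a set \<Rightarrow> nat" where
  "ramification_index absv F K =
    card ((\<lambda>r. (\<lambda>u. r * u) ` value_group absv F) ` value_group absv K)"

text \<open>
  The base of the logarithm is the absolute value of a uniformizer of \<open>E\<close> (the largest absolute
  value less than 1), so that \<open>E - {0}\<close> is mapped onto the integers.
\<close>

definition normalized_valuation ::
    "('a::field \<Rightarrow> real) \<Rightarrow> 'a set \<Rightarrow> 'a \<Rightarrow> ereal" where
  "normalized_valuation absv E x =
    (if x = 0 then \<infinity> else ereal (log (Sup {r \<in> value_group absv E. r < 1}) (absv x)))"


definition open_rational_disk :: "('a::field \<Rightarrow> real) \<Rightarrow> 'a set \<Rightarrow> bool" where
  "open_rational_disk absv D \<longleftrightarrow> (\<exists>a. \<exists>r\<in>value_group absv UNIV. D = {x. absv (x - a) < r})"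

definition closed_rational_disk :: "('a::field \<Rightarrow> real) \<Rightarrow> 'a set \<Rightarrow> bool" where
  "closed_rational_disk absv D \<longleftrightarrow> (\<exists>a. \<exists>r\<in>value_group absv UNIV. D = {x. absv (x - a) \<le> r})"

text \<open>
  Presentations \<open>X = D\<^sub>0 - \<Union>\<D>\<close>.  A set \<open>\<D>\<close> can replace the family of closed disks because
  pairwise disjoint disks are distinct.
\<close>

definition connected_presentation ::
    "('a::field \<Rightarrow> real) \<Rightarrow> 'a option set \<Rightarrow> 'a set set \<Rightarrow> 'a option set \<Rightarrow> bool" where
  "connected_presentation absv D\<^sub>0 \<D> X \<longleftrightarrow>
    (D\<^sub>0 = UNIV \<or> (\<exists>D. open_rational_disk absv D \<and> D\<^sub>0 = Some ` D)) \<and>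
    finite \<D> \<and> (\<forall>D\<in>\<D>. closed_rational_disk absv D \<and> Some ` D \<subset> D\<^sub>0) \<and> disjoint \<D> \<and>
    X = D\<^sub>0 - Some ` \<Union>\<D>"

definition connected_standard :: "('a::field \<Rightarrow> real) \<Rightarrow> 'a option set \<Rightarrow> bool" where
  "connected_standard absv X \<longleftrightarrow> (\<exists>D\<^sub>0 \<D>. connected_presentation absv D\<^sub>0 \<D> X)"

definition standard_decomposition ::
    "('a::field \<Rightarrow> real) \<Rightarrow> 'a option set set \<Rightarrow> 'a option set \<Rightarrow> bool" where
  "standard_decomposition absv \<C> X \<longleftrightarrow>
    finite \<C> \<and> disjoint \<C> \<and> (\<forall>Y\<in>\<C>. connected_standard absv Y) \<and> X = \<Union>\<C>"

definition standard_subset :: "('a::field \<Rightarrow> real) \<Rightarrow> 'a option set \<Rightarrow> bool" where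
  "standard_subset absv X \<longleftrightarrow> (\<exists>\<C>. standard_decomposition absv \<C> X)"


definition disk_min_ramification ::
    "('a::field \<Rightarrow> real) \<Rightarrow> 'a set \<Rightarrow> 'a set \<Rightarrow> nat" where
  "disk_min_ramification absv E D =
    (let F = field_of_definition E (Some ` D) in
      (LEAST s. \<exists>K. finite_extension F K \<and> K \<inter> D \<noteq> {} \<and> ramification_index absv F K = s))"

text \<open>
  The set of admissible \<open>t\<close> is the same for every extension \<open>K\<close> realising the minimal ramification
  index \<open>s\<close>: the centre can be taken in \<open>K \<inter> D\<close>, and the value group of \<open>K\<close> depends only on \<open>s\<close>.
  Hence the quantifier over \<open>K\<close> may be existential.
\<close>

definition disk_scale :: "('a::field \<Rightarrow> real) \<Rightarrow> 'a set \<Rightarrow> 'a set \<Rightarrow> nat" where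
  "disk_scale absv E D =
    (let F = field_of_definition E (Some ` D);
         s = disk_min_ramification absv E D;
         v = normalized_valuation absv E
     in (LEAST t. 0 < t \<and>
          (\<exists>K. finite_extension F K \<and> K \<inter> D \<noteq> {} \<and> ramification_index absv F K = s \<and>
            (\<exists>a\<in>K. \<exists>b\<in>K.
              D = {x. ereal (real (s * t)) * v (x - a) \<ge> v b} \<or>
              D = {x. ereal (real (s * t)) * v (x - a) > v b}))))"

definition disk_complexity :: "('a::field \<Rightarrow> real) \<Rightarrow> 'a set \<Rightarrow> 'a set \<Rightarrow> nat" where
  "disk_complexity absv E D = disk_min_ramification absv E D * disk_scale absv E D"

definition outer_complexity :: "('a::field \<Rightarrow> real) \<Rightarrow> 'a set \<Rightarrow> 'a option set \<Rightarrow> nat" where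
  "outer_complexity absv E D\<^sub>0 =
    (if D\<^sub>0 = UNIV then 0 else disk_complexity absv E (Some -` D\<^sub>0))"

text \<open>
  The presentation of a connected standard subset and the decomposition of a standard subset into
  connected components are unique, so the choices below are immaterial.
\<close>

definition connected_complexity :: "('a::field \<Rightarrow> real) \<Rightarrow> 'a set \<Rightarrow> 'a option set \<Rightarrow> nat" where
  "connected_complexity absv E X =
    (let (D\<^sub>0, \<D>) = (SOME (D\<^sub>0, \<D>). connected_presentation absv D\<^sub>0 \<D> X)
     in outer_complexity absv E D\<^sub>0 + (\<Sum>D\<in>\<D>. disk_complexity absv E D))"

definition connected_components ::
    "('a::field \<Rightarrow> real) \<Rightarrow> 'a option set \<Rightarrow> 'a option set set" where
  "connected_components absv X = (SOME \<C>. standard_decomposition absv \<C> X)"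

definition complexity :: "('a::field \<Rightarrow> real) \<Rightarrow> 'a set \<Rightarrow> 'a option set \<Rightarrow> nat" where
  "complexity absv E X =
    (\<Sum>Y\<in>connected_components absv X. connected_complexity absv E Y)"

end

(*
  Degrees over E are measured by sizes of Galois orbits.  A disk D with stabilizer H and field of
  definition F that meets an extension K of F contains a point whose H-orbit has at most e(K/F)
  elements: otherwise, for j <= e(K/F), monic polynomials Q_j over F of degree j whose value at a
  point b of K in D is minimal have no roots in D; two of the e(K/F) + 1 absolute values |Q_j(b)|
  agree modulo |F^*|, and since Q_j is constant on D up to a factor congruent to 1, the residue of
  the corresponding quotient is Galois invariant, so that subtracting a multiple of the smaller
  polynomial decreases the larger one further.  Hence a disk of bounded complexity with a bounded
  number of conjugates has a centre of bounded degree and a radius in a fixed finite extension of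
  the value group.

  The disks presenting a standard subset X are determined by X, so they are permuted by the Galois
  group when X is defined over E, and there are at most m of them.  Given X and X' and a point z of
  X, let D be the smallest of the disks of X and X' that contains z.  A point of D generic enough
  to avoid all disks that avoid z lies in the same disks as z, and it can be chosen of bounded
  degree.  All points of bounded degree lie in one finite extension of E, which therefore
  determines X.  The latter fact is proved without discriminants: if an automorphism moves all
  integers of the field L of a point of bounded degree only slightly, averaging over the orbits of
  the group S of such automorphisms shows that L is contained in the closed field fixed by S; and a
  finite net of the integers of bounded degree exists because Z_p is totally bounded.
*)
theory Submission
  imports Defs
begin

section \<open>Elementary facts on the absolute value\<close>

definition poly_over :: "'a::zero set \<Rightarrow> 'a poly \<Rightarrow> bool" where
  "poly_over F f \<longleftrightarrow> (\<forall>i. coeff f i \<in> F)"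

context
  fixes F :: "'a::field set"
  assumes F: "is_subfield F"
begin

lemma subfield_0: "0 \<in> F" and subfield_1: "1 \<in> F"
  and subfield_diff: "x \<in> F \<Longrightarrow> y \<in> F \<Longrightarrow> x - y \<in> F"
  and subfield_mult: "x \<in> F \<Longrightarrow> y \<in> F \<Longrightarrow> x * y \<in> F"
  and subfield_inverse: "x \<in> F \<Longrightarrow> inverse x \<in> F"
  using F unfolding is_subfield_def by auto

lemma subfield_minus: "x \<in> F \<Longrightarrow> - x \<in> F"
  using subfield_diff[of 0 x] subfield_0 by simp

lemma subfield_add: "x \<in> F \<Longrightarrow> y \<in> F \<Longrightarrow> x + y \<in> F"
  using subfield_diff[of x "- y"] subfield_minus by simp

lemma subfield_divide: "x \<in> F \<Longrightarrow> y \<in> F \<Longrightarrow> x / y \<in> F"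
  by (simp add: divide_inverse subfield_mult subfield_inverse)

lemma subfield_power: "x \<in> F \<Longrightarrow> x ^ n \<in> F"
  by (induction n) (auto intro: subfield_mult subfield_1)

lemma subfield_of_nat: "of_nat n \<in> F"
  by (induction n) (auto intro: subfield_add subfield_0 subfield_1)

lemma subfield_sum: "(\<And>i. i \<in> I \<Longrightarrow> f i \<in> F) \<Longrightarrow> (\<Sum>i\<in>I. f i) \<in> F"
  by (induction I rule: infinite_finite_induct) (auto intro: subfield_add subfield_0)

lemma poly_over_diff: "poly_over F f \<Longrightarrow> poly_over F g \<Longrightarrow> poly_over F (f - g)"
  by (auto simp: poly_over_def intro: subfield_diff)

lemma poly_over_smult: "c \<in> F \<Longrightarrow> poly_over F f \<Longrightarrow> poly_over F (smult c f)"
  by (auto simp: poly_over_def intro: subfield_mult)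

lemma poly_over_monom: "c \<in> F \<Longrightarrow> poly_over F (monom c n)"
  by (auto simp: poly_over_def subfield_0)

lemma poly_over_mult: "poly_over F f \<Longrightarrow> poly_over F g \<Longrightarrow> poly_over F (f * g)"
  by (auto simp: poly_over_def coeff_mult intro!: subfield_sum subfield_mult)

lemma poly_over_poly: "poly_over F f \<Longrightarrow> x \<in> F \<Longrightarrow> poly f x \<in> F"
  by (auto simp: poly_altdef poly_over_def intro!: subfield_sum subfield_mult subfield_power)

end

lemma monic_factorization:
  fixes f :: "'a::alg_closed_field poly"
  assumes "lead_coeff f = 1"
  obtains A where "size A = degree f" "\<And>x. poly f x = (\<Prod>a\<in>#A. x - a)"
    "\<And>a. a \<in># A \<Longrightarrow> poly f a = 0"
proof -
  from assms have "f \<noteq> 0" by auto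
  then obtain A where A: "size A = degree f" "f = smult (lead_coeff f) (\<Prod>x\<in>#A. [:-x, 1:])"
    using alg_closed_imp_factorization by blast
  have *: "poly f x = (\<Prod>a\<in>#A. x - a)" for x
    by (subst A(2)) (simp add: assms poly_prod_mset)
  show thesis
  proof (rule that[OF A(1) *])
    fix a assume "a \<in># A"
    then show "poly f a = 0"
      by (auto simp: * prod_mset_zero_iff)
  qed
qed

context Qp_algebraic_closure
begin

lemma absv_0 [simp]: "absv 0 = 0"
  by (simp add: absv_eq_0_iff)

lemma absv_1 [simp]: "absv 1 = 1"
proof -
  have "absv 1 * absv 1 = absv 1" using absv_mult[of 1 1] by simp
  moreover have "absv 1 \<noteq> 0" by (simp add: absv_eq_0_iff)
  ultimately show ?thesis by simp
qed

lemma absv_pos: "x \<noteq> 0 \<Longrightarrow> 0 < absv x"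
  using absv_nonneg[of x] absv_eq_0_iff[of x] by linarith

lemma absv_minus [simp]: "absv (- x) = absv x"
proof -
  have "absv (-1) * absv (-1) = 1" using absv_mult[of "-1" "-1"] by simp
  then have "absv (-1) = 1" using absv_nonneg[of "-1"]
    by (simp add: square_eq_1_iff)
  then show ?thesis using absv_mult[of "-1" x] by simp
qed

lemma absv_diff_commute: "absv (x - y) = absv (y - x)"
  using absv_minus[of "x - y"] by simp

lemma absv_diff_le_max: "absv (x - y) \<le> max (absv x) (absv y)"
  using absv_add_le_max[of x "- y"] by simp

lemma absv_ultrametric: "absv (x - z) \<le> max (absv (x - y)) (absv (y - z))"
  using absv_add_le_max[of "x - y" "y - z"] by simp

lemma absv_power: "absv (x ^ n) = absv x ^ n"
  by (induction n) (auto simp: absv_mult)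

lemma absv_inverse: "absv (inverse x) = inverse (absv x)"
proof (cases "x = 0")
  case False
  then have "absv x * absv (inverse x) = 1" using absv_mult[of x "inverse x"] by simp
  then show ?thesis by (metis inverse_unique)
qed auto

lemma absv_divide: "absv (x / y) = absv x / absv y"
  by (simp add: divide_inverse absv_mult absv_inverse)

lemma absv_prod_mset: "absv (prod_mset A) = prod_mset (image_mset absv A)"
  by (induction A) (auto simp: absv_mult)

lemma absv_prod: "absv (prod f A) = (\<Prod>x\<in>A. absv (f x))"
  by (induction A rule: infinite_finite_induct) (auto simp: absv_mult)

lemma absv_eq_of_diff_less: "absv (x - y) < absv x \<Longrightarrow> absv y = absv x"
  using absv_add_le_max[of "x - y" y] absv_diff_le_max[of x "x - y"] by auto

lemma absv_sum_le: "0 \<le> c \<Longrightarrow> (\<And>i. i \<in> I \<Longrightarrow> absv (f i) \<le> c) \<Longrightarrow> absv (\<Sum>i\<in>I. f i) \<le> c"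
proof (induction I rule: infinite_finite_induct)
  case (insert i I)
  then have "absv (sum f I) \<le> c" "absv (f i) \<le> c" by auto
  then show ?case using insert(1,2) absv_add_le_max[of "f i" "sum f I"] by simp
qed auto

lemma absv_of_nat_le_1: "absv (of_nat n) \<le> 1"
proof (induction n)
  case (Suc n)
  then show ?case using absv_add_le_max[of 1 "of_nat n"] by auto
qed auto

lemma absv_of_int_le_1: "absv (of_int n) \<le> 1"
  using absv_of_nat_le_1[of "nat \<bar>n\<bar>"] by (cases "n \<ge> 0") auto

lemma p_gt_1: "1 < p"
  using prime_p prime_gt_1_nat by blast

lemma absv_p_pos: "0 < absv (of_nat p)" and absv_p_less_1: "absv (of_nat p) < 1"
  using p_gt_1 by (auto simp: absv_p)

lemma absv_of_nat_not_dvd: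
  assumes "\<not> p dvd n"
  shows "absv (of_nat n) = 1"
proof (rule ccontr)
  assume "absv (of_nat n) \<noteq> 1"
  then have less: "absv (of_nat n) < 1" using absv_of_nat_le_1[of n] by simp
  have "coprime (int n) (int p)"
    using assms prime_p by (metis coprime_commute coprime_int_iff prime_imp_coprime)
  then obtain u v where "u * int n + v * int p = 1"
    using bezout_int[of "int n" "int p"] by auto
  then have "(1::'a) = of_int u * of_nat n + of_int v * of_nat p"
    by (metis of_int_1 of_int_add of_int_mult of_int_of_nat_eq)
  then have "1 \<le> max (absv (of_int u * of_nat n)) (absv (of_int v * of_nat p))"
    by (metis absv_1 absv_add_le_max)
  moreover have "absv (of_int u * of_nat n) \<le> absv (of_nat n)"
      "absv (of_int v * of_nat p) \<le> absv (of_nat p)"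
    by (auto simp: absv_mult absv_of_int_le_1 absv_nonneg mult_left_le_one_le)
  ultimately show False using less absv_p_less_1 by linarith
qed

lemma absv_of_nat:
  assumes "0 < n"
  obtains k where "absv (of_nat n) = (1 / real p) ^ k"
proof -
  have "\<not> is_unit p" using prime_p by auto
  then obtain m where m: "n = p ^ multiplicity p n * m" "\<not> p dvd m"
    using assms multiplicity_decompose'[of n p] by (metis less_numeral_extra(3))
  have "absv (of_nat n) = absv (of_nat (p ^ multiplicity p n * m))" using m by simp
  also have "\<dots> = absv (of_nat p) ^ multiplicity p n * absv (of_nat m)"
    by (simp add: absv_mult absv_power del: absv_p)
  finally show thesis using that absv_of_nat_not_dvd[OF m(2)] absv_p by auto
qed

lemma absv_of_int:
  assumes "n \<noteq> 0"
  obtains k where "absv (of_int n) = (1 / real p) ^ k"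
proof -
  have "absv (of_int n) = absv (of_nat (nat \<bar>n\<bar>))" by (cases "n \<ge> 0") auto
  moreover have "0 < nat \<bar>n\<bar>" using assms by simp
  ultimately show thesis using absv_of_nat that by metis
qed

lemma absv_of_int_dvd:
  assumes "int p ^ k dvd n"
  shows "absv (of_int n) \<le> (1 / real p) ^ k"
proof -
  from assms obtain m where "n = int p ^ k * m" by auto
  then have "absv (of_int n) = absv (of_nat p) ^ k * absv (of_int m)"
    by (simp add: absv_mult absv_power)
  also have "\<dots> \<le> absv (of_nat p) ^ k"
    using absv_of_int_le_1 absv_nonneg by (simp add: mult_left_le)
  finally show ?thesis by (simp add: absv_p)
qed

lemma Qp_of_rat: "of_rat q \<in> Qp absv"
  unfolding Qp_def by (auto intro!: exI[of _ q])

lemma Qp_absv: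
  assumes "x \<in> Qp absv" "x \<noteq> 0"
  obtains k :: int where "absv x = real p powi k"
proof -
  obtain q where q: "absv (x - of_rat q) < absv x"
    using assms absv_pos[of x] unfolding Qp_def by blast
  then have eq: "absv x = absv (of_rat q)" using absv_eq_of_diff_less by metis
  obtain u v where uv: "quotient_of q = (u, v)" by force
  then have "v > 0" using quotient_of_denom_pos by blast
  have q: "(of_rat q :: 'a) = of_int u / of_int v"
    by (simp add: quotient_of_div[OF uv] of_rat_divide)
  have "u \<noteq> 0"
  proof
    assume "u = 0"
    then have "absv x = 0" using eq q by simp
    then show False using assms absv_eq_0_iff by blast
  qed
  obtain i where i: "absv (of_int u) = (1 / real p) ^ i" using absv_of_int \<open>u \<noteq> 0\<close> by metis
  obtain j where j: "absv (of_int v) = (1 / real p) ^ j" using absv_of_int \<open>v > 0\<close> by (metis less_irrefl)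
  have "absv x = real p powi (int j - int i)"
    using p_gt_1 by (simp add: eq q absv_divide i j power_int_diff power_one_over field_simps)
  then show thesis by (rule that)
qed

lemma Qp_approx:
  assumes "x \<in> Qp absv" "0 < e"
  obtains q where "absv (x - of_rat q) < e"
  using assms unfolding Qp_def by blast

lemma Qp_diff: "x \<in> Qp absv \<Longrightarrow> y \<in> Qp absv \<Longrightarrow> x - y \<in> Qp absv"
  unfolding Qp_def
proof safe
  fix e :: real assume *: "\<forall>e>0. \<exists>q. absv (x - of_rat q) < e" "\<forall>e>0. \<exists>q. absv (y - of_rat q) < e" "0 < e"
  then obtain q q' where "absv (x - of_rat q) < e" "absv (y - of_rat q') < e" by blast
  moreover have eq: "x - y - of_rat (q - q') = (x - of_rat q) - (y - of_rat q')"
    by (simp add: of_rat_diff)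
  ultimately have "absv (x - y - of_rat (q - q')) < e"
    unfolding eq using absv_diff_le_max[of "x - of_rat q" "y - of_rat q'"] by simp
  then show "\<exists>q. absv (x - y - of_rat q) < e" by blast
qed

lemma Qp_mult:
  assumes "x \<in> Qp absv" "y \<in> Qp absv"
  shows "x * y \<in> Qp absv"
  unfolding Qp_def
proof safe
  fix e :: real assume "0 < e"
  define C where "C = 1 + absv x + absv y"
  have C: "C > 0" "absv x < C" "absv y < C" "1 \<le> C"
    using absv_nonneg[of x] absv_nonneg[of y] by (auto simp: C_def)
  obtain q where q: "absv (x - of_rat q) < min 1 (e / C)"
    using Qp_approx[OF assms(1), of "min 1 (e / C)"] \<open>0 < e\<close> C by auto
  obtain q' where q': "absv (y - of_rat q') < e / C"
    using Qp_approx[OF assms(2), of "e / C"] \<open>0 < e\<close> C by auto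
  have "absv (of_rat q) \<le> C"
    using absv_diff_le_max[of x "x - of_rat q"] q C by auto
  then have "absv (of_rat q * (y - of_rat q')) \<le> C * absv (y - of_rat q')"
    by (simp add: absv_mult absv_nonneg mult_right_mono)
  also have "\<dots> < e" using q' C by (simp add: field_simps)
  finally have 1: "absv (of_rat q * (y - of_rat q')) < e" .
  have "absv ((x - of_rat q) * y) \<le> absv (x - of_rat q) * C"
    using C by (simp add: absv_mult absv_nonneg mult_left_mono)
  also have "\<dots> < e" using q C by (simp add: field_simps)
  finally have 2: "absv ((x - of_rat q) * y) < e" .
  have "x * y - of_rat (q * q') = (x - of_rat q) * y + of_rat q * (y - of_rat q')"
    by (simp add: algebra_simps of_rat_mult)
  then have "absv (x * y - of_rat (q * q')) < e"
    using absv_add_le_max[of "(x - of_rat q) * y" "of_rat q * (y - of_rat q')"] 1 2 by simp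
  then show "\<exists>q. absv (x * y - of_rat q) < e" by blast
qed

lemma Qp_inverse:
  assumes "x \<in> Qp absv"
  shows "inverse x \<in> Qp absv"
proof (cases "x = 0")
  case False
  show ?thesis
    unfolding Qp_def
  proof safe
    fix e :: real assume "0 < e"
    have x: "absv x > 0" using False absv_pos by simp
    then obtain q where q: "absv (x - of_rat q) < min (absv x) (e * (absv x)\<^sup>2)"
      using Qp_approx[OF assms, of "min (absv x) (e * (absv x)\<^sup>2)"] \<open>0 < e\<close> by auto
    then have eq: "absv (of_rat q) = absv x" using absv_eq_of_diff_less[of x "of_rat q"] by simp
    then have "(of_rat q :: 'a) \<noteq> 0" using x by auto
    then have "inverse x - of_rat (inverse q) = - (x - of_rat q) / (x * of_rat q)"
      using False unfolding of_rat_inverse by (simp add: divide_simps)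
    then have "absv (inverse x - of_rat (inverse q)) = absv (x - of_rat q) / (absv x)\<^sup>2"
      by (simp add: absv_divide absv_mult eq power2_eq_square absv_diff_commute del: minus_diff_eq)
    also have "\<dots> < e" using q x by (simp add: field_simps)
    finally show "\<exists>q. absv (inverse x - of_rat q) < e" by blast
  qed
qed (use Qp_of_rat[of 0] in simp)

lemma Qp_subfield: "is_subfield (Qp absv)"
  unfolding is_subfield_def
  using Qp_diff Qp_mult Qp_inverse Qp_of_rat[of 0] Qp_of_rat[of 1] by auto

lemma Qp_approx_nat:
  assumes "x \<in> Qp absv" "absv x \<le> 1"
  obtains n where "n < p ^ k" "absv (x - of_nat n) \<le> (1 / real p) ^ k"
proof -
  have ppos: "(1 / real p) ^ k > 0" using p_gt_1 by simp
  have ple: "(1 / real p) ^ k \<le> 1" using p_gt_1 by (simp add: power_le_one)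
  from assms(1) obtain q where q: "absv (x - of_rat q) < (1 / real p) ^ k"
    using ppos unfolding Qp_def by blast
  have q1: "absv (of_rat q) \<le> 1"
    using absv_diff_le_max[of x "x - of_rat q"] q assms(2) ple by auto
  obtain u v where uv: "quotient_of q = (u, v)" by force
  then have "v > 0" using quotient_of_denom_pos by blast
  have cop: "coprime u v" using uv quotient_of_coprime by blast
  have qeq: "(of_rat q :: 'a) = of_int u / of_int v"
    by (simp add: quotient_of_div[OF uv] of_rat_divide)
  have ndvd: "\<not> int p dvd v"
  proof
    assume "int p dvd v"
    then have "absv (of_int v) < 1" using absv_of_int_dvd[of 1 v] p_gt_1
      by (smt (verit) absv_p absv_p_less_1 power_one_right)
    moreover have "\<not> int p dvd u"
      using cop \<open>int p dvd v\<close> prime_p by (metis coprime_common_divisor not_prime_unit prime_nat_int_transfer)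
    then have "absv (of_nat (nat \<bar>u\<bar>)) = 1"
      by (intro absv_of_nat_not_dvd) (simp add: nat_abs_dvd_iff dvd_nat_abs_iff)
    then have "absv (of_int u) = 1" by (cases "u \<ge> 0") auto
    moreover have "absv (of_int v) > 0" using \<open>v > 0\<close> absv_pos[of "of_int v"] by simp
    ultimately show False using q1 by (simp add: qeq absv_divide field_simps)
  qed
  then have v1: "absv (of_int v) = 1"
    using absv_of_nat_not_dvd[of "nat v"] \<open>v > 0\<close> int_dvd_int_iff[of p "nat v"] by simp
  have "coprime v (int p ^ k)"
    using ndvd prime_p by (metis coprime_commute coprime_power_left_iff prime_imp_coprime prime_nat_int_transfer)
  then obtain a b where ab: "a * v + b * int p ^ k = 1"
    using bezout_int[of v "int p ^ k"] by auto
  define n where "n = nat ((u * a) mod (int p ^ k))"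
  have pk: "int p ^ k > 0" using p_gt_1 by simp
  have n: "int n = (u * a) mod (int p ^ k)" using pk by (simp add: n_def)
  have "n < p ^ k" using pk n by (metis of_nat_less_iff of_nat_power pos_mod_bound)
  have dvd: "int p ^ k dvd u * a - int n" by (simp add: n)
  have "u - int n * v = u * (a * v + b * int p ^ k) - int n * v"
    by (simp add: ab)
  also have "\<dots> = u * (b * int p ^ k) + (u * a - int n) * v"
    by (simp add: algebra_simps)
  finally have "u - int n * v = u * (b * int p ^ k) + (u * a - int n) * v" .
  then have "int p ^ k dvd u - int n * v" using dvd by simp
  from absv_of_int_dvd[OF this]
  have "absv (of_int u - of_nat n * of_int v) \<le> (1 / real p) ^ k" by simp
  moreover have "(of_rat q :: 'a) - of_nat n = (of_int u - of_nat n * of_int v) / of_int v"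
    using \<open>v > 0\<close> unfolding qeq by (simp add: diff_divide_distrib)
  ultimately have "absv (of_rat q - of_nat n :: 'a) \<le> (1 / real p) ^ k"
    by (simp add: absv_divide v1)
  then have "absv (x - of_nat n) \<le> (1 / real p) ^ k"
    using absv_ultrametric[of x "of_nat n" "of_rat q"] q by simp
  with \<open>n < p ^ k\<close> show thesis by (rule that)
qed

end

section \<open>Extension of partial homomorphisms\<close>

definition hom_graph :: "'a::field set \<Rightarrow> ('a \<times> 'a) set \<Rightarrow> bool" where
  "hom_graph F G \<longleftrightarrow> (\<forall>e\<in>F. (e, e) \<in> G) \<and>
    (\<forall>x y x' y'. (x, y) \<in> G \<longrightarrow> (x', y') \<in> G \<longrightarrow> (x - x', y - y') \<in> G \<and> (x * x', y * y') \<in> G) \<and>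
    (\<forall>y. (0, y) \<in> G \<longrightarrow> y = 0)"

definition coeffs_related :: "('a::zero \<times> 'a) set \<Rightarrow> 'a poly \<Rightarrow> 'a poly \<Rightarrow> bool" where
  "coeffs_related G f g \<longleftrightarrow> (\<forall>i. (coeff f i, coeff g i) \<in> G)"

context
  fixes F :: "'a::{alg_closed_field, field_char_0} set"
  assumes F: "is_subfield F"
    and alg: "\<And>x. \<exists>f. f \<noteq> 0 \<and> poly_over F f \<and> poly f x = 0"
begin

lemmas F_01 = subfield_0[OF F] subfield_1[OF F]

lemmas F_closed = subfield_diff[OF F] subfield_mult[OF F] subfield_inverse[OF F]

lemma inverse_as_poly:
  assumes "x \<noteq> 0"
  obtains r where "poly_over F r" "poly r x = inverse x"
proof -
  have "\<exists>h. poly_over F h \<and> poly h x = 0 \<and> coeff h 0 \<noteq> 0" if "poly_over F f" "f \<noteq> 0" "poly f x = 0" for f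
    using that
  proof (induction f)
    case (pCons c f)
    have f: "poly_over F f" using pCons.prems(1)
      by (metis poly_over_def coeff_pCons_Suc)
    show ?case
    proof (cases "c = 0")
      case True
      then show ?thesis using pCons.IH[OF f] pCons.prems \<open>x \<noteq> 0\<close> by auto
    next
      case False
      then show ?thesis using pCons.prems by (intro exI[of _ "pCons c f"]) auto
    qed
  qed auto
  with alg[of x] obtain h where h: "poly_over F h" "poly h x = 0" "coeff h 0 \<noteq> 0" by blast
  obtain c h' where hh: "h = pCons c h'" by (cases h)
  have c: "c \<noteq> 0" "c \<in> F" using h hh by (auto simp: poly_over_def dest: spec[of _ 0])
  have h': "poly_over F h'" using h(1) unfolding hh by (metis poly_over_def coeff_pCons_Suc)
  have "- inverse c \<in> F" using F_closed(1)[OF F_01(1) F_closed(3)[OF c(2)]] by simp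
  then have "poly_over F (smult (- inverse c) h')"
    using h' F_closed(2)[of "- inverse c"] unfolding poly_over_def coeff_smult by blast
  moreover have "poly (smult (- inverse c) h') x = inverse x"
  proof -
    have "x * poly h' x = - c" using h(2) hh by (simp add: eq_neg_iff_add_eq_0 add.commute)
    then have "poly h' x = - c / x" using assms by (simp add: field_simps)
    then show ?thesis using c assms by (simp add: field_simps)
  qed
  ultimately show thesis by (rule that)
qed

context
  fixes G :: "('a \<times> 'a) set"
  assumes G: "hom_graph F G"
begin

lemma graph_refl: "e \<in> F \<Longrightarrow> (e, e) \<in> G"
  and graph_diff: "(x, y) \<in> G \<Longrightarrow> (x', y') \<in> G \<Longrightarrow> (x - x', y - y') \<in> G"
  and graph_mult: "(x, y) \<in> G \<Longrightarrow> (x', y') \<in> G \<Longrightarrow> (x * x', y * y') \<in> G"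
  and graph_zero: "(0, y) \<in> G \<Longrightarrow> y = 0"
  using G unfolding hom_graph_def by blast+

lemma graph_add:
  assumes "(x, y) \<in> G" "(x', y') \<in> G"
  shows "(x + x', y + y') \<in> G"
  using graph_diff[OF assms(1) graph_diff[OF graph_refl[OF F_01(1)] assms(2)]] by simp

lemma graph_fun: "(x, y) \<in> G \<Longrightarrow> (x, y') \<in> G \<Longrightarrow> y = y'"
  using graph_diff[of x y x y'] graph_zero[of "y - y'"] by simp

lemma graph_sum: "(\<And>i. i \<in> I \<Longrightarrow> (f i, g i) \<in> G) \<Longrightarrow> (\<Sum>i\<in>I. f i, \<Sum>i\<in>I. g i) \<in> G"
  by (induction I rule: infinite_finite_induct) (auto intro: graph_add graph_refl F_01)

lemma graph_power: "(x, y) \<in> G \<Longrightarrow> (x ^ n, y ^ n) \<in> G"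
  by (induction n) (auto intro: graph_mult graph_refl F_01)

lemma coeffs_related_diff:
  "coeffs_related G f g \<Longrightarrow> coeffs_related G f' g' \<Longrightarrow> coeffs_related G (f - f') (g - g')"
  by (auto simp: coeffs_related_def intro: graph_diff)

lemma coeffs_related_mult:
  "coeffs_related G f g \<Longrightarrow> coeffs_related G f' g' \<Longrightarrow> coeffs_related G (f * f') (g * g')"
  by (auto simp: coeffs_related_def coeff_mult intro!: graph_sum graph_mult)

lemma coeffs_related_monom: "(c, c') \<in> G \<Longrightarrow> coeffs_related G (monom c n) (monom c' n)"
  by (auto simp: coeffs_related_def graph_refl F_01)

lemma coeffs_related_smult:
  "(c, c') \<in> G \<Longrightarrow> coeffs_related G f g \<Longrightarrow> coeffs_related G (smult c f) (smult c' g)"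
  by (auto simp: coeffs_related_def intro: graph_mult)

lemma coeffs_related_refl: "poly_over F f \<Longrightarrow> coeffs_related G f f"
  by (auto simp: coeffs_related_def poly_over_def intro: graph_refl)

lemma graph_poly:
  assumes "poly_over F r" "(x, y) \<in> G"
  shows "(poly r x, poly r y) \<in> G"
  unfolding poly_altdef using assms
  by (auto intro!: graph_sum graph_mult graph_power graph_refl simp: poly_over_def)

lemma graph_inverse:
  assumes "(x, y) \<in> G" "x \<noteq> 0"
  obtains z where "(inverse x, z) \<in> G" "y * z = 1"
proof -
  obtain r where "poly_over F r" "poly r x = inverse x" using inverse_as_poly assms by blast
  then have z: "(inverse x, poly r y) \<in> G" using graph_poly assms by metis
  have "(1, y * poly r y) \<in> G" using graph_mult[OF assms(1) z] assms(2) by simp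
  then have "y * poly r y = 1" using graph_fun graph_refl[OF F_01(2)] by blast
  with z show thesis by (rule that)
qed

lemma hom_graph_adjoin:
  assumes PQ: "coeffs_related G P Q" and P: "lead_coeff P = 1"
    and min: "\<And>f g. coeffs_related G f g \<Longrightarrow> lead_coeff f = 1 \<Longrightarrow> poly f a = 0 \<Longrightarrow> degree P \<le> degree f"
    and root: "poly P a = 0" "poly Q b = 0"
  obtains G' where "hom_graph F G'" "G \<subseteq> G'" "(a, b) \<in> G'"
proof -
  define G' where "G' = {(poly f a, poly g b) | f g. coeffs_related G f g}"
  have zero: "poly g b = 0"
    if "coeffs_related G f g" "\<And>i. i \<ge> n \<Longrightarrow> coeff f i = 0" "poly f a = 0" for f g n
    using that
  proof (induction n arbitrary: f g)
    case 0
    then have "\<And>i. coeff g i = 0"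
      unfolding coeffs_related_def using graph_zero by (metis le0)
    then have "g = 0" by (simp add: poly_eq_iff)
    then show ?case by simp
  next
    case (Suc n)
    define c where "c = coeff f n"
    show ?case
    proof (cases "c = 0")
      case True
      then have "coeff f i = 0" if "i \<ge> n" for i
        using that Suc.prems(2)[of i] by (cases "i = n") (auto simp: c_def)
      then show ?thesis using Suc.IH[of f g] Suc.prems by blast
    next
      case False
      have deg: "degree f = n"
      proof (rule antisym)
        show "degree f \<le> n" using Suc.prems(2) by (intro degree_le) auto
        show "n \<le> degree f" using False by (intro le_degree) (auto simp: c_def)
      qed
      define c' where "c' = coeff g n"
      have cc: "(c, c') \<in> G" using Suc.prems(1) by (auto simp: coeffs_related_def c_def c'_def)
      obtain z where z: "(inverse c, z) \<in> G" using graph_inverse[OF cc False] by blast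
      have "degree P \<le> n"
      proof -
        have "degree P \<le> degree (smult (inverse c) f)"
        proof (rule min)
          show "coeffs_related G (smult (inverse c) f) (smult z g)"
            using coeffs_related_smult[OF z Suc.prems(1)] .
        qed (use Suc.prems False deg in \<open>auto simp: c_def\<close>)
        then show ?thesis using deg False by simp
      qed
      define k where "k = n - degree P"
      define f1 where "f1 = f - monom c k * P"
      define g1 where "g1 = g - monom c' k * Q"
      have r1: "coeffs_related G f1 g1" unfolding f1_def g1_def
        using coeffs_related_diff[OF Suc.prems(1) coeffs_related_mult[OF coeffs_related_monom[OF cc] PQ]] .
      have "coeff f1 i = 0" if "i \<ge> n" for i
      proof (cases "i = n")
        case True
        have "coeff (monom c k * P) n = c"
          using P \<open>degree P \<le> n\<close> by (simp add: coeff_monom_mult k_def)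
        then show ?thesis using True by (simp add: f1_def c_def)
      next
        case False
        then have "degree (monom c k * P) < i"
          using degree_mult_le[of "monom c k" P] degree_monom_le[of c k] that \<open>degree P \<le> n\<close> k_def by linarith
        then have "coeff (monom c k * P) i = 0" by (rule coeff_eq_0)
        then show ?thesis using Suc.prems(2)[of i] that False by (simp add: f1_def)
      qed
      moreover have "poly f1 a = 0" using Suc.prems root by (simp add: f1_def)
      ultimately have "poly g1 b = 0" using Suc.IH[of f1 g1] r1 by blast
      then show ?thesis using root by (simp add: g1_def)
    qed
  qed
  have "hom_graph F G'"
    unfolding hom_graph_def
  proof (intro conjI allI impI ballI)
    fix e assume "e \<in> F"
    then have "coeffs_related G [:e:] [:e:]"
      using graph_refl F_01 by (auto simp: coeffs_related_def coeff_pCons split: nat.split)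
    then show "(e, e) \<in> G'" unfolding G'_def by force
  next
    fix x y x' y' assume "(x, y) \<in> G'" "(x', y') \<in> G'"
    then obtain f g f' g' where *: "x = poly f a" "y = poly g b" "x' = poly f' a" "y' = poly g' b"
      "coeffs_related G f g" "coeffs_related G f' g'"
      unfolding G'_def by blast
    show "(x - x', y - y') \<in> G'"
      unfolding G'_def mem_Collect_eq using coeffs_related_diff[OF *(5,6)] *(1-4)
      by (intro exI[of _ "f - f'"] exI[of _ "g - g'"]) simp
    show "(x * x', y * y') \<in> G'"
      unfolding G'_def mem_Collect_eq using coeffs_related_mult[OF *(5,6)] *(1-4)
      by (intro exI[of _ "f * f'"] exI[of _ "g * g'"]) simp
  next
    fix y assume "(0, y) \<in> G'"
    then obtain f g where "poly f a = 0" "y = poly g b" "coeffs_related G f g"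
      unfolding G'_def by auto
    moreover have "coeff f i = 0" if "Suc (degree f) \<le> i" for i
      using that by (intro coeff_eq_0) simp
    ultimately show "y = 0" using zero[of f g "Suc (degree f)"] by blast
  qed
  moreover have "G \<subseteq> G'"
  proof clarify
    fix x y assume "(x, y) \<in> G"
    then have "coeffs_related G [:x:] [:y:]"
      using graph_refl F_01 by (auto simp: coeffs_related_def coeff_pCons split: nat.split)
    then show "(x, y) \<in> G'" unfolding G'_def by force
  qed
  moreover have "(a, b) \<in> G'"
  proof -
    have "coeffs_related G [:0, 1:] [:0, 1:]"
      using graph_refl F_01 by (auto simp: coeffs_related_def coeff_pCons split: nat.split)
    then show ?thesis unfolding G'_def by force
  qed
  ultimately show thesis by (rule that)
qed

lemma hom_graph_extend:
  obtains b G' where "hom_graph F G'" "G \<subseteq> G'" "(a, b) \<in> G'"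
proof -
  define R where "R f \<longleftrightarrow> lead_coeff f = 1 \<and> poly f a = 0 \<and> (\<exists>g. coeffs_related G f g)" for f
  obtain f where f: "f \<noteq> 0" "poly_over F f" "poly f a = 0" using alg by blast
  then have "R (smult (inverse (lead_coeff f)) f)"
  proof -
    have "poly_over F (smult (inverse (lead_coeff f)) f)"
      using f F_closed by (auto simp: poly_over_def)
    then show ?thesis using f coeffs_related_refl unfolding R_def by (auto intro!: exI)
  qed
  then obtain P where P: "R P" "\<And>f. R f \<Longrightarrow> degree P \<le> degree f"
    using ex_has_least_nat[of R _ degree] by metis
  then obtain Q where Q: "coeffs_related G P Q" by (auto simp: R_def)
  have P1: "lead_coeff P = 1" using P by (simp add: R_def)
  have "degree P \<noteq> 0"
  proof
    assume "degree P = 0"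
    then obtain c where "P = [:c:]" by (elim degree_eq_zeroE)
    with P(1) show False by (auto simp: R_def)
  qed
  have "coeff Q (degree P) = 1"
    using Q P1 graph_fun[OF _ graph_refl[OF F_01(2)]] unfolding coeffs_related_def by metis
  then have "degree P \<le> degree Q" by (intro le_degree) simp
  then obtain b where "poly Q b = 0"
    using alg_closed_imp_poly_has_root[of Q] \<open>degree P \<noteq> 0\<close> by auto
  then show thesis
    using hom_graph_adjoin[OF Q P1 _ _ ] P that unfolding R_def by (metis (no_types, lifting))
qed

end

lemma hom_graph_automorphism:
  assumes "hom_graph F G\<^sub>0"
  obtains \<sigma> where "\<sigma> \<in> Gal F" "\<And>x y. (x, y) \<in> G\<^sub>0 \<Longrightarrow> \<sigma> x = y"
proof -
  define A where "A = {G. hom_graph F G \<and> G\<^sub>0 \<subseteq> G}"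
  have "\<exists>M\<in>A. \<forall>X\<in>A. M \<subseteq> X \<longrightarrow> X = M"
  proof (rule subset_Zorn_nonempty)
    show "A \<noteq> {}" using assms by (auto simp: A_def)
  next
    fix C assume C: "C \<noteq> {}" "subset.chain A C"
    then have CA: "\<And>G. G \<in> C \<Longrightarrow> hom_graph F G \<and> G\<^sub>0 \<subseteq> G"
      unfolding subset_chain_def A_def by auto
    have "hom_graph F (\<Union>C)"
      unfolding hom_graph_def
    proof (intro conjI allI impI ballI)
      fix e assume "e \<in> F"
      then show "(e, e) \<in> \<Union>C" using C(1) CA unfolding hom_graph_def by blast
    next
      fix x y x' y' assume "(x, y) \<in> \<Union>C" "(x', y') \<in> \<Union>C"
      then obtain G H where "G \<in> C" "(x, y) \<in> G" "H \<in> C" "(x', y') \<in> H" by blast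
      then obtain K where K: "K \<in> C" "(x, y) \<in> K" "(x', y') \<in> K"
        using C(2) unfolding subset_chain_def by blast
      then show "(x - x', y - y') \<in> \<Union>C" "(x * x', y * y') \<in> \<Union>C"
        using graph_diff[of K] graph_mult[of K] CA[of K] by blast+
    next
      fix y assume "(0, y) \<in> \<Union>C"
      then show "y = 0" using CA graph_zero by blast
    qed
    then show "\<Union>C \<in> A" using C(1) CA by (auto simp: A_def)
  qed
  then obtain M where MA: "M \<in> A" and max: "\<And>X. X \<in> A \<Longrightarrow> M \<subseteq> X \<Longrightarrow> X = M"
    by auto
  then have M: "hom_graph F M" "G\<^sub>0 \<subseteq> M" by (simp_all add: A_def)
  have total: "\<exists>y. (x, y) \<in> M" for x
  proof -
    obtain b G' where G': "hom_graph F G'" "M \<subseteq> G'" "(x, b) \<in> G'"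
      by (rule hom_graph_extend[OF M(1), of x])
    then have "G' \<in> A" using M(2) by (auto simp: A_def)
    then have "G' = M" using max G'(2) by blast
    with G'(3) show ?thesis by blast
  qed
  define \<sigma> where "\<sigma> x = (SOME y. (x, y) \<in> M)" for x
  have \<sigma>: "(x, \<sigma> x) \<in> M" for x
    unfolding \<sigma>_def using total by (rule someI_ex)
  have \<sigma>I: "(x, y) \<in> M \<Longrightarrow> \<sigma> x = y" for x y
    using graph_fun[OF M(1)] \<sigma> by blast
  have add: "\<sigma> (x + y) = \<sigma> x + \<sigma> y" for x y using \<sigma>I graph_add[OF M(1)] \<sigma> by blast
  have diff: "\<sigma> (x - y) = \<sigma> x - \<sigma> y" for x y using \<sigma>I graph_diff[OF M(1)] \<sigma> by blast
  have mult: "\<sigma> (x * y) = \<sigma> x * \<sigma> y" for x y using \<sigma>I graph_mult[OF M(1)] \<sigma> by blast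
  have fixF: "\<sigma> x = x" if "x \<in> F" for x using \<sigma>I graph_refl[OF M(1) that] by blast
  have inj: "inj \<sigma>"
  proof (rule injI, rule ccontr)
    fix x y assume *: "\<sigma> x = \<sigma> y" "x \<noteq> y"
    obtain z where "\<sigma> (x - y) * z = 1"
      using graph_inverse[OF M(1) \<sigma>[of "x - y"]] * by auto
    then show False using * diff by simp
  qed
  have "surj \<sigma>"
    unfolding surj_def
  proof
    fix y
    obtain f where f: "f \<noteq> 0" "poly_over F f" "poly f y = 0" using alg by blast
    define S where "S = {x. poly f x = 0}"
    have "finite S" unfolding S_def using f poly_roots_finite by blast
    have "\<sigma> ` S \<subseteq> S"
    proof clarify
      fix x assume "x \<in> S"
      then have "(0, poly f (\<sigma> x)) \<in> M" using graph_poly[OF M(1) f(2) \<sigma>[of x]] by (simp add: S_def)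
      then show "\<sigma> x \<in> S" using graph_zero[OF M(1)] by (simp add: S_def)
    qed
    then have "\<sigma> ` S = S"
      using \<open>finite S\<close> inj by (meson endo_inj_surj inj_on_subset subset_UNIV)
    moreover have "y \<in> S" using f by (simp add: S_def)
    ultimately show "\<exists>x. y = \<sigma> x" by blast
  qed
  with inj have "bij \<sigma>" by (simp add: bij_def)
  then have "\<sigma> \<in> Gal F" using add mult fixF by (auto simp: Gal_def)
  then show thesis using that \<sigma>I M(2) by blast
qed

lemma fixed_by_Gal:
  assumes "\<And>\<sigma>. \<sigma> \<in> Gal F \<Longrightarrow> \<sigma> w = w"
  shows "w \<in> F"
proof -
  define R where "R f \<longleftrightarrow> lead_coeff f = 1 \<and> poly f w = 0 \<and> poly_over F f" for f
  have Id: "hom_graph F {(e, e) | e. e \<in> F}"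
    using F_01 F_closed by (auto simp: hom_graph_def)
  obtain f where f: "f \<noteq> 0" "poly_over F f" "poly f w = 0" using alg by blast
  then have "R (smult (inverse (lead_coeff f)) f)"
    using F_closed unfolding R_def by (auto simp: poly_over_def)
  then obtain P where P: "R P" "\<And>f. R f \<Longrightarrow> degree P \<le> degree f"
    using ex_has_least_nat[of R _ degree] by metis
  have rel: "coeffs_related {(e, e) | e. e \<in> F} P P"
    using P by (auto simp: R_def coeffs_related_def poly_over_def)
  have "b = w" if b: "poly P b = 0" for b
  proof -
    obtain G' where G': "hom_graph F G'" "(w, b) \<in> G'"
    proof (rule hom_graph_adjoin[OF Id rel _ _ _ b, of w])
      fix f g assume "coeffs_related {(e, e) | e. e \<in> F} f g" "lead_coeff f = 1" "poly f w = 0"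
      then have "R f" by (force simp: R_def coeffs_related_def poly_over_def)
      then show "degree P \<le> degree f" by (rule P(2))
    qed (use P in \<open>auto simp: R_def\<close>)
    then show ?thesis using hom_graph_automorphism[OF G'(1)] assms by metis
  qed
  then have roots: "\<And>a. poly P a = 0 \<Longrightarrow> a = w" .
  have P1: "lead_coeff P = 1" using P by (simp add: R_def)
  then have P0: "P \<noteq> 0" by auto
  define n where "n = degree P"
  obtain A where A: "size A = n" "P = (\<Prod>x\<in>#A. [:-x, 1:])"
    using alg_closed_imp_factorization[OF P0] P1 unfolding n_def by auto
  have "a = w" if "a \<in># A" for a
    using that by (intro roots, subst A(2)) (auto simp: poly_prod_mset prod_mset_zero_iff)
  then have "A = replicate_mset n w"
    using A(1) by (metis set_mset_subset_singletonD singleton_iff subsetI)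
  then have Pw: "P = [:-w, 1:] ^ n" using A(2) by simp
  have "n \<noteq> 0"
  proof
    assume "n = 0"
    then show False using P(1) Pw by (simp add: R_def)
  qed
  have "coeff ([:-w, 1:] ^ n) (n - 1) = - of_nat n * w" if "n \<noteq> 0" for n
    using that
  proof (induction n)
    case (Suc n)
    show ?case
    proof (cases n)
      case (Suc k)
      have "coeff ([:-w, 1:] ^ n) n = 1"
        using coeff_linear_power[of "-w" n] by simp
      then show ?thesis using Suc.IH Suc by (simp add: algebra_simps)
    qed simp
  qed simp
  then have "- of_nat n * w \<in> F"
    using P(1) Pw \<open>n \<noteq> 0\<close> unfolding R_def poly_over_def by metis
  moreover have "of_nat n \<in> F" by (rule subfield_of_nat[OF F])
  ultimately have "inverse (of_nat n) * (0 - (- of_nat n * w)) \<in> F"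
    using F_closed F_01 by blast
  moreover have "inverse (of_nat n) * (0 - (- of_nat n * w)) = w"
    using \<open>n \<noteq> 0\<close> by (simp add: field_simps)
  ultimately show "w \<in> F" by (simp only:)
qed

end

section \<open>Invariance of the absolute value under automorphisms\<close>

context Qp_algebraic_closure
begin

lemma Qp_series:
  assumes e: "\<And>k. e k \<in> Qp absv" "\<And>k. absv (e k) \<le> C / 2 ^ k" and "0 < C"
  obtains s where "s \<in> Qp absv" "\<And>k. absv ((\<Sum>l<k. e l) - s) \<le> C / 2 ^ k"
proof -
  define S where "S k = (\<Sum>l<k. e l)" for k
  have S: "S k \<in> Qp absv" for k
    unfolding S_def using e(1) by (intro subfield_sum Qp_subfield)
  have tail: "absv (S m - S k) \<le> C / 2 ^ k" if "k \<le> m" for k m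
  proof -
    have "S m - S k = (\<Sum>l\<in>{k..<m}. e l)"
      unfolding S_def using that by (simp add: lessThan_atLeast0 sum_diff_nat_ivl)
    also have "absv \<dots> \<le> C / 2 ^ k"
    proof (rule absv_sum_le)
      fix l assume "l \<in> {k..<m}"
      then have "C / 2 ^ l \<le> C / 2 ^ k"
        using \<open>0 < C\<close> by (intro divide_left_mono power_increasing) auto
      then show "absv (e l) \<le> C / 2 ^ k" using e(2)[of l] by linarith
    qed (use \<open>0 < C\<close> in simp)
    finally show ?thesis .
  qed
  have "\<exists>s\<in>Qp absv. (\<lambda>n. absv (S n - s)) \<longlonglongrightarrow> 0"
  proof (rule Qp_complete[OF S])
    fix \<epsilon> :: real assume "0 < \<epsilon>"
    then obtain N where N: "C / \<epsilon> < 2 ^ N" using real_arch_pow[of 2 "C / \<epsilon>"] by auto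
    then have N: "C / 2 ^ N < \<epsilon>" using \<open>0 < \<epsilon>\<close> by (simp add: field_simps)
    have "absv (S m - S n) < \<epsilon>" if "m \<ge> N" "n \<ge> N" for m n
      using tail[OF that(1)] tail[OF that(2)] absv_ultrametric[of "S m" "S n" "S N"] N
        absv_diff_commute[of "S N" "S n"] by simp
    then show "\<exists>N. \<forall>m\<ge>N. \<forall>n\<ge>N. absv (S m - S n) < \<epsilon>" by blast
  qed
  then obtain s where s: "s \<in> Qp absv" "(\<lambda>n. absv (S n - s)) \<longlonglongrightarrow> 0" by blast
  have "absv (S k - s) \<le> C / 2 ^ k" for k
  proof -
    have "\<forall>\<^sub>F n in sequentially. absv (S n - s) < C / 2 ^ k"
      using s(2) \<open>0 < C\<close> by (intro order_tendstoD) auto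
    then obtain N where "\<And>n. n \<ge> N \<Longrightarrow> absv (S n - s) < C / 2 ^ k"
      by (auto simp: eventually_sequentially)
    then have "absv (S (max N k) - s) < C / 2 ^ k" by simp
    moreover have "absv (S k - S (max N k)) \<le> C / 2 ^ k"
      using tail[of k "max N k"] by (simp add: absv_diff_commute)
    ultimately show ?thesis using absv_ultrametric[of "S k" s "S (max N k)"] by simp
  qed
  with s(1) show thesis using that unfolding S_def by blast
qed

definition Qp_span :: "(nat \<Rightarrow> 'a) \<Rightarrow> nat \<Rightarrow> 'a set" where
  "Qp_span b n = {x. \<exists>c. (\<forall>i. c i \<in> Qp absv) \<and> x = (\<Sum>i<n. c i * b i)}"

lemma Qp_span_diff:
  assumes "x \<in> Qp_span b n" "y \<in> Qp_span b n"
  shows "x - y \<in> Qp_span b n"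
proof -
  obtain c d where "\<forall>i. c i \<in> Qp absv" "x = (\<Sum>i<n. c i * b i)"
    "\<forall>i. d i \<in> Qp absv" "y = (\<Sum>i<n. d i * b i)"
    using assms unfolding Qp_span_def by blast
  then show ?thesis
    unfolding Qp_span_def mem_Collect_eq
    by (intro exI[of _ "\<lambda>i. c i - d i"]) (auto simp: algebra_simps sum_subtractf intro: Qp_diff)
qed

lemma Qp_span_scale:
  assumes "x \<in> Qp_span b n" "a \<in> Qp absv"
  shows "a * x \<in> Qp_span b n"
proof -
  obtain c where "\<forall>i. c i \<in> Qp absv" "x = (\<Sum>i<n. c i * b i)"
    using assms unfolding Qp_span_def by blast
  then show ?thesis
    unfolding Qp_span_def mem_Collect_eq using assms(2)
    by (intro exI[of _ "\<lambda>i. a * c i"]) (auto simp: algebra_simps sum_distrib_left intro: Qp_mult)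
qed

lemma Qp_span_0: "0 \<in> Qp_span b n"
  unfolding Qp_span_def mem_Collect_eq
  using subfield_0[OF Qp_subfield] by (intro exI[of _ "\<lambda>i. 0"]) auto

lemma Qp_span_sum:
  "(\<And>i. i \<in> I \<Longrightarrow> f i \<in> Qp_span b n) \<Longrightarrow> (\<Sum>i\<in>I. f i) \<in> Qp_span b n"
proof (induction I rule: infinite_finite_induct)
  case (insert i I)
  then have "f i - (0 - sum f I) \<in> Qp_span b n" by (intro Qp_span_diff Qp_span_0) auto
  then show ?case using insert by simp
qed (auto intro: Qp_span_0)

lemma Qp_span_basis:
  assumes "i < n"
  shows "b i \<in> Qp_span b n"
  unfolding Qp_span_def mem_Collect_eq
  using assms subfield_0[OF Qp_subfield] subfield_1[OF Qp_subfield]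
  by (intro exI[of _ "\<lambda>j. if j = i then 1 else 0"]) (auto simp: if_distrib[of "\<lambda>x. x * _"] cong: if_cong)

definition bounded_coords :: "(nat \<Rightarrow> 'a) \<Rightarrow> nat \<Rightarrow> real \<Rightarrow> bool" where
  "bounded_coords b n C \<longleftrightarrow> 0 < C \<and> (\<forall>x\<in>Qp_span b n.
     \<exists>c. (\<forall>i. c i \<in> Qp absv \<and> absv (c i) \<le> C * absv x) \<and> x = (\<Sum>i<n. c i * b i))"

lemma Qp_span_closed:
  assumes C: "bounded_coords b n C"
    and lim: "\<And>k. \<exists>v\<in>Qp_span b n. absv (y - v) \<le> 1 / 2 ^ k"
  shows "y \<in> Qp_span b n"
proof -
  have C0: "C > 0" using C by (simp add: bounded_coords_def)
  obtain v where v: "\<And>k. v k \<in> Qp_span b n" "\<And>k. absv (y - v k) \<le> 1 / 2 ^ k"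
    using lim by metis
  define d where "d k = v (Suc k) - v k" for k
  have d: "d k \<in> Qp_span b n" for k unfolding d_def using v by (intro Qp_span_diff)
  have dle: "absv (d k) \<le> 1 / 2 ^ k" for k
  proof -
    have "absv (d k) \<le> max (absv (y - v (Suc k))) (absv (y - v k))"
      unfolding d_def using absv_ultrametric[of "v (Suc k)" "v k" y] absv_diff_commute[of y "v (Suc k)"] by simp
    moreover have "(1::real) / 2 ^ Suc k \<le> 1 / 2 ^ k" by (simp add: field_simps)
    ultimately show ?thesis using v(2)[of k] v(2)[of "Suc k"] by linarith
  qed
  have "\<exists>c. (\<forall>i. c i \<in> Qp absv \<and> absv (c i) \<le> C * absv (d k)) \<and> d k = (\<Sum>i<n. c i * b i)" for k
    using C d unfolding bounded_coords_def by blast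
  then obtain c where c: "\<And>k i. c k i \<in> Qp absv" "\<And>k i. absv (c k i) \<le> C * absv (d k)"
      "\<And>k. d k = (\<Sum>i<n. c k i * b i)"
    by metis
  have "absv (c k i) \<le> C / 2 ^ k" for k i
    using c(2)[of k i] mult_left_mono[OF dle[of k], of C] C0 by simp
  then have "\<exists>s. s \<in> Qp absv \<and> (\<forall>k. absv ((\<Sum>l<k. c l i) - s) \<le> C / 2 ^ k)" for i
    using Qp_series[of "\<lambda>k. c k i" C] c(1) C0 by metis
  then obtain s where s: "\<And>i. s i \<in> Qp absv" "\<And>i k. absv ((\<Sum>l<k. c l i) - s i) \<le> C / 2 ^ k"
    by metis
  define z where "z = v 0 + (\<Sum>i<n. s i * b i)"
  define B where "B = 1 + (\<Sum>i<n. absv (b i))"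
  have B: "absv (b i) \<le> B" if "i < n" for i
    using member_le_sum[of i "{..<n}" "\<lambda>i. absv (b i)"] that absv_nonneg by (simp add: B_def)
  have B0: "B > 0" unfolding B_def using absv_nonneg by (simp add: add_pos_nonneg sum_nonneg)
  have vk: "v k = v 0 + (\<Sum>i<n. (\<Sum>l<k. c l i) * b i)" for k
  proof (induction k)
    case (Suc k)
    have "v (Suc k) = v k + d k" by (simp add: d_def)
    then show ?case using Suc c(3)[of k] by (simp add: algebra_simps sum.distrib)
  qed simp
  have "absv (y - z) \<le> (1 + C * B) / 2 ^ k" for k
  proof -
    have "v k - z = (\<Sum>i<n. ((\<Sum>l<k. c l i) - s i) * b i)"
      unfolding z_def by (subst vk) (simp add: algebra_simps sum_subtractf)
    also have "absv \<dots> \<le> C / 2 ^ k * B"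
    proof (rule absv_sum_le)
      fix i assume "i \<in> {..<n}"
      then show "absv (((\<Sum>l<k. c l i) - s i) * b i) \<le> C / 2 ^ k * B"
        unfolding absv_mult using s(2)[of i k] B[of i] absv_nonneg C0 by (intro mult_mono) auto
    qed (use C0 B0 in simp)
    finally have "absv (v k - z) \<le> C * B / 2 ^ k" by simp
    moreover have "absv (y - v k) \<le> 1 / 2 ^ k" by (rule v(2))
    moreover have "0 \<le> C * B / 2 ^ k" "0 \<le> (1::real) / 2 ^ k" using C0 B0 by auto
    moreover have "(1 + C * B) / 2 ^ k = 1 / 2 ^ k + C * B / 2 ^ k" by (simp add: add_divide_distrib)
    ultimately show ?thesis using absv_ultrametric[of y z "v k"] by linarith
  qed
  then have "absv (y - z) = 0"
  proof -
    have False if "absv (y - z) > 0"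
    proof -
      obtain k where "(1 + C * B) / absv (y - z) < 2 ^ k"
        using real_arch_pow[of 2] by auto
      then have "(1 + C * B) / 2 ^ k < absv (y - z)" using that by (simp add: field_simps)
      then show False using \<open>absv (y - z) \<le> (1 + C * B) / 2 ^ k\<close> by linarith
    qed
    then show ?thesis using absv_nonneg[of "y - z"] by force
  qed
  then have "y = z" using absv_eq_0_iff by simp
  have "(\<Sum>i<n. s i * b i) \<in> Qp_span b n" unfolding Qp_span_def using s(1) by blast
  then have "v 0 - (0 - (\<Sum>i<n. s i * b i)) \<in> Qp_span b n"
    using v(1) Qp_span_0 by (intro Qp_span_diff)
  then show ?thesis unfolding \<open>y = z\<close> z_def by simp
qed

lemma bounded_coords_exists: "\<exists>C. bounded_coords b n C"
proof (induction n)
  case 0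
  have "bounded_coords b 0 1"
    unfolding bounded_coords_def Qp_span_def
    by (auto intro!: exI[of _ "\<lambda>i. 0"] subfield_0[OF Qp_subfield])
  then show ?case by blast
next
  case (Suc n)
  then obtain C where C: "bounded_coords b n C" by blast
  then have C0: "C > 0" by (simp add: bounded_coords_def)
  have Q0: "0 \<in> Qp absv" by (rule subfield_0[OF Qp_subfield])
  show ?case
  proof (cases "b n \<in> Qp_span b n")
    case True
    have "bounded_coords b (Suc n) C"
      unfolding bounded_coords_def
    proof (intro conjI ballI)
      fix x assume "x \<in> Qp_span b (Suc n)"
      then obtain d where d: "\<forall>i. d i \<in> Qp absv" "x = (\<Sum>i<Suc n. d i * b i)"
        unfolding Qp_span_def by blast
      have "(\<Sum>i<n. d i * b i) \<in> Qp_span b n" unfolding Qp_span_def using d(1) by blast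
      then have "d n * b n - (0 - (\<Sum>i<n. d i * b i)) \<in> Qp_span b n"
        using True d(1) by (intro Qp_span_diff Qp_span_scale Qp_span_0) auto
      then have "x \<in> Qp_span b n" using d(2) by (simp add: add.commute)
      then obtain c where c: "\<forall>i. c i \<in> Qp absv \<and> absv (c i) \<le> C * absv x" "x = (\<Sum>i<n. c i * b i)"
        using C unfolding bounded_coords_def by blast
      then show "\<exists>c. (\<forall>i. c i \<in> Qp absv \<and> absv (c i) \<le> C * absv x) \<and> x = (\<Sum>i<Suc n. c i * b i)"
        using C0 absv_nonneg[of x] Q0 by (intro exI[of _ "c(n := 0)"]) auto
    qed (rule C0)
    then show ?thesis by blast
  next
    case False
    then obtain k where k: "\<And>v. v \<in> Qp_span b n \<Longrightarrow> 1 / 2 ^ k < absv (b n - v)"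
      using Qp_span_closed[OF C, of "b n"] by (meson not_le)
    define D where "D = 2 ^ k * (1 + absv (b n))"
    define C' where "C' = 2 ^ k + C * (1 + D)"
    have D0: "D \<ge> 0" "C' > 0" "C * (1 + D) \<le> C'" "2 ^ k \<le> C'"
      unfolding D_def C'_def using C0 absv_nonneg[of "b n"] by (auto intro!: add_pos_nonneg)
    have "bounded_coords b (Suc n) C'"
      unfolding bounded_coords_def
    proof (intro conjI ballI)
      fix x assume "x \<in> Qp_span b (Suc n)"
      then obtain d where d: "\<forall>i. d i \<in> Qp absv" "x = (\<Sum>i<Suc n. d i * b i)"
        unfolding Qp_span_def by blast
      define w where "w = (\<Sum>i<n. d i * b i)"
      have w: "w \<in> Qp_span b n" unfolding w_def Qp_span_def using d(1) by blast
      have x: "x = w + d n * b n" using d(2) by (simp add: w_def)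
      have dn: "absv (d n) \<le> 2 ^ k * absv x"
      proof (cases "d n = 0")
        case False
        have "inverse (d n) * (0 - w) \<in> Qp_span b n"
          using w d(1) by (intro Qp_span_scale Qp_span_diff Qp_span_0 Qp_inverse) auto
        then have "1 / 2 ^ k < absv (b n - inverse (d n) * (0 - w))" by (rule k)
        moreover have "b n - inverse (d n) * (0 - w) = x / d n"
          using False x by (simp add: field_simps)
        ultimately have "1 / 2 ^ k < absv x / absv (d n)" by (simp add: absv_divide)
        then show ?thesis using absv_pos[OF False] by (simp add: field_simps)
      qed (use absv_nonneg[of x] in simp)
      have "absv (d n * b n) \<le> 2 ^ k * absv x * absv (b n)"
        unfolding absv_mult using dn absv_nonneg by (intro mult_right_mono) auto
      also have "\<dots> \<le> D * absv x"
        using absv_nonneg[of x] absv_nonneg[of "b n"] by (simp add: D_def algebra_simps)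
      finally have 1: "absv (d n * b n) \<le> D * absv x" .
      have "absv w \<le> max (absv x) (absv (d n * b n))"
        using absv_diff_le_max[of x "d n * b n"] x by simp
      also have "\<dots> \<le> (1 + D) * absv x" using 1 D0(1) absv_nonneg[of x]
        by (auto simp: algebra_simps)
      finally have 2: "absv w \<le> (1 + D) * absv x" .
      obtain c where c: "\<forall>i. c i \<in> Qp absv \<and> absv (c i) \<le> C * absv w" "w = (\<Sum>i<n. c i * b i)"
        using C w unfolding bounded_coords_def by blast
      define c' where "c' = c(n := d n)"
      have "c' i \<in> Qp absv \<and> absv (c' i) \<le> C' * absv x" for i
      proof (cases "i = n")
        case True
        have "2 ^ k * absv x \<le> C' * absv x" using D0 absv_nonneg[of x] by (intro mult_right_mono)
        then show ?thesis using True d(1) dn by (simp add: c'_def)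
      next
        case False
        have "C * absv w \<le> C * (1 + D) * absv x" using 2 C0 by simp
        also have "\<dots> \<le> C' * absv x" using D0 absv_nonneg[of x] by (intro mult_right_mono)
        finally show ?thesis using False c(1) by (auto simp: c'_def intro: order_trans)
      qed
      moreover have "x = (\<Sum>i<Suc n. c' i * b i)" using x c(2) by (simp add: c'_def)
      ultimately show "\<exists>c. (\<forall>i. c i \<in> Qp absv \<and> absv (c i) \<le> C' * absv x) \<and> x = (\<Sum>i<Suc n. c i * b i)"
        by blast
    qed (rule D0)
    then show ?thesis by blast
  qed
qed

end

context
  fixes E :: "'a::field_char_0 set" and \<sigma>
  assumes \<sigma>: "\<sigma> \<in> Gal E"
begin

lemma Gal_add: "\<sigma> (x + y) = \<sigma> x + \<sigma> y"
  and Gal_mult: "\<sigma> (x * y) = \<sigma> x * \<sigma> y"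
  and Gal_fixed: "x \<in> E \<Longrightarrow> \<sigma> x = x"
  and Gal_bij: "bij \<sigma>"
  using \<sigma> by (auto simp: Gal_def)

lemma Gal_inj: "\<sigma> x = \<sigma> y \<longleftrightarrow> x = y"
  using Gal_bij by (metis bij_pointE)

lemma Gal_0: "\<sigma> 0 = 0"
  using Gal_add[of 0 0] by simp

lemma Gal_1: "\<sigma> 1 = 1"
  using Gal_mult[of 1 1] Gal_inj[of 1 0] Gal_0 by simp

lemma Gal_minus: "\<sigma> (- x) = - \<sigma> x"
  using Gal_add[of x "- x"] Gal_0 by (simp add: eq_neg_iff_add_eq_0 add.commute)

lemma Gal_diff: "\<sigma> (x - y) = \<sigma> x - \<sigma> y"
  using Gal_add[of x "- y"] by (simp add: Gal_minus)

lemma Gal_inverse: "\<sigma> (inverse x) = inverse (\<sigma> x)"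
proof (cases "x = 0")
  case False
  then have "\<sigma> x * \<sigma> (inverse x) = 1" using Gal_mult[of x "inverse x"] Gal_1 by simp
  then show ?thesis by (metis inverse_unique)
qed (simp add: Gal_0)

lemma Gal_divide: "\<sigma> (x / y) = \<sigma> x / \<sigma> y"
  by (simp add: divide_inverse Gal_mult Gal_inverse)

lemma Gal_power: "\<sigma> (x ^ n) = \<sigma> x ^ n"
  by (induction n) (auto simp: Gal_mult Gal_0 Gal_1)

lemma Gal_of_nat: "\<sigma> (of_nat n) = of_nat n"
  by (induction n) (auto simp: Gal_add Gal_0 Gal_1)

lemma Gal_sum: "\<sigma> (\<Sum>i\<in>I. f i) = (\<Sum>i\<in>I. \<sigma> (f i))"
  by (induction I rule: infinite_finite_induct) (auto simp: Gal_add Gal_0 Gal_1)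

lemma Gal_prod: "\<sigma> (\<Prod>i\<in>I. f i) = (\<Prod>i\<in>I. \<sigma> (f i))"
  by (induction I rule: infinite_finite_induct) (auto simp: Gal_mult Gal_0 Gal_1)

lemma Gal_poly: "poly_over E f \<Longrightarrow> \<sigma> (poly f x) = poly f (\<sigma> x)"
  by (simp add: poly_altdef Gal_sum Gal_mult Gal_power Gal_fixed poly_over_def)

lemma Gal_inv: "inv \<sigma> \<in> Gal E"
proof -
  have *: "\<sigma> (inv \<sigma> x) = x" for x using Gal_bij by (simp add: bij_is_surj surj_f_inv_f)
  have "inv \<sigma> (x + y) = inv \<sigma> x + inv \<sigma> y" for x y
    by (subst Gal_inj[symmetric]) (simp add: Gal_add *)
  moreover have "inv \<sigma> (x * y) = inv \<sigma> x * inv \<sigma> y" for x y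
    by (subst Gal_inj[symmetric]) (simp add: Gal_mult *)
  moreover have "inv \<sigma> x = x" if "x \<in> E" for x
    by (subst Gal_inj[symmetric]) (simp add: Gal_fixed that *)
  ultimately show ?thesis using Gal_bij by (auto simp: Gal_def bij_imp_bij_inv)
qed

lemma Gal_inv_apply: "\<sigma> (inv \<sigma> x) = x" "inv \<sigma> (\<sigma> x) = x"
  using Gal_bij by (auto simp: bij_is_surj surj_f_inv_f bij_is_inj inv_f_f)

end

lemma Gal_comp: "\<sigma> \<in> Gal E \<Longrightarrow> \<tau> \<in> Gal E \<Longrightarrow> \<sigma> \<circ> \<tau> \<in> Gal E"
  by (auto simp: Gal_def intro: bij_comp)

lemma Gal_id: "id \<in> Gal E"
  by (auto simp: Gal_def)

lemma Gal_mono: "E \<subseteq> F \<Longrightarrow> Gal F \<subseteq> Gal E"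
  by (auto simp: Gal_def)

context Qp_algebraic_closure
begin

lemma powers_in_Qp_span:
  obtains d where "\<And>n. x ^ n \<in> Qp_span (\<lambda>i. x ^ i) d"
proof -
  obtain f where f: "f \<noteq> 0" "\<forall>i. coeff f i \<in> Qp absv" "poly f x = 0"
    using algebraic_over_Qp by blast
  define d where "d = degree f"
  define V where "V = Qp_span (\<lambda>i. x ^ i) d"
  have lc: "coeff f d \<noteq> 0" using f by (simp add: d_def)
  have "(\<Sum>i<d. coeff f i * x ^ i) + coeff f d * x ^ d = 0"
    using f(3) unfolding poly_altdef d_def[symmetric] by (simp add: lessThan_Suc_atMost[symmetric])
  then have "x ^ d = inverse (coeff f d) * (0 - (\<Sum>i<d. coeff f i * x ^ i))"
    using lc by (simp add: field_simps eq_neg_iff_add_eq_0)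
  moreover have "(\<Sum>i<d. coeff f i * x ^ i) \<in> V" unfolding V_def Qp_span_def using f(2) by blast
  ultimately have xd: "x ^ d \<in> V"
    unfolding V_def using f(2) Qp_inverse by (metis Qp_span_scale Qp_span_diff Qp_span_0)
  have "x ^ n \<in> V" for n
  proof (induction n)
    case 0
    have "d \<noteq> 0"
    proof
      assume "d = 0"
      then obtain c where "f = [:c:]" unfolding d_def by (elim degree_eq_zeroE)
      with f show False by simp
    qed
    then show ?case unfolding V_def using Qp_span_basis[of 0 d "\<lambda>i. x ^ i"] by simp
  next
    case (Suc n)
    then obtain c where c: "\<forall>i. c i \<in> Qp absv" "x ^ n = (\<Sum>i<d. c i * x ^ i)"
      unfolding V_def Qp_span_def by blast
    have "x ^ Suc n = (\<Sum>i<d. c i * x ^ Suc i)" using c(2) by (simp add: sum_distrib_left mult_ac)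
    also have "\<dots> \<in> V"
      unfolding V_def
    proof (intro Qp_span_sum Qp_span_scale)
      fix i assume "i \<in> {..<d}"
      then show "x ^ Suc i \<in> Qp_span (\<lambda>i. x ^ i) d"
        using Qp_span_basis[of "Suc i" d "\<lambda>i. x ^ i"] xd unfolding V_def by (cases "Suc i = d") auto
    qed (use c in auto)
    finally show ?case .
  qed
  then show thesis unfolding V_def by (rule that)
qed

lemma Gal_absv_le:
  assumes "\<sigma> \<in> Gal (Qp absv)"
  shows "absv (\<sigma> x) \<le> absv x"
proof (rule ccontr)
  assume "\<not> absv (\<sigma> x) \<le> absv x"
  then have less: "absv x < absv (\<sigma> x)" by simp
  then have "x \<noteq> 0" using Gal_0[OF assms] by auto
  then have x: "absv x > 0" by (rule absv_pos)
  obtain d where d: "\<And>n. x ^ n \<in> Qp_span (\<lambda>i. x ^ i) d"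
    using powers_in_Qp_span[of x] by blast
  obtain C where C: "bounded_coords (\<lambda>i. x ^ i) d C" using bounded_coords_exists by blast
  then have C0: "C > 0" by (simp add: bounded_coords_def)
  define B where "B = (1 + absv (\<sigma> x)) ^ d"
  have B: "absv (\<sigma> x) ^ i \<le> B" if "i < d" for i
  proof -
    have "absv (\<sigma> x) ^ i \<le> (1 + absv (\<sigma> x)) ^ i" using absv_nonneg by (intro power_mono) auto
    also have "\<dots> \<le> B" unfolding B_def using absv_nonneg[of "\<sigma> x"] that by (intro power_increasing) auto
    finally show ?thesis .
  qed
  have B0: "B > 0" unfolding B_def using absv_nonneg[of "\<sigma> x"] by (intro zero_less_power) simp
  have "(absv (\<sigma> x) / absv x) ^ n \<le> C * B" for n
  proof -
    obtain c where c: "\<forall>i. c i \<in> Qp absv \<and> absv (c i) \<le> C * absv (x ^ n)" "x ^ n = (\<Sum>i<d. c i * x ^ i)"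
      using C d[of n] unfolding bounded_coords_def by blast
    have "\<sigma> x ^ n = (\<Sum>i<d. c i * \<sigma> x ^ i)"
      using c by (simp add: Gal_power[OF assms, symmetric] Gal_sum[OF assms] Gal_mult[OF assms] Gal_fixed[OF assms])
    also have "absv \<dots> \<le> C * absv (x ^ n) * B"
    proof (rule absv_sum_le)
      fix i assume "i \<in> {..<d}"
      then show "absv (c i * \<sigma> x ^ i) \<le> C * absv (x ^ n) * B"
        unfolding absv_mult[of "c i"] absv_power[of "\<sigma> x"]
        using c(1) B absv_nonneg C0 by (intro mult_mono) auto
    qed (use C0 B0 absv_nonneg in auto)
    finally have "absv (\<sigma> x) ^ n \<le> C * B * absv x ^ n" by (simp add: absv_power mult_ac)
    then show ?thesis using x by (simp add: power_divide field_simps)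
  qed
  moreover obtain n where "C * B < (absv (\<sigma> x) / absv x) ^ n"
    using real_arch_pow[of "absv (\<sigma> x) / absv x"] less x by auto
  ultimately show False by (meson not_le)
qed

lemma Gal_absv:
  assumes "\<sigma> \<in> Gal (Qp absv)"
  shows "absv (\<sigma> x) = absv x"
  using Gal_absv_le[OF assms, of x] Gal_absv_le[OF Gal_inv[OF assms], of "\<sigma> x"]
  by (simp add: Gal_inv_apply[OF assms])

end

section \<open>Galois orbits\<close>

definition orb :: "('a \<Rightarrow> 'a) set \<Rightarrow> 'a \<Rightarrow> 'a set" where
  "orb H x = (\<lambda>\<sigma>. \<sigma> x) ` H"

definition fixed :: "('a \<Rightarrow> 'a) set \<Rightarrow> 'a set" where
  "fixed H = {x. \<forall>\<sigma>\<in>H. \<sigma> x = x}"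

lemma orb_mono: "H \<subseteq> K \<Longrightarrow> orb H x \<subseteq> orb K x"
  by (auto simp: orb_def)

lemma fixed_antimono: "H \<subseteq> K \<Longrightarrow> fixed K \<subseteq> fixed H"
  by (auto simp: fixed_def)

lemma prod_mset_ge_power:
  fixes f :: "'b \<Rightarrow> real"
  assumes "\<And>a. a \<in># A \<Longrightarrow> c \<le> f a" "0 \<le> c"
  shows "c ^ size A \<le> (\<Prod>a\<in>#A. f a)"
  using assms(1)
proof (induction A)
  case (add a A)
  then have "c * c ^ size A \<le> f a * (\<Prod>a\<in>#A. f a)"
    using \<open>0 \<le> c\<close> by (intro mult_mono) (auto intro: order_trans)
  then show ?case by simp
qed simp

lemma map_poly_mult_hom:
  fixes f g :: "'a::field poly"
  assumes "\<And>x y. \<sigma> (x + y) = \<sigma> x + \<sigma> y" "\<And>x y. \<sigma> (x * y) = \<sigma> x * \<sigma> y" "\<sigma> 0 = 0"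
  shows "map_poly \<sigma> (f * g) = map_poly \<sigma> f * map_poly \<sigma> g"
proof (rule poly_eqI)
  fix n
  have sum: "\<sigma> (\<Sum>i\<in>I. h i) = (\<Sum>i\<in>I. \<sigma> (h i))" for h and I :: "nat set"
    by (induction I rule: infinite_finite_induct) (auto simp: assms)
  show "coeff (map_poly \<sigma> (f * g)) n = coeff (map_poly \<sigma> f * map_poly \<sigma> g) n"
    by (simp add: coeff_map_poly assms coeff_mult sum)
qed

context Qp_algebraic_closure
begin

abbreviation GQ :: "('a \<Rightarrow> 'a) set" where
  "GQ \<equiv> Gal (Qp absv)"

definition Galois_group :: "('a \<Rightarrow> 'a) set \<Rightarrow> bool" where
  "Galois_group H \<longleftrightarrow> H \<subseteq> GQ \<and> id \<in> H \<and> (\<forall>\<sigma>\<in>H. \<forall>\<tau>\<in>H. \<sigma> \<circ> \<tau> \<in> H) \<and> (\<forall>\<sigma>\<in>H. inv \<sigma> \<in> H)"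

lemma Galois_group_Gal: "Qp absv \<subseteq> F \<Longrightarrow> Galois_group (Gal F)"
  unfolding Galois_group_def using Gal_mono[of "Qp absv" F] Gal_comp Gal_inv Gal_id by blast

lemma fixed_Gal:
  assumes "is_subfield F" "Qp absv \<subseteq> F"
  shows "fixed (Gal F) = F"
proof -
  have "\<exists>f. f \<noteq> 0 \<and> poly_over F f \<and> poly f x = 0" for x
    using algebraic_over_Qp[of x] assms(2) unfolding poly_over_def by blast
  then show ?thesis
    using fixed_by_Gal[OF assms(1)] Gal_fixed[of _ F] unfolding fixed_def by blast
qed

context
  fixes H
  assumes H: "Galois_group H"
begin

lemma group_GQ: "\<sigma> \<in> H \<Longrightarrow> \<sigma> \<in> GQ"
  and group_id: "id \<in> H"
  and group_comp: "\<sigma> \<in> H \<Longrightarrow> \<tau> \<in> H \<Longrightarrow> \<sigma> \<circ> \<tau> \<in> H"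
  and group_inv: "\<sigma> \<in> H \<Longrightarrow> inv \<sigma> \<in> H"
  using H unfolding Galois_group_def by blast+

lemma orb_self: "x \<in> orb H x"
  unfolding orb_def using group_id by (intro image_eqI[of _ _ id]) auto

lemma orb_image:
  assumes "\<sigma> \<in> H"
  shows "\<sigma> ` orb H x = orb H x"
proof
  show "\<sigma> ` orb H x \<subseteq> orb H x"
    unfolding orb_def
  proof safe
    fix \<tau> assume "\<tau> \<in> H"
    then show "\<sigma> (\<tau> x) \<in> (\<lambda>\<sigma>. \<sigma> x) ` H"
      using group_comp[OF assms] by (intro image_eqI[of _ _ "\<sigma> \<circ> \<tau>"]) auto
  qed
  show "orb H x \<subseteq> \<sigma> ` orb H x"
  proof
    fix y assume "y \<in> orb H x"
    then obtain \<tau> where "\<tau> \<in> H" "y = \<tau> x" by (auto simp: orb_def)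
    then have "y = \<sigma> ((inv \<sigma> \<circ> \<tau>) x)" by (simp add: Gal_inv_apply[OF group_GQ[OF assms]])
    then show "y \<in> \<sigma> ` orb H x"
      using group_comp[OF group_inv[OF assms] \<open>\<tau> \<in> H\<close>] unfolding orb_def by blast
  qed
qed

lemma orb_absv: "y \<in> orb H x \<Longrightarrow> absv y = absv x"
  unfolding orb_def using Gal_absv[OF group_GQ] by blast

lemma Qp_fixed: "Qp absv \<subseteq> fixed H"
  unfolding fixed_def using group_GQ Gal_fixed by blast

lemma fixed_subfield: "is_subfield (fixed H)"
proof -
  have "x - y \<in> fixed H \<and> x * y \<in> fixed H" if "x \<in> fixed H" "y \<in> fixed H" for x y
    unfolding fixed_def
  proof (intro conjI CollectI ballI)
    fix \<sigma> assume "\<sigma> \<in> H"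
    then have "\<sigma> x = x" "\<sigma> y = y" "\<sigma> \<in> GQ" using that group_GQ by (auto simp: fixed_def)
    then show "\<sigma> (x - y) = x - y" "\<sigma> (x * y) = x * y"
      using Gal_diff[of \<sigma> "Qp absv" x y] Gal_mult[of \<sigma> "Qp absv" x y] by auto
  qed
  moreover have "inverse x \<in> fixed H" if "x \<in> fixed H" for x
    unfolding fixed_def
  proof (intro CollectI ballI)
    fix \<sigma> assume "\<sigma> \<in> H"
    then have "\<sigma> x = x" "\<sigma> \<in> GQ" using that group_GQ by (auto simp: fixed_def)
    then show "\<sigma> (inverse x) = inverse x" using Gal_inverse[of \<sigma> "Qp absv" x] by simp
  qed
  ultimately show ?thesis
    using Qp_fixed subfield_0[OF Qp_subfield] subfield_1[OF Qp_subfield]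
    unfolding is_subfield_def by blast
qed

lemma orb_roots:
  assumes "f \<noteq> 0" "poly_over (fixed H) f" "poly f x = 0"
  shows "finite (orb H x)" "card (orb H x) \<le> degree f"
proof -
  have "orb H x \<subseteq> {y. poly f y = 0}"
  proof
    fix y assume "y \<in> orb H x"
    then obtain \<sigma> where \<sigma>: "\<sigma> \<in> H" "y = \<sigma> x" by (auto simp: orb_def)
    then have "\<sigma> \<in> Gal (fixed H)"
      using group_GQ by (auto simp: Gal_def fixed_def)
    then have "\<sigma> (poly f x) = poly f (\<sigma> x)" using Gal_poly assms(2) by blast
    then show "y \<in> {y. poly f y = 0}" using \<sigma> assms(3) Gal_0[OF group_GQ[OF \<sigma>(1)]] by simp
  qed
  moreover have fin: "finite {y. poly f y = 0}" using assms(1) by (rule poly_roots_finite)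
  ultimately show "finite (orb H x)" by (rule finite_subset)
  have "card (orb H x) \<le> card {y. poly f y = 0}"
    using fin \<open>orb H x \<subseteq> {y. poly f y = 0}\<close> by (rule card_mono)
  also have "\<dots> \<le> degree f" using assms(1) by (rule card_poly_roots_bound)
  finally show "card (orb H x) \<le> degree f" .
qed

lemma orb_finite: "finite (orb H x)"
proof -
  obtain f where f: "f \<noteq> 0" "\<forall>i. coeff f i \<in> Qp absv" "poly f x = 0"
    using algebraic_over_Qp by blast
  have "poly_over (fixed H) f" using f(2) Qp_fixed unfolding poly_over_def by blast
  then show ?thesis using orb_roots(1) f by blast
qed

lemma orb_card_pos: "0 < card (orb H x)"
  using orb_finite orb_self by (auto simp: card_gt_0_iff)

lemma fixed_iff_orb: "x \<in> fixed H \<longleftrightarrow> orb H x = {x}"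
  using orb_self by (auto simp: fixed_def orb_def)

definition orb_poly :: "'a \<Rightarrow> 'a poly" where
  "orb_poly x = (\<Prod>y\<in>orb H x. [:-y, 1:])"

lemma orb_poly_root: "poly (orb_poly x) x = 0"
  unfolding orb_poly_def poly_prod using orb_finite orb_self by (auto simp: prod_zero_iff)

lemma orb_poly_degree: "degree (orb_poly x) = card (orb H x)"
  unfolding orb_poly_def by (subst degree_prod_sum_eq) auto

lemma orb_poly_monic: "lead_coeff (orb_poly x) = 1"
  unfolding orb_poly_def by (simp add: lead_coeff_prod)

lemma orb_poly_over: "poly_over (fixed H) (orb_poly x)"
  unfolding poly_over_def fixed_def
proof (intro allI CollectI ballI)
  fix i \<sigma> assume \<sigma>: "\<sigma> \<in> H"
  note G = group_GQ[OF \<sigma>]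
  have map: "map_poly \<sigma> (\<Prod>y\<in>A. [:-y, 1:]) = (\<Prod>y\<in>A. [:-\<sigma> y, 1:])" for A
  proof (induction A rule: infinite_finite_induct)
    case (insert y A)
    have "map_poly \<sigma> [:-y, 1:] = [:-\<sigma> y, 1:]"
      by (simp add: map_poly_pCons Gal_0[OF G] Gal_1[OF G] Gal_minus[OF G])
    then show ?case
      using insert by (simp add: map_poly_mult_hom Gal_add[OF G] Gal_mult[OF G] Gal_0[OF G] del: mult_pCons_left)
  qed (simp_all add: map_poly_1' Gal_1[OF G])
  have "(\<Prod>y\<in>orb H x. [:-\<sigma> y, 1:]) = (\<Prod>y\<in>\<sigma> ` orb H x. [:-y, 1:])"
    by (subst prod.reindex) (auto simp: inj_on_def Gal_inj[OF G])
  then have "map_poly \<sigma> (orb_poly x) = orb_poly x"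
    unfolding orb_poly_def map using orb_image[OF \<sigma>] by simp
  then show "\<sigma> (coeff (orb_poly x) i) = coeff (orb_poly x) i"
    using coeff_map_poly[of \<sigma> "orb_poly x" i] Gal_0[OF G] by simp
qed

lemma orb_poly_integral:
  assumes "absv x \<le> 1"
  shows "absv (coeff (orb_poly x) i) \<le> 1"
proof -
  have "\<forall>i. absv (coeff (\<Prod>y\<in>A. [:-y, 1:]) i) \<le> 1" if "\<forall>y\<in>A. absv y \<le> 1" for A :: "'a set"
    using that
  proof (induction A rule: infinite_finite_induct)
    case (insert y A)
    show ?case
    proof
      fix i
      let ?c = "coeff (\<Prod>y\<in>A. [:-y, 1:])"
      have "absv (?c j) \<le> 1" for j using insert by blast
      moreover have "absv (y * ?c i) \<le> 1"
        using insert absv_nonneg by (auto simp: absv_mult mult_le_one)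
      ultimately show "absv (coeff (\<Prod>y\<in>insert y A. [:-y, 1:]) i) \<le> 1"
        using insert(1,2) absv_diff_le_max[of "0" "y * ?c i"]
          absv_diff_le_max[of "?c (i - 1)" "y * ?c i"]
        by (cases i) (auto intro: order_trans)
    qed
  qed (auto simp: coeff_1)
  then show ?thesis unfolding orb_poly_def using orb_absv assms by auto
qed

lemma card_orb_add: "card (orb H (x + y)) \<le> card (orb H x) * card (orb H y)"
proof -
  have "orb H (x + y) \<subseteq> (\<lambda>(a, b). a + b) ` (orb H x \<times> orb H y)"
  proof
    fix z assume "z \<in> orb H (x + y)"
    then obtain \<sigma> where "\<sigma> \<in> H" "z = \<sigma> (x + y)" by (auto simp: orb_def)
    then show "z \<in> (\<lambda>(a, b). a + b) ` (orb H x \<times> orb H y)"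
      using Gal_add[OF group_GQ, of \<sigma> x y] by (intro image_eqI[of _ _ "(\<sigma> x, \<sigma> y)"]) (auto simp: orb_def)
  qed
  then show ?thesis
    by (metis card_cartesian_product surj_card_le finite_cartesian_product orb_finite)
qed

lemma card_orb_mult: "card (orb H (x * y)) \<le> card (orb H x) * card (orb H y)"
proof -
  have "orb H (x * y) \<subseteq> (\<lambda>(a, b). a * b) ` (orb H x \<times> orb H y)"
  proof
    fix z assume "z \<in> orb H (x * y)"
    then obtain \<sigma> where "\<sigma> \<in> H" "z = \<sigma> (x * y)" by (auto simp: orb_def)
    then show "z \<in> (\<lambda>(a, b). a * b) ` (orb H x \<times> orb H y)"
      using Gal_mult[OF group_GQ, of \<sigma> x y] by (intro image_eqI[of _ _ "(\<sigma> x, \<sigma> y)"]) (auto simp: orb_def)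
  qed
  then show ?thesis
    by (metis card_cartesian_product surj_card_le finite_cartesian_product orb_finite)
qed

lemma card_orb_power: "card (orb H (x ^ n)) \<le> card (orb H x)"
proof -
  have "orb H (x ^ n) \<subseteq> (\<lambda>a. a ^ n) ` orb H x"
  proof
    fix z assume "z \<in> orb H (x ^ n)"
    then obtain \<sigma> where "\<sigma> \<in> H" "z = \<sigma> (x ^ n)" by (auto simp: orb_def)
    then show "z \<in> (\<lambda>a. a ^ n) ` orb H x"
      using Gal_power[OF group_GQ, of \<sigma> x n] by (intro image_eqI[of _ _ "\<sigma> x"]) (auto simp: orb_def)
  qed
  then show ?thesis using surj_card_le[OF orb_finite] by blast
qed

lemma card_orb_index:
  assumes K: "Galois_group K"
    and \<phi>: "\<And>\<sigma> \<tau>. \<sigma> \<in> H \<Longrightarrow> \<tau> \<in> H \<Longrightarrow> \<phi> \<sigma> = \<phi> \<tau> \<Longrightarrow> inv \<tau> \<circ> \<sigma> \<in> K"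
    and fin: "finite (\<phi> ` H)"
  shows "card (orb H x) \<le> card (\<phi> ` H) * card (orb K x)"
proof -
  define r where "r s = (SOME \<tau>. \<tau> \<in> H \<and> \<phi> \<tau> = s)" for s
  have r: "r s \<in> H \<and> \<phi> (r s) = s" if "s \<in> \<phi> ` H" for s
  proof -
    have "\<exists>\<tau>. \<tau> \<in> H \<and> \<phi> \<tau> = s" using that by blast
    then show ?thesis unfolding r_def by (rule someI_ex)
  qed
  have finK: "finite (orb K x)"
  proof -
    obtain f where f: "f \<noteq> 0" "\<forall>i. coeff f i \<in> Qp absv" "poly f x = 0"
      using algebraic_over_Qp by blast
    have "orb K x \<subseteq> {y. poly f y = 0}"
    proof
      fix y assume "y \<in> orb K x"
      then obtain \<sigma> where \<sigma>: "\<sigma> \<in> GQ" "y = \<sigma> x" using K by (auto simp: orb_def Galois_group_def)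
      then show "y \<in> {y. poly f y = 0}"
        using f Gal_poly[OF \<sigma>(1), of f x] Gal_0[OF \<sigma>(1)] by (simp add: poly_over_def)
    qed
    then show ?thesis using poly_roots_finite[OF f(1)] finite_subset by blast
  qed
  have "orb H x \<subseteq> (\<Union>s\<in>\<phi> ` H. r s ` orb K x)"
  proof
    fix y assume "y \<in> orb H x"
    then obtain \<sigma> where \<sigma>: "\<sigma> \<in> H" "y = \<sigma> x" by (auto simp: orb_def)
    define s where "s = \<phi> \<sigma>"
    have rs: "r s \<in> H" "\<phi> (r s) = \<phi> \<sigma>" using r[of s] \<sigma> by (auto simp: s_def)
    then have "inv (r s) \<circ> \<sigma> \<in> K" using \<phi>[of \<sigma> "r s"] \<sigma> by simp
    moreover have "y = r s ((inv (r s) \<circ> \<sigma>) x)"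
      using Gal_inv_apply[OF group_GQ[OF rs(1)]] \<sigma> by simp
    ultimately show "y \<in> (\<Union>s\<in>\<phi> ` H. r s ` orb K x)"
      using \<sigma>(1) unfolding orb_def s_def by blast
  qed
  then have "card (orb H x) \<le> card (\<Union>s\<in>\<phi> ` H. r s ` orb K x)"
    by (rule card_mono[OF finite_UN_I[OF fin finite_imageI[OF finK]]])
  also have "\<dots> \<le> (\<Sum>s\<in>\<phi> ` H. card (r s ` orb K x))" using fin by (rule card_UN_le)
  also have "\<dots> \<le> (\<Sum>s\<in>\<phi> ` H. card (orb K x))"
    using finK by (intro sum_mono card_image_le)
  finally show ?thesis by simp
qed

definition pointwise_stabilizer :: "'a set \<Rightarrow> ('a \<Rightarrow> 'a) set" where
  "pointwise_stabilizer K = {\<sigma>\<in>H. \<forall>x\<in>K. \<sigma> x = x}"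

lemma Galois_group_pointwise_stabilizer: "Galois_group (pointwise_stabilizer K)"
proof -
  have "inv \<sigma> x = x" if "\<sigma> \<in> H" "\<sigma> x = x" for \<sigma> x
    using Gal_inv_apply(2)[OF group_GQ[OF that(1)], of x] that(2) by simp
  then show ?thesis
    unfolding Galois_group_def pointwise_stabilizer_def
    using group_GQ group_comp group_inv group_id by auto
qed

lemma finite_extension_index:
  assumes K: "finite_extension F K" "F \<subseteq> fixed H"
  obtains N where "\<And>x. card (orb H x) \<le> N * card (orb (pointwise_stabilizer K) x)"
proof -
  obtain B where B: "finite B" "B \<subseteq> K" "\<And>x. x \<in> K \<Longrightarrow> \<exists>c. (\<forall>b\<in>B. c b \<in> F) \<and> x = (\<Sum>b\<in>B. c b * b)"
    using K(1) unfolding finite_extension_def by blast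
  define \<phi> where "\<phi> \<sigma> = restrict \<sigma> B" for \<sigma> :: "'a \<Rightarrow> 'a"
  have "\<phi> ` H \<subseteq> (\<Pi>\<^sub>E b\<in>B. orb H b)" by (auto simp: \<phi>_def orb_def)
  then have fin: "finite (\<phi> ` H)"
    using B(1) orb_finite by (meson finite_PiE finite_subset)
  have "inv \<tau> \<circ> \<sigma> \<in> pointwise_stabilizer K" if "\<sigma> \<in> H" "\<tau> \<in> H" "\<phi> \<sigma> = \<phi> \<tau>" for \<sigma> \<tau>
  proof -
    define \<rho> where "\<rho> = inv \<tau> \<circ> \<sigma>"
    have \<rho>: "\<rho> \<in> H" unfolding \<rho>_def using that group_comp group_inv by blast
    have "\<rho> b = b" if "b \<in> B" for b
    proof -
      have "\<sigma> b = \<tau> b" using \<open>\<phi> \<sigma> = \<phi> \<tau>\<close> that unfolding \<phi>_def by (metis restrict_apply')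
      then show ?thesis using Gal_inv_apply(2)[OF group_GQ[OF \<open>\<tau> \<in> H\<close>]] by (simp add: \<rho>_def)
    qed
    moreover have "\<rho> a = a" if "a \<in> F" for a using K(2) that \<rho> by (auto simp: fixed_def)
    ultimately have "\<rho> x = x" if "x \<in> K" for x
    proof -
      obtain c where c: "\<forall>b\<in>B. c b \<in> F" "x = (\<Sum>b\<in>B. c b * b)" using B(3) \<open>x \<in> K\<close> by blast
      have "\<rho> x = (\<Sum>b\<in>B. \<rho> (c b) * \<rho> b)"
        by (simp add: c(2) Gal_sum[OF group_GQ[OF \<rho>]] Gal_mult[OF group_GQ[OF \<rho>]])
      also have "\<dots> = x"
        unfolding c(2) using c(1) \<open>\<And>b. b \<in> B \<Longrightarrow> \<rho> b = b\<close> \<open>\<And>a. a \<in> F \<Longrightarrow> \<rho> a = a\<close>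
        by (intro sum.cong) auto
      finally show ?thesis .
    qed
    then show ?thesis using \<rho> unfolding pointwise_stabilizer_def \<rho>_def by blast
  qed
  then show thesis
    using that card_orb_index[OF Galois_group_pointwise_stabilizer _ fin] by blast
qed

end

lemma total_boundedness:
  assumes "0 < \<epsilon>"
  obtains A where "finite A"
    "\<And>y. absv y \<le> 1 \<Longrightarrow> card (orb GQ y) \<le> M \<Longrightarrow> \<exists>z\<in>A. absv (y - z) \<le> \<epsilon>"
proof -
  have GQ: "Galois_group GQ" by (rule Galois_group_Gal) simp
  define \<delta> where "\<delta> = min \<epsilon> 1"
  have \<delta>: "0 < \<delta>" "\<delta> \<le> 1" "\<delta> \<le> \<epsilon>" using assms by (auto simp: \<delta>_def)
  obtain k where k: "(1 / real p) ^ k < \<delta> ^ M"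
    using real_arch_pow_inv[of "\<delta> ^ M" "1 / real p"] \<delta> p_gt_1 by auto
  define g :: "nat \<Rightarrow> (nat \<Rightarrow> nat) \<Rightarrow> 'a poly" where
    "g d n = monom 1 d + (\<Sum>i<d. monom (of_nat (n i)) i)" for d n
  have coeff_g: "coeff (g d n) i = (if i = d then 1 else if i < d then of_nat (n i) else 0)" for d n i
    unfolding g_def coeff_add coeff_sum coeff_monom by (simp add: sum.delta)
  have deg_g: "degree (g d n) = d" for d n
  proof (rule antisym)
    show "degree (g d n) \<le> d" by (intro degree_le) (auto simp: coeff_g)
    show "d \<le> degree (g d n)" by (intro le_degree) (simp add: coeff_g)
  qed
  have lc_g: "lead_coeff (g d n) = 1" for d n by (simp add: deg_g coeff_g)
  have g0: "g d n \<noteq> 0" for d n using lc_g[of d n] by auto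
  define A where "A = (\<Union>d\<in>{..M}. \<Union>n\<in>({..<d} \<rightarrow>\<^sub>E {..<p ^ k}). {z. poly (g d n) z = 0})"
  have "finite A"
    unfolding A_def using g0 poly_roots_finite by (intro finite_UN_I finite_PiE) auto
  moreover have "\<exists>z\<in>A. absv (y - z) \<le> \<epsilon>" if y: "absv y \<le> 1" "card (orb GQ y) \<le> M" for y
  proof -
    define P where "P = orb_poly GQ y"
    define d where "d = card (orb GQ y)"
    have dP: "degree P = d" unfolding P_def d_def by (rule orb_poly_degree[OF GQ])
    have "coeff P i \<in> Qp absv" for i
      using orb_poly_over[OF GQ] fixed_Gal[OF Qp_subfield] unfolding P_def poly_over_def by auto
    then have "\<exists>n<p ^ k. absv (coeff P i - of_nat n) \<le> (1 / real p) ^ k" for i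
      using Qp_approx_nat[of "coeff P i" k] orb_poly_integral[OF GQ y(1)] unfolding P_def by metis
    then obtain n where n: "\<And>i. n i < p ^ k" "\<And>i. absv (coeff P i - of_nat (n i)) \<le> (1 / real p) ^ k"
      by metis
    define Q where "Q = g d (restrict n {..<d})"
    have lcP: "coeff P d = 1" using orb_poly_monic[OF GQ, of y] dP unfolding P_def by simp
    have le: "absv (coeff (Q - P) i) \<le> (1 / real p) ^ k" for i
      unfolding Q_def using n(2)[of i] lcP coeff_eq_0[of P i] dP
      by (auto simp: coeff_g absv_diff_commute)
    have "poly Q y = poly (Q - P) y" using orb_poly_root[OF GQ] by (simp add: P_def)
    also have "absv \<dots> \<le> (1 / real p) ^ k"
      unfolding poly_altdef
    proof (rule absv_sum_le)
      fix i
      have "absv (coeff (Q - P) i) * absv y ^ i \<le> (1 / real p) ^ k * 1"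
        using le[of i] y(1) absv_nonneg by (intro mult_mono power_le_one) auto
      then show "absv (coeff (Q - P) i * y ^ i) \<le> (1 / real p) ^ k"
        by (simp add: absv_mult absv_power)
    qed simp
    finally have small: "absv (poly Q y) < \<delta> ^ M" using k by simp
    obtain R where R: "size R = d" "\<And>x. poly Q x = (\<Prod>a\<in>#R. x - a)" "\<And>a. a \<in># R \<Longrightarrow> poly Q a = 0"
      using monic_factorization[of Q] lc_g deg_g unfolding Q_def by metis
    have "\<exists>a\<in>#R. absv (y - a) < \<delta>"
    proof (rule ccontr)
      assume "\<not> ?thesis"
      then have "\<delta> ^ size R \<le> (\<Prod>a\<in>#R. absv (y - a))"
        using \<delta> by (intro prod_mset_ge_power) (auto simp: not_less)
      also have "\<dots> = absv (poly Q y)" by (simp add: R(2) absv_prod_mset image_mset.compositionality comp_def)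
      finally have "\<delta> ^ d < \<delta> ^ M" using small R(1) by simp
      moreover have "\<delta> ^ M \<le> \<delta> ^ d" using y(2) \<delta> unfolding d_def by (intro power_decreasing) auto
      ultimately show False by simp
    qed
    then obtain a where a: "a \<in># R" "absv (y - a) < \<delta>" by blast
    have "restrict n {..<d} \<in> {..<d} \<rightarrow>\<^sub>E {..<p ^ k}" using n(1) by auto
    then have "a \<in> A" unfolding A_def using R(3)[OF a(1)] y(2) unfolding Q_def d_def by blast
    then show ?thesis using a(2) \<delta>(3) by force
  qed
  ultimately show thesis by (rule that)
qed

lemma absv_fact_le:
  assumes "0 < n" "n \<le> M"
  shows "absv (fact M) \<le> absv (of_nat n)"
proof -
  have "n dvd fact M" using assms by (simp add: dvd_fact)
  then obtain k where "(fact M :: nat) = n * k" by auto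
  then have "(fact M :: 'a) = of_nat n * of_nat k" by (metis of_nat_fact of_nat_mult)
  then show ?thesis using absv_of_nat_le_1[of k] absv_nonneg by (simp add: absv_mult mult_left_le)
qed

lemma close_automorphism_fixes:
  assumes w: "card (orb GQ w) \<le> M" and \<sigma>\<^sub>0: "\<sigma>\<^sub>0 \<in> GQ"
    and close: "\<And>y. absv y \<le> 1 \<Longrightarrow> card (orb GQ y) \<le> M \<Longrightarrow>
      absv (\<sigma>\<^sub>0 y - y) \<le> absv (of_nat p) * absv (fact M)"
  shows "\<sigma>\<^sub>0 w = w"
proof -
  define c where "c = absv (of_nat p) * absv (fact M)"
  have c0: "c \<ge> 0" unfolding c_def using absv_nonneg by simp
  have GQ: "Galois_group GQ" by (rule Galois_group_Gal) simp
  define U where "U = pointwise_stabilizer GQ {w}"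
  have U: "Galois_group U" unfolding U_def by (rule Galois_group_pointwise_stabilizer[OF GQ])
  define L where "L = fixed U"
  have Lsub: "is_subfield L" unfolding L_def by (rule fixed_subfield[OF U])
  have "w \<in> L" by (auto simp: L_def U_def fixed_def pointwise_stabilizer_def[OF GQ])
  have orbL: "card (orb GQ y) \<le> M" if "y \<in> L" for y
  proof -
    have "card (orb GQ y) \<le> card ((\<lambda>\<sigma>. \<sigma> w) ` GQ) * card (orb U y)"
    proof (rule card_orb_index[OF GQ U])
      fix \<sigma> \<tau> assume "\<sigma> \<in> GQ" "\<tau> \<in> GQ" "\<sigma> w = \<tau> w"
      then show "inv \<tau> \<circ> \<sigma> \<in> U"
        using Gal_comp[OF Gal_inv] Gal_inv_apply(2)[of \<tau> "Qp absv" w]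
        by (simp add: U_def pointwise_stabilizer_def[OF GQ])
    qed (use orb_finite[OF GQ] in \<open>simp add: orb_def\<close>)
    moreover have "orb U y = {y}" using that fixed_iff_orb[OF U] by (simp add: L_def)
    ultimately show ?thesis using w by (simp add: orb_def)
  qed
  define S where "S = {\<sigma>\<in>GQ. \<forall>y\<in>L. absv y \<le> 1 \<longrightarrow> absv (\<sigma> y - y) \<le> c}"
  have SD: "absv (\<sigma> y - y) \<le> c" if "\<sigma> \<in> S" "y \<in> L" "absv y \<le> 1" for \<sigma> y
    using that by (auto simp: S_def)
  have "\<sigma>\<^sub>0 \<in> S" using \<sigma>\<^sub>0 close orbL by (auto simp: S_def c_def)
  have US: "U \<subseteq> S" using c0 by (auto simp: S_def L_def U_def fixed_def pointwise_stabilizer_def[OF GQ])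
  have S: "Galois_group S"
    unfolding Galois_group_def
  proof (intro conjI ballI)
    show "S \<subseteq> GQ" by (auto simp: S_def)
    show "id \<in> S" using c0 Gal_id by (auto simp: S_def)
  next
    fix \<sigma> \<tau> assume *: "\<sigma> \<in> S" "\<tau> \<in> S"
    then have G: "\<sigma> \<in> GQ" "\<tau> \<in> GQ" by (auto simp: S_def)
    have "absv (\<sigma> (\<tau> y) - y) \<le> c" if "y \<in> L" "absv y \<le> 1" for y
    proof -
      have "absv (\<sigma> (\<tau> y) - \<sigma> y) = absv (\<tau> y - y)"
        using Gal_absv[OF G(1), of "\<tau> y - y"] Gal_diff[OF G(1)] by simp
      then show ?thesis
        using absv_ultrametric[of "\<sigma> (\<tau> y)" y "\<sigma> y"] SD[OF *(1) that] SD[OF *(2) that] by simp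
    qed
    then show "\<sigma> \<circ> \<tau> \<in> S" using Gal_comp[OF G] by (simp add: S_def)
  next
    fix \<sigma> assume *: "\<sigma> \<in> S"
    then have G: "\<sigma> \<in> GQ" by (auto simp: S_def)
    have "absv (inv \<sigma> y - y) \<le> c" if "y \<in> L" "absv y \<le> 1" for y
    proof -
      have "absv (inv \<sigma> y - y) = absv (\<sigma> (inv \<sigma> y - y))" using Gal_absv[OF G] by simp
      also have "\<dots> = absv (y - \<sigma> y)" by (simp add: Gal_diff[OF G] Gal_inv_apply[OF G])
      finally show ?thesis using SD[OF * that] absv_diff_commute by simp
    qed
    then show "inv \<sigma> \<in> S" using Gal_inv[OF G] by (simp add: S_def)
  qed
  have FL: "fixed S \<subseteq> L" unfolding L_def by (rule fixed_antimono[OF US])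
  have Fsub: "is_subfield (fixed S)" by (rule fixed_subfield[OF S])
  have avg: "\<exists>u\<in>fixed S. absv (y - u) \<le> absv (of_nat p)" if y: "y \<in> L" "absv y \<le> 1" for y
  proof -
    define n where "n = card (orb S y)"
    have n: "0 < n" "n \<le> M"
      using orb_card_pos[OF S] orbL[OF y(1)] card_mono[OF orb_finite[OF GQ] orb_mono[of S GQ y]]
      by (auto simp: n_def S_def)
    then have n0: "(of_nat n :: 'a) \<noteq> 0" by simp
    define u where "u = (\<Sum>z\<in>orb S y. z) / of_nat n"
    have "\<sigma> u = u" if "\<sigma> \<in> S" for \<sigma>
    proof -
      have G: "\<sigma> \<in> GQ" using that by (simp add: S_def)
      have "(\<Sum>z\<in>orb S y. \<sigma> z) = (\<Sum>z\<in>\<sigma> ` orb S y. z)"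
        by (subst sum.reindex) (auto simp: inj_on_def Gal_inj[OF G])
      then show ?thesis
        unfolding u_def by (simp add: Gal_divide[OF G] Gal_of_nat[OF G] Gal_sum[OF G] orb_image[OF S that])
    qed
    then have "u \<in> fixed S" by (simp add: fixed_def)
    moreover have "absv (y - u) \<le> absv (of_nat p)"
    proof -
      have "(\<Sum>z\<in>orb S y. y - z) = of_nat n * y - (\<Sum>z\<in>orb S y. z)"
        by (simp add: sum_subtractf n_def)
      then have "y - u = (\<Sum>z\<in>orb S y. y - z) / of_nat n"
        using n0 by (simp add: u_def field_simps)
      moreover have "absv (\<Sum>z\<in>orb S y. y - z) \<le> c"
      proof (rule absv_sum_le[OF c0])
        fix z assume "z \<in> orb S y"
        then obtain \<sigma> where "\<sigma> \<in> S" "z = \<sigma> y" by (auto simp: orb_def)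
        then show "absv (y - z) \<le> c" using SD[of \<sigma> y] y absv_diff_commute by simp
      qed
      ultimately have "absv (y - u) \<le> c / absv (of_nat n)"
        by (simp add: absv_divide divide_right_mono absv_nonneg)
      also have "\<dots> \<le> c / absv (fact M)"
        using absv_fact_le[OF n] c0 absv_pos[of "fact M"] by (intro divide_left_mono mult_pos_pos) (auto intro: absv_pos simp: n0)
      also have "\<dots> = absv (of_nat p)" using absv_pos[of "fact M"] by (simp add: c_def)
      finally show ?thesis .
    qed
    ultimately show ?thesis by blast
  qed
  have iter: "\<forall>y\<in>L. absv y \<le> 1 \<longrightarrow> (\<exists>u\<in>fixed S. absv (y - u) \<le> absv (of_nat p) ^ k)" for k
  proof (induction k)
    case 0
    then show ?case using subfield_0[OF Fsub] by (intro ballI impI bexI[of _ 0]) auto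
  next
    case (Suc k)
    show ?case
    proof (intro ballI impI)
      fix y assume y: "y \<in> L" "absv y \<le> 1"
      obtain u where u: "u \<in> fixed S" "absv (y - u) \<le> absv (of_nat p)" using avg[OF y] by blast
      have p0: "(of_nat p :: 'a) \<noteq> 0" using p_gt_1 by simp
      define y' where "y' = (y - u) / of_nat p"
      have "y' \<in> L" unfolding y'_def
        using y(1) u(1) FL by (intro subfield_divide[OF Lsub] subfield_diff[OF Lsub] subfield_of_nat[OF Lsub]) auto
      moreover have "absv y' \<le> 1" unfolding y'_def absv_divide using u(2) absv_p_pos by simp
      ultimately obtain u' where u': "u' \<in> fixed S" "absv (y' - u') \<le> absv (of_nat p) ^ k"
        using Suc by blast
      have "y - (u + of_nat p * u') = of_nat p * (y' - u')"
        using p0 by (simp add: y'_def field_simps)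
      then have "absv (y - (u + of_nat p * u')) \<le> absv (of_nat p) ^ Suc k"
        using u'(2) absv_p_pos by (simp add: absv_mult mult_left_mono)
      moreover have "u + of_nat p * u' \<in> fixed S"
        using u u' by (intro subfield_add[OF Fsub] subfield_mult[OF Fsub] subfield_of_nat[OF Fsub])
      ultimately show "\<exists>u\<in>fixed S. absv (y - u) \<le> absv (of_nat p) ^ Suc k" by blast
    qed
  qed
  have fix1: "\<sigma>\<^sub>0 y = y" if y: "y \<in> L" "absv y \<le> 1" for y
  proof (rule ccontr)
    assume "\<sigma>\<^sub>0 y \<noteq> y"
    then have "absv (\<sigma>\<^sub>0 y - y) > 0" by (intro absv_pos) simp
    then obtain k where k: "absv (of_nat p) ^ k < absv (\<sigma>\<^sub>0 y - y)"
      using real_arch_pow_inv absv_p_less_1 by blast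
    obtain u where u: "u \<in> fixed S" "absv (y - u) \<le> absv (of_nat p) ^ k" using iter y by blast
    have "\<sigma>\<^sub>0 u = u" using u(1) \<open>\<sigma>\<^sub>0 \<in> S\<close> by (simp add: fixed_def)
    then have "absv (\<sigma>\<^sub>0 y - u) = absv (y - u)"
      using Gal_absv[OF \<sigma>\<^sub>0, of "y - u"] Gal_diff[OF \<sigma>\<^sub>0] by simp
    then have "absv (\<sigma>\<^sub>0 y - y) \<le> absv (y - u)"
      using absv_ultrametric[of "\<sigma>\<^sub>0 y" y u] absv_diff_commute[of u y] by simp
    then show False using u(2) k by simp
  qed
  obtain j where "absv (of_nat p) ^ j < 1 / (1 + absv w)"
    using real_arch_pow_inv[of "1 / (1 + absv w)"] absv_p_less_1 absv_nonneg[of w] by auto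
  then have "absv (of_nat p) ^ j * (1 + absv w) < 1"
    using absv_nonneg[of w] by (simp add: pos_less_divide_eq)
  moreover have "absv (of_nat p ^ j * w) \<le> absv (of_nat p) ^ j * (1 + absv w)"
    unfolding absv_mult absv_power using absv_p_pos by (intro mult_left_mono) auto
  ultimately have "absv (of_nat p ^ j * w) \<le> 1" by simp
  then have "\<sigma>\<^sub>0 (of_nat p ^ j * w) = of_nat p ^ j * w"
    using \<open>w \<in> L\<close> by (intro fix1 subfield_mult[OF Lsub] subfield_power[OF Lsub] subfield_of_nat[OF Lsub])
  then show ?thesis
    using p_gt_1 by (simp add: Gal_mult[OF \<sigma>\<^sub>0] Gal_power[OF \<sigma>\<^sub>0] Gal_of_nat[OF \<sigma>\<^sub>0])
qed

text \<open>This replaces the finiteness of the set of extensions of bounded degree.\<close>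

lemma bounded_orbits_finitely_generated:
  obtains A where "finite A"
    "\<And>\<sigma> w. \<sigma> \<in> GQ \<Longrightarrow> (\<And>z. z \<in> A \<Longrightarrow> \<sigma> z = z) \<Longrightarrow> card (orb GQ w) \<le> M \<Longrightarrow> \<sigma> w = w"
proof -
  define c where "c = absv (of_nat p) * absv (fact M)"
  have "c > 0" unfolding c_def using absv_p_pos absv_pos[of "fact M"] by simp
  then obtain A where A: "finite A"
    "\<And>y. absv y \<le> 1 \<Longrightarrow> card (orb GQ y) \<le> M \<Longrightarrow> \<exists>z\<in>A. absv (y - z) \<le> c"
    using total_boundedness[of c M] by metis
  have "\<sigma> w = w" if \<sigma>: "\<sigma> \<in> GQ" "\<And>z. z \<in> A \<Longrightarrow> \<sigma> z = z" and w: "card (orb GQ w) \<le> M" for \<sigma> w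
  proof (rule close_automorphism_fixes[OF w \<sigma>(1)])
    fix y assume "absv y \<le> 1" "card (orb GQ y) \<le> M"
    then obtain z where z: "z \<in> A" "absv (y - z) \<le> c" using A(2) by blast
    have "absv (\<sigma> y - z) = absv (y - z)"
      using Gal_absv[OF \<sigma>(1), of "y - z"] Gal_diff[OF \<sigma>(1)] \<sigma>(2)[OF z(1)] by simp
    then show "absv (\<sigma> y - y) \<le> absv (of_nat p) * absv (fact M)"
      using absv_ultrametric[of "\<sigma> y" y z] absv_diff_commute[of z y] z(2) by (simp add: c_def)
  qed
  with A(1) show thesis by (rule that)
qed

end

section \<open>Ramification and points of disks\<close>

lemma finite_image_of_finite_image:
  assumes "finite (g ` A)" "\<And>x y. x \<in> A \<Longrightarrow> y \<in> A \<Longrightarrow> g x = g y \<Longrightarrow> f x = f y"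
  shows "finite (f ` A)"
proof (rule finite_surj[OF assms(1)])
  show "f ` A \<subseteq> (\<lambda>t. f (SOME x. x \<in> A \<and> g x = t)) ` g ` A"
  proof
    fix y assume "y \<in> f ` A"
    then obtain x where x: "x \<in> A" "y = f x" by blast
    define z where "z = (SOME z. z \<in> A \<and> g z = g x)"
    have "z \<in> A \<and> g z = g x" unfolding z_def by (rule someI[of _ x]) (use x in simp)
    then have "y = f z" using assms(2)[of x z] x by simp
    then show "y \<in> (\<lambda>t. f (SOME x. x \<in> A \<and> g x = t)) ` g ` A"
      using x(1) unfolding z_def by blast
  qed
qed

context Qp_algebraic_closure
begin

lemma Galois_group_GQ: "Galois_group GQ"
  by (rule Galois_group_Gal) simp

lemma real_p_gt_1: "1 < real p"
  using p_gt_1 by simp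

lemma absv_power_fixed:
  assumes H: "Galois_group H" and "x \<noteq> 0"
  obtains f where "f \<in> fixed H" "f \<noteq> 0" "absv f = absv x ^ card (orb H x)"
proof -
  define f where "f = (\<Prod>y\<in>orb H x. y)"
  have "\<sigma> f = f" if "\<sigma> \<in> H" for \<sigma>
  proof -
    have G: "\<sigma> \<in> GQ" using H that by (auto simp: Galois_group_def)
    have "\<sigma> f = (\<Prod>y\<in>\<sigma> ` orb H x. y)"
      unfolding f_def Gal_prod[OF G] by (subst prod.reindex) (auto simp: inj_on_def Gal_inj[OF G])
    then show ?thesis using orb_image[OF H that] by (simp add: f_def)
  qed
  then have "f \<in> fixed H" by (simp add: fixed_def)
  moreover have eq: "absv f = absv x ^ card (orb H x)"
    unfolding f_def absv_prod using orb_absv[OF H] by simp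
  moreover have "f \<noteq> 0"
  proof
    assume "f = 0"
    then show False using eq absv_pos[OF assms(2)] by simp
  qed
  ultimately show thesis using that by blast
qed

lemma absv_power_fact:
  assumes "x \<noteq> 0" "card (orb GQ x) \<le> M"
  obtains j :: int where "absv x ^ fact M = real p powi j"
proof -
  obtain f where f: "f \<in> fixed GQ" "f \<noteq> 0" "absv f = absv x ^ card (orb GQ x)"
    using absv_power_fixed[OF Galois_group_GQ assms(1)] by blast
  then have "f \<in> Qp absv" using fixed_Gal[OF Qp_subfield] by simp
  then obtain i where i: "absv f = real p powi i" using Qp_absv f(2) by blast
  have "card (orb GQ x) dvd fact M"
    using assms(2) orb_card_pos[OF Galois_group_GQ, of x] by (simp add: dvd_fact)
  then obtain k where k: "fact M = card (orb GQ x) * k" by blast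
  have "absv x ^ fact M = real p powi (i * int k)"
    unfolding k power_mult f(3)[symmetric] i by (simp add: power_int_mult)
  then show thesis by (rule that)
qed

lemma powi_p_less_iff: "real p powi i < real p powi j \<longleftrightarrow> i < j"
proof (cases i j rule: linorder_cases)
  case greater
  then show ?thesis using power_int_strict_increasing[OF _ real_p_gt_1, of j i] by simp
qed (use power_int_strict_increasing[OF _ real_p_gt_1, of i j] in auto)

lemma powi_p_pos: "0 < real p powi i"
  using p_gt_1 by simp

definition ramification_cosets :: "'a set \<Rightarrow> 'a set \<Rightarrow> real set set" where
  "ramification_cosets F K =
    (\<lambda>r. (\<lambda>u. r * u) ` value_group absv F) ` value_group absv K"

lemma ramification_index_eq: "ramification_index absv F K = card (ramification_cosets F K)"
  by (simp add: ramification_index_def ramification_cosets_def)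

context
  fixes F :: "'a set"
  assumes F: "is_subfield F"
begin

lemma value_group_1: "1 \<in> value_group absv F"
  unfolding value_group_def using subfield_1[OF F] by (intro image_eqI[of _ _ 1]) auto

lemma value_group_mult:
  "r \<in> value_group absv F \<Longrightarrow> s \<in> value_group absv F \<Longrightarrow> r * s \<in> value_group absv F"
  unfolding value_group_def using subfield_mult[OF F] by (auto simp: absv_mult[symmetric])

lemma value_group_divide:
  assumes "r \<in> value_group absv F" "s \<in> value_group absv F"
  shows "r / s \<in> value_group absv F"
proof -
  obtain x y where "x \<in> F" "x \<noteq> 0" "r = absv x" "y \<in> F" "y \<noteq> 0" "s = absv y"
    using assms unfolding value_group_def by auto
  then show ?thesis unfolding value_group_def using subfield_divide[OF F, of x y]
    by (intro image_eqI[of _ _ "x / y"]) (auto simp: absv_divide)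
qed

lemma value_group_power: "r \<in> value_group absv F \<Longrightarrow> r ^ n \<in> value_group absv F"
  by (induction n) (auto intro: value_group_mult value_group_1)

lemma value_group_pos: "r \<in> value_group absv F \<Longrightarrow> 0 < r"
  unfolding value_group_def using absv_pos by auto

lemma value_group_powi:
  assumes "Qp absv \<subseteq> F"
  shows "real p powi j \<in> value_group absv F"
proof -
  have "(of_nat p :: 'a) \<in> F" using subfield_of_nat[OF F] by blast
  then have p: "absv (of_nat p) \<in> value_group absv F"
    unfolding value_group_def using p_gt_1 by auto
  then have "1 / absv (of_nat p) \<in> value_group absv F"
    using value_group_divide value_group_1 by blast
  then have "(1 / absv (of_nat p)) ^ n \<in> value_group absv F" for n by (rule value_group_power)
  moreover have "absv (of_nat p) ^ n \<in> value_group absv F" for n using p by (rule value_group_power)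
  ultimately show ?thesis
    unfolding absv_p by (cases j) (auto simp: power_int_def power_one_over inverse_eq_divide)
qed

lemma coset_eqI:
  assumes "r / s \<in> value_group absv F" "s / r \<in> value_group absv F" "r > 0" "s > 0"
  shows "(\<lambda>u. r * u) ` value_group absv F = (\<lambda>u. s * u) ` value_group absv F"
proof -
  have "(\<lambda>u. r * u) ` value_group absv F \<subseteq> (\<lambda>u. s * u) ` value_group absv F"
    if "r / s \<in> value_group absv F" "s > 0" for r s
  proof clarify
    fix u assume "u \<in> value_group absv F"
    then have "r / s * u \<in> value_group absv F" using that value_group_mult by blast
    then show "r * u \<in> (\<lambda>u. s * u) ` value_group absv F"
      using that(2) by (intro image_eqI[of _ _ "r / s * u"]) auto
  qed
  then show ?thesis using assms by blast
qed

lemma coset_eqD: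
  assumes "(\<lambda>u. r * u) ` value_group absv F = (\<lambda>u. s * u) ` value_group absv F"
  obtains u where "u \<in> value_group absv F" "r = s * u"
proof -
  have "r * 1 \<in> (\<lambda>u. r * u) ` value_group absv F" using value_group_1 by (rule imageI)
  then have "r \<in> (\<lambda>u. s * u) ` value_group absv F" using assms by simp
  then show thesis using that by blast
qed

context
  fixes K :: "'a set" and M :: nat
  assumes K: "is_subfield K" and FK: "F \<subseteq> K" and QF: "Qp absv \<subseteq> F"
    and bounded: "\<And>x. x \<in> K \<Longrightarrow> card (orb GQ x) \<le> M"
begin

lemma value_group_power_fact:
  assumes "r \<in> value_group absv K"
  obtains j :: int where "r ^ fact M = real p powi j"
proof -
  obtain x where "x \<in> K" "x \<noteq> 0" "r = absv x" using assms unfolding value_group_def by auto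
  then show thesis using absv_power_fact[of x M] bounded that by blast
qed

lemma finite_ramification_cosets: "finite (ramification_cosets F K)"
proof -
  define g where "g r = (SOME j :: int. r ^ fact M = real p powi j) mod fact M" for r :: real
  have g: "\<exists>j. r ^ fact M = real p powi j \<and> g r = j mod fact M" if r: "r \<in> value_group absv K" for r
  proof -
    have "\<exists>j :: int. r ^ fact M = real p powi j" using value_group_power_fact[OF r] by metis
    then have "r ^ fact M = real p powi (SOME j :: int. r ^ fact M = real p powi j)" by (rule someI_ex)
    then show ?thesis unfolding g_def by blast
  qed
  have "g ` value_group absv K \<subseteq> {0..<fact M}" unfolding g_def by auto
  then have fin: "finite (g ` value_group absv K)" by (rule finite_subset) simp
  have pos: "r > 0" if "r \<in> value_group absv K" for r using that absv_pos by (auto simp: value_group_def)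
  have quot: "r / s \<in> value_group absv F" if rs: "r \<in> value_group absv K" "s \<in> value_group absv K" "g r = g s" for r s
  proof -
    obtain i where i: "r ^ fact M = real p powi i" "g r = i mod fact M" using g[OF rs(1)] by blast
    obtain j where j: "s ^ fact M = real p powi j" "g s = j mod fact M" using g[OF rs(2)] by blast
    obtain k where k: "i - j = fact M * k" using i j rs(3) by (metis mod_eq_dvd_iff dvd_def)
    have "(r / s) ^ fact M = real p powi (i - j)"
      using p_gt_1 by (simp add: power_divide i j power_int_diff)
    also have "\<dots> = (real p powi k) ^ fact M"
    proof -
      have "(fact M :: int) = int (fact M)" by (simp only: of_nat_fact)
      then show ?thesis unfolding k by (simp only: power_int_mult power_int_of_nat mult.commute[of "int _"])
    qed
    finally have "r / s = real p powi k"
      using pos rs powi_p_pos[of k] power_eq_imp_eq_base[of "r / s" "fact M" "real p powi k"]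
      by (simp add: less_imp_le)
    then show ?thesis using value_group_powi[OF QF] by simp
  qed
  show ?thesis
    unfolding ramification_cosets_def
    by (rule finite_image_of_finite_image[OF fin], rule coset_eqI) (use quot pos in auto)
qed

lemma ramification_index_pos: "0 < ramification_index absv F K"
proof -
  have "ramification_cosets F K \<noteq> {}"
    unfolding ramification_cosets_def value_group_def using subfield_1[OF K] by (auto intro: exI[of _ 1])
  then show ?thesis unfolding ramification_index_eq
    using finite_ramification_cosets by (simp add: card_gt_0_iff)
qed

lemma ramification_pigeonhole:
  assumes "\<And>i. i \<le> ramification_index absv F K \<Longrightarrow> r i \<in> value_group absv K"
  obtains i j u where "i < j" "j \<le> ramification_index absv F K" "u \<in> value_group absv F" "r j = r i * u"
proof -
  define s where "s = ramification_index absv F K"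
  define c where "c i = (\<lambda>u. r i * u) ` value_group absv F" for i :: nat
  have "c ` {..s} \<subseteq> ramification_cosets F K"
    unfolding c_def ramification_cosets_def using assms by (auto simp: s_def)
  then have "card (c ` {..s}) \<le> s"
    unfolding s_def ramification_index_eq by (rule card_mono[OF finite_ramification_cosets])
  then have "\<not> inj_on c {..s}" by (intro pigeonhole) simp
  then obtain i j where ij: "i \<le> s" "j \<le> s" "i \<noteq> j" "c i = c j" unfolding inj_on_def by auto
  have *: "\<exists>u\<in>value_group absv F. r j = r i * u" if "c i = c j" for i j
    using that unfolding c_def by (metis coset_eqD)
  show thesis
  proof (cases "i < j")
    case True
    then show thesis using *[OF ij(4)] that ij unfolding s_def by blast
  next
    case False
    then have "j < i" using ij(3) by simp
    then show thesis using *[OF ij(4)[symmetric]] that ij unfolding s_def by blast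
  qed
qed

lemma value_group_least:
  assumes "V \<subseteq> value_group absv K" "V \<noteq> {}" "0 < \<delta>" "\<And>r. r \<in> V \<Longrightarrow> \<delta> \<le> r"
  obtains r where "r \<in> V" "\<And>s. s \<in> V \<Longrightarrow> r \<le> s"
proof -
  define g where "g r = (SOME j :: int. r ^ fact M = real p powi j)" for r :: real
  have g: "r ^ fact M = real p powi (g r)" if "r \<in> V" for r
  proof -
    have "\<exists>j :: int. r ^ fact M = real p powi j" using value_group_power_fact assms(1) that by (metis subsetD)
    then show ?thesis unfolding g_def by (rule someI_ex)
  qed
  obtain n where n: "(1 / real p) ^ n < \<delta> ^ fact M"
    using real_arch_pow_inv[of "\<delta> ^ fact M" "1 / real p"] assms(3) real_p_gt_1 by auto
  have low: "- int n < g r" if "r \<in> V" for r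
  proof -
    have "real p powi (- int n) = (1 / real p) ^ n"
      by (simp add: power_int_minus power_one_over inverse_eq_divide)
    also note n
    also have "\<delta> ^ fact M \<le> real p powi (g r)"
      using assms(3,4) that g[OF that] by (metis less_imp_le power_mono)
    finally show ?thesis using powi_p_less_iff by blast
  qed
  obtain r0 where "r0 \<in> V" using assms(2) by blast
  then obtain r where r: "r \<in> V" "\<And>s. s \<in> V \<Longrightarrow> nat (g r + int n) \<le> nat (g s + int n)"
    using ex_has_least_nat[of "\<lambda>r. r \<in> V" r0 "\<lambda>r. nat (g r + int n)"] by blast
  have "r \<le> s" if s: "s \<in> V" for s
  proof -
    have "g r \<le> g s" using r(2)[OF s] low[OF s] low[OF r(1)] by linarith
    then have "r ^ fact M \<le> s ^ fact M"
      using g[OF s] g[OF r(1)] powi_p_less_iff[of "g s" "g r"] by simp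
    moreover have "0 \<le> s" using assms(3,4) s by (meson less_imp_le order_trans)
    ultimately show ?thesis by (rule power_le_imp_le_base[where n = "fact M - 1", simplified])
  qed
  with r(1) show thesis by (rule that)
qed

end

end

lemma absv_frobenius:
  assumes "absv u \<le> 1" "absv v \<le> 1"
  shows "absv ((u + v) ^ p - u ^ p - v ^ p) < 1"
proof -
  have p0: "p > 0" using p_gt_1 by simp
  obtain m where m: "p = Suc m" using p0 gr0_implies_Suc by blast
  define t where "t k = of_nat (p choose k) * u ^ k * v ^ (p - k)" for k
  have "(u + v) ^ p = (\<Sum>k\<le>p. t k)" unfolding t_def by (rule binomial_ring)
  also have "\<dots> = t 0 + (\<Sum>k\<in>{1..<p}. t k) + t p"
  proof -
    have "{..p} = insert 0 (insert p {1..<p})" using p0 by auto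
    then show ?thesis using p0 by simp
  qed
  finally have "(u + v) ^ p - u ^ p - v ^ p = (\<Sum>k\<in>{1..<p}. t k)" by (simp add: t_def)
  also have "absv \<dots> \<le> absv (of_nat p)"
  proof (rule absv_sum_le)
    fix k assume "k \<in> {1..<p}"
    then have "p dvd (p choose k)" using prime_p by (intro dvd_choose_prime) auto
    then obtain c where "p choose k = p * c" by blast
    then have "absv (t k) = absv (of_nat p) * (absv (of_nat c) * absv u ^ k * absv v ^ (p - k))"
      by (simp add: t_def absv_mult absv_power)
    also have "\<dots> \<le> absv (of_nat p) * 1"
      using assms absv_nonneg absv_of_nat_le_1[of c]
      by (intro mult_left_mono mult_le_one mult_nonneg_nonneg power_le_one zero_le_power) auto
    finally show "absv (t k) \<le> absv (of_nat p)" by simp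
  qed (rule absv_nonneg)
  finally show ?thesis using absv_p_less_1 by simp
qed

lemma absv_frobenius_inj:
  assumes "absv a \<le> 1" "absv b \<le> 1" "absv (a ^ p - b ^ p) < 1"
  shows "absv (a - b) < 1"
proof -
  have "absv (a - b) \<le> 1" using absv_diff_le_max[of a b] assms by simp
  then have "absv (a ^ p - (a - b) ^ p - b ^ p) < 1"
    using absv_frobenius[of "a - b" b] assms by simp
  then have "absv ((a - b) ^ p) < 1"
    using absv_diff_le_max[of "a ^ p - b ^ p" "a ^ p - (a - b) ^ p - b ^ p"] assms(3) by simp
  then have "absv (a - b) ^ p < 1" by (simp add: absv_power)
  then show ?thesis using absv_nonneg[of "a - b"] by (metis not_le one_le_power)
qed

lemma absv_power_diff_le:
  assumes "absv a \<le> 1" "absv b \<le> 1"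
  shows "absv (a ^ n - b ^ n) \<le> absv (a - b)"
proof (induction n)
  case (Suc n)
  have "a ^ Suc n - b ^ Suc n = a * (a ^ n - b ^ n) + (a - b) * b ^ n"
    by (simp add: algebra_simps)
  moreover have "absv (a * (a ^ n - b ^ n)) \<le> absv (a - b)"
    using Suc assms(1) absv_nonneg mult_mono[of "absv a" 1 "absv (a ^ n - b ^ n)" "absv (a - b)"]
    by (simp add: absv_mult)
  moreover have "absv ((a - b) * b ^ n) \<le> absv (a - b)"
    using assms(2) absv_nonneg by (simp add: absv_mult absv_power mult_left_le power_le_one)
  ultimately show ?case
    using absv_add_le_max[of "a * (a ^ n - b ^ n)" "(a - b) * b ^ n"] by simp
qed (simp add: absv_nonneg)

lemma root_of_unity_close:
  assumes "a ^ n = a" "b ^ n = b" "absv (of_nat n) < 1" "0 < n" "absv a \<le> 1" "absv b \<le> 1" "absv (a - b) < 1"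
  shows "a = b"
proof (rule ccontr)
  assume "a \<noteq> b"
  obtain m where m: "n = Suc m" using assms(4) gr0_implies_Suc by blast
  define S where "S = (\<Sum>i<Suc m. a ^ i * b ^ (m - i))"
  have "a ^ n - b ^ n = (a - b) * S" unfolding S_def m by (rule diff_power_eq_sum)
  then have "(a - b) * S = a - b" using assms(1,2) by simp
  then have "S = 1" using \<open>a \<noteq> b\<close> by simp
  have "S - of_nat n * b ^ m = (\<Sum>i<Suc m. (a ^ i - b ^ i) * b ^ (m - i))"
  proof -
    have "(\<Sum>i<Suc m. b ^ i * b ^ (m - i)) = (\<Sum>i<Suc m. b ^ m)"
      by (intro sum.cong) (auto simp flip: power_add)
    then show ?thesis unfolding S_def m by (simp add: left_diff_distrib sum_subtractf del: sum.lessThan_Suc)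
  qed
  also have "absv \<dots> \<le> absv (a - b)"
  proof (rule absv_sum_le)
    fix i
    have "absv (a ^ i - b ^ i) * absv b ^ (m - i) \<le> absv (a - b) * 1"
      using absv_power_diff_le assms(5,6) absv_nonneg by (intro mult_mono power_le_one) auto
    then show "absv ((a ^ i - b ^ i) * b ^ (m - i)) \<le> absv (a - b)" by (simp add: absv_mult absv_power)
  qed (rule absv_nonneg)
  finally have 1: "absv (S - of_nat n * b ^ m) < 1" using assms(7) by simp
  have "absv (of_nat n * b ^ m) \<le> absv (of_nat n) * 1"
    unfolding absv_mult absv_power using assms(6) absv_nonneg by (intro mult_left_mono power_le_one) auto
  then have "absv S < 1"
    using 1 assms(3) absv_add_le_max[of "S - of_nat n * b ^ m" "of_nat n * b ^ m"] by simp
  then show False using \<open>S = 1\<close> by simp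
qed

text \<open>The residue of \<open>y\<close> is fixed by \<open>H\<close>, hence so is its Teichmueller representative.\<close>

lemma fixed_residue_lift:
  assumes H: "Galois_group H" and y: "absv y \<le> 1" and inv: "\<And>\<sigma>. \<sigma> \<in> H \<Longrightarrow> absv (\<sigma> y - y) < 1"
  obtains z where "z \<in> fixed H" "absv (y - z) < 1"
proof -
  define M where "M = card (orb GQ y)"
  obtain A where A: "finite A" "\<And>x. absv x \<le> 1 \<Longrightarrow> card (orb GQ x) \<le> M \<Longrightarrow> \<exists>z\<in>A. absv (x - z) \<le> 1/2"
    using total_boundedness[of "1/2" M] by auto
  have y1: "absv (y ^ k) \<le> 1" for k using y absv_nonneg by (simp add: absv_power power_le_one)
  have "\<exists>z\<in>A. absv (y ^ (p ^ i) - z) \<le> 1/2" for i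
    using A(2)[OF y1] card_orb_power[OF Galois_group_GQ] unfolding M_def by blast
  then obtain z where z: "\<And>i. z i \<in> A" "\<And>i. absv (y ^ (p ^ i) - z i) \<le> 1/2" by metis
  have "\<not> inj z"
  proof
    assume "inj z"
    moreover have "finite (range z)" using A(1) z(1) by (meson finite_subset image_subsetI)
    ultimately show False using finite_imageD by (metis infinite_UNIV_nat)
  qed
  then obtain i' j' where "i' \<noteq> j'" "z i' = z j'" unfolding inj_def by blast
  then obtain i j where ij: "i < j" "z i = z j" by (metis nat_neq_iff)
  have "absv (y ^ (p ^ i) - y ^ (p ^ j)) \<le> 1/2"
    using absv_ultrametric[of "y ^ (p ^ i)" "y ^ (p ^ j)" "z i"] z(2)[of i] z(2)[of j] ij(2)
      absv_diff_commute[of "z j" "y ^ (p ^ j)"] by simp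
  define q where "q = p ^ (j - i)"
  have pi: "absv (y ^ (p ^ i) - (y ^ q) ^ (p ^ i)) < 1"
  proof -
    have "(y ^ q) ^ (p ^ i) = y ^ (p ^ j)"
      using ij(1) by (simp add: q_def power_mult[symmetric] power_add[symmetric])
    then show ?thesis using \<open>absv (y ^ (p ^ i) - y ^ (p ^ j)) \<le> 1/2\<close> by simp
  qed
  have "absv (y - y ^ q) < 1" if "absv (y ^ (p ^ i) - (y ^ q) ^ (p ^ i)) < 1" for i
    using that
  proof (induction i)
    case (Suc i)
    have "absv ((y ^ (p ^ i)) ^ p - ((y ^ q) ^ (p ^ i)) ^ p) < 1"
      using Suc.prems by (simp add: power_mult[symmetric] mult_ac)
    moreover have "absv ((y ^ q) ^ (p ^ i)) \<le> 1" using y1[of "q * p ^ i"] by (simp add: power_mult)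
    ultimately show ?case using absv_frobenius_inj[OF y1[of "p ^ i"]] Suc.IH by blast
  qed simp
  then have yq: "absv (y - y ^ q) < 1" using pi by blast
  have q1: "1 < q" unfolding q_def using p_gt_1 ij(1) by (intro one_less_power) auto
  have qless: "absv (of_nat q) < 1"
  proof -
    have "absv (of_nat q) = absv (of_nat p) ^ (j - i)" by (simp add: q_def absv_power)
    moreover have "absv (of_nat p) ^ (j - i) < 1"
      using absv_p_less_1 absv_p_pos ij(1) by (intro power_Suc_less_one[of _ "j - i - 1", simplified] | simp add: power_less_one_iff)+
    ultimately show ?thesis by simp
  qed
  define g :: "'a poly" where "g = monom 1 q - monom 1 1"
  have cg: "coeff g k = (if k = q then 1 else 0) - (if k = 1 then 1 else 0)" for k
    by (simp add: g_def)
  have dg: "degree g = q"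
  proof (rule antisym)
    show "degree g \<le> q" using q1 by (intro degree_le) (auto simp: cg)
    show "q \<le> degree g" using q1 by (intro le_degree) (simp add: cg)
  qed
  have "lead_coeff g = 1" using q1 by (simp add: dg cg)
  then obtain R where R: "size R = degree g" "\<And>x. poly g x = (\<Prod>a\<in>#R. x - a)" "\<And>a. a \<in># R \<Longrightarrow> poly g a = 0"
    using monic_factorization[of g] by metis
  have pg: "poly g x = x ^ q - x" for x by (simp add: g_def poly_monom)
  have "\<exists>a\<in>#R. absv (y - a) < 1"
  proof (rule ccontr)
    assume "\<not> ?thesis"
    then have "1 ^ size R \<le> (\<Prod>a\<in>#R. absv (y - a))"
      by (intro prod_mset_ge_power) (auto simp: not_less)
    also have "\<dots> = absv (poly g y)" by (simp add: R(2) absv_prod_mset image_mset.compositionality comp_def)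
    finally show False using yq by (simp add: pg absv_diff_commute)
  qed
  then obtain a where a: "a \<in># R" "absv (y - a) < 1" by blast
  have aq: "a ^ q = a" using R(3)[OF a(1)] by (simp add: pg)
  have a1: "absv a \<le> 1" using absv_diff_le_max[of y "y - a"] a(2) y by simp
  have "\<sigma> a = a" if \<sigma>: "\<sigma> \<in> H" for \<sigma>
  proof (rule root_of_unity_close[OF _ aq qless])
    have G: "\<sigma> \<in> GQ" using H \<sigma> by (auto simp: Galois_group_def)
    show "\<sigma> a ^ q = \<sigma> a" using Gal_power[OF G, of a q] aq by simp
    show "absv (\<sigma> a) \<le> 1" using Gal_absv[OF G] a1 by simp
    have "absv (\<sigma> a - \<sigma> y) < 1"
      using Gal_absv[OF G, of "a - y"] Gal_diff[OF G] a(2) absv_diff_commute by simp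
    then show "absv (\<sigma> a - a) < 1"
      using absv_ultrametric[of "\<sigma> a" a "\<sigma> y"] absv_ultrametric[of "\<sigma> y" a y] inv[OF \<sigma>] a(2) by simp
  qed (use q1 a1 in auto)
  then have "a \<in> fixed H" by (simp add: fixed_def)
  then show thesis using a(2) by (rule that)
qed

lemma absv_prod_mset_diff_less:
  assumes "\<And>a. a \<in># A \<Longrightarrow> absv (x - b) < absv (b - a)"
  shows "absv ((\<Prod>a\<in>#A. x - a) - (\<Prod>a\<in>#A. b - a)) < absv (\<Prod>a\<in>#A. b - a)"
  using assms
proof (induction A)
  case (add a A)
  define P where "P = (\<Prod>a\<in>#A. x - a)"
  define Q where "Q = (\<Prod>a\<in>#A. b - a)"
  have IH: "absv (P - Q) < absv Q" using add unfolding P_def Q_def by simp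
  have xa: "absv (x - b) < absv (b - a)" using add.prems by simp
  then have "absv ((b - a) - (x - a)) < absv (b - a)" by (simp add: absv_diff_commute)
  then have eq: "absv (x - a) = absv (b - a)" by (rule absv_eq_of_diff_less)
  have Q0: "absv Q > 0" using IH absv_nonneg[of "P - Q"] by linarith
  have "absv ((x - a) * (P - Q)) < absv ((b - a) * Q)"
    unfolding absv_mult eq using IH xa absv_nonneg[of "x - b"] by (intro mult_strict_left_mono) auto
  moreover have "absv ((x - b) * Q) < absv ((b - a) * Q)"
    unfolding absv_mult using xa Q0 by (intro mult_strict_right_mono)
  moreover have "(x - a) * P - (b - a) * Q = (x - a) * (P - Q) + (x - b) * Q"
    by (simp add: algebra_simps)
  ultimately show ?case
    using absv_add_le_max[of "(x - a) * (P - Q)" "(x - b) * Q"] by (simp add: P_def[symmetric] Q_def[symmetric])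
qed simp

lemma root_in_disk:
  assumes H: "Galois_group H"
    and disk: "\<And>x b a. x \<in> D \<Longrightarrow> b \<in> D \<Longrightarrow> a \<notin> D \<Longrightarrow> absv (x - b) < absv (b - a)"
    and stable: "\<And>\<sigma> x. \<sigma> \<in> H \<Longrightarrow> x \<in> D \<Longrightarrow> \<sigma> x \<in> D"
    and b: "b \<in> D" "b \<in> K" and x0: "x0 \<in> D" "x0 \<noteq> b"
    and K: "is_subfield K" "fixed H \<subseteq> K" and bounded: "\<And>x. x \<in> K \<Longrightarrow> card (orb GQ x) \<le> M"
  obtains a where "a \<in> D" "card (orb H a) \<le> ramification_index absv (fixed H) K"
proof (rule ccontr)
  define F where "F = fixed H"
  define s where "s = ramification_index absv F K"
  assume "\<not> thesis"
  then have large: "\<And>a. a \<in> D \<Longrightarrow> s < card (orb H a)" using that unfolding s_def F_def by force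
  have F: "is_subfield F" unfolding F_def by (rule fixed_subfield[OF H])
  have QF: "Qp absv \<subseteq> F" unfolding F_def by (rule Qp_fixed[OF H])
  have FK: "F \<subseteq> K" using K(2) by (simp add: F_def)
  note vg = K(1) FK QF bounded
  define \<P> where "\<P> j = {Q. poly_over F Q \<and> lead_coeff Q = 1 \<and> degree Q = j}" for j
  have noroot: "poly Q a \<noteq> 0" if Qa: "Q \<in> \<P> j" "j \<le> s" "a \<in> D" for Q j a
  proof
    assume "poly Q a = 0"
    moreover have "Q \<noteq> 0" using Qa(1) by (auto simp: \<P>_def)
    ultimately have "card (orb H a) \<le> j"
      using orb_roots(2)[OF H, of Q a] Qa(1) by (auto simp: \<P>_def F_def)
    then show False using large[OF Qa(3)] Qa(2) by simp
  qed
  have split: "\<exists>R. size R = j \<and> (\<forall>x. poly Q x = (\<Prod>a\<in>#R. x - a)) \<and> (\<forall>a. a \<in># R \<longrightarrow> a \<notin> D)"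
    if Q: "Q \<in> \<P> j" "j \<le> s" for Q j
  proof -
    have "lead_coeff Q = 1" "degree Q = j" using Q by (auto simp: \<P>_def)
    then obtain R where "size R = j" "\<And>x. poly Q x = (\<Prod>a\<in>#R. x - a)" "\<And>a. a \<in># R \<Longrightarrow> poly Q a = 0"
      using monic_factorization[of Q] by metis
    then show ?thesis using noroot[OF Q] by blast
  qed
  have near: "absv (poly Q x - poly Q b) < absv (poly Q b)" if x: "Q \<in> \<P> j" "j \<le> s" "x \<in> D" for Q j x
  proof -
    obtain R where R: "\<And>x. poly Q x = (\<Prod>a\<in>#R. x - a)" "\<And>a. a \<in># R \<Longrightarrow> a \<notin> D"
      using split[OF x(1,2)] by blast
    show ?thesis unfolding R(1) using disk x(3) b(1) R(2) by (intro absv_prod_mset_diff_less) blast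
  qed
  define \<delta> where "\<delta> = absv (x0 - b)"
  have "\<delta> > 0" unfolding \<delta>_def using x0 by (intro absv_pos) simp
  have lower: "\<delta> ^ j \<le> absv (poly Q b)" if Q: "Q \<in> \<P> j" "j \<le> s" for Q j
  proof -
    obtain R where R: "size R = j" "\<And>x. poly Q x = (\<Prod>a\<in>#R. x - a)" "\<And>a. a \<in># R \<Longrightarrow> a \<notin> D"
      using split[OF Q] by blast
    have "\<delta> ^ size R \<le> (\<Prod>a\<in>#R. absv (b - a))"
    proof (rule prod_mset_ge_power)
      fix a assume "a \<in># R"
      then show "\<delta> \<le> absv (b - a)"
        unfolding \<delta>_def by (intro less_imp_le disk x0(1) b(1) R(3))
    qed (use \<open>\<delta> > 0\<close> in simp)
    then show ?thesis by (simp add: R(1,2) absv_prod_mset image_mset.compositionality comp_def)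
  qed
  have inK: "poly Q b \<in> K" if "Q \<in> \<P> j" for Q j
  proof (rule poly_over_poly[OF K(1) _ b(2)])
    show "poly_over K Q" using that FK by (auto simp: \<P>_def poly_over_def)
  qed
  have valK: "absv (poly Q b) \<in> value_group absv K" if "Q \<in> \<P> j" "j \<le> s" for Q j
    using inK[OF that(1)] noroot[OF that b(1)] by (auto simp: value_group_def)
  have "\<exists>Q\<in>\<P> j. \<forall>Q'\<in>\<P> j. absv (poly Q b) \<le> absv (poly Q' b)" if j: "j \<le> s" for j
  proof -
    have "monom 1 j \<in> \<P> j"
      using poly_over_monom[OF F subfield_1[OF F]] by (auto simp: \<P>_def degree_monom_eq)
    then have ne: "(\<lambda>Q. absv (poly Q b)) ` \<P> j \<noteq> {}" by blast
    have sub: "(\<lambda>Q. absv (poly Q b)) ` \<P> j \<subseteq> value_group absv K" using valK j by blast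
    obtain r where r: "r \<in> (\<lambda>Q. absv (poly Q b)) ` \<P> j" "\<And>s. s \<in> (\<lambda>Q. absv (poly Q b)) ` \<P> j \<Longrightarrow> r \<le> s"
    proof (rule value_group_least[OF F vg sub ne])
      show "0 < \<delta> ^ j" using \<open>\<delta> > 0\<close> by simp
      show "\<delta> ^ j \<le> r" if "r \<in> (\<lambda>Q. absv (poly Q b)) ` \<P> j" for r
        using that lower j by auto
    qed auto
    then show ?thesis by auto
  qed
  then have "\<forall>j\<in>{..s}. \<exists>Q. Q \<in> \<P> j \<and> (\<forall>Q'\<in>\<P> j. absv (poly Q b) \<le> absv (poly Q' b))" by auto
  from bchoice[OF this] obtain Q where
    Q0: "\<forall>j\<in>{..s}. Q j \<in> \<P> j \<and> (\<forall>Q'\<in>\<P> j. absv (poly (Q j) b) \<le> absv (poly Q' b))" ..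
  have Q: "Q j \<in> \<P> j" "Q' \<in> \<P> j \<Longrightarrow> absv (poly (Q j) b) \<le> absv (poly Q' b)" if "j \<le> s" for j Q'
    using Q0 that by auto
  obtain i j u where ij: "i < j" "j \<le> s" "u \<in> value_group absv F"
      "absv (poly (Q j) b) = absv (poly (Q i) b) * u"
  proof (rule ramification_pigeonhole[OF F vg, of "\<lambda>j. absv (poly (Q j) b)"])
    fix i assume "i \<le> ramification_index absv F K"
    then have "i \<le> s" by (simp add: s_def)
    then show "absv (poly (Q i) b) \<in> value_group absv K" using valK[OF Q(1)] by blast
  qed (auto simp: s_def)
  obtain c where c: "c \<in> F" "c \<noteq> 0" "u = absv c" using ij(3) unfolding value_group_def by auto
  have i_le: "i \<le> s" using ij by simp
  define A where "A = poly (Q j) b"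
  define B where "B = c * poly (Q i) b"
  define y where "y = A / B"
  have AB: "absv A = absv B" using ij(4) c(3) by (simp add: A_def B_def absv_mult)
  have A0: "absv A > 0" unfolding A_def by (rule absv_pos[OF noroot[OF Q(1)[OF ij(2)] ij(2) b(1)]])
  have y1: "absv y = 1" using AB A0 by (simp add: y_def absv_divide)
  have inv: "absv (\<sigma> y - y) < 1" if \<sigma>: "\<sigma> \<in> H" for \<sigma>
  proof -
    have G: "\<sigma> \<in> GQ" using H \<sigma> by (auto simp: Galois_group_def)
    have GF: "\<sigma> \<in> Gal F" using G \<sigma> by (auto simp: F_def fixed_def Gal_def)
    define A' where "A' = poly (Q j) (\<sigma> b)"
    define B' where "B' = c * poly (Q i) (\<sigma> b)"
    have "\<sigma> y = A' / B'"
      using Gal_poly[OF GF, of "Q j" b] Gal_poly[OF GF, of "Q i" b] Q(1)[OF ij(2)] Q(1)[OF i_le]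
        Gal_fixed[OF GF c(1)] Gal_divide[OF GF] Gal_mult[OF GF]
      by (simp add: y_def A_def B_def A'_def B'_def \<P>_def)
    have \<sigma>b: "\<sigma> b \<in> D" using stable \<sigma> b(1) .
    have dA: "absv (A' - A) < absv A"
      unfolding A_def A'_def using near[OF Q(1)[OF ij(2)] ij(2) \<sigma>b] .
    have "absv (poly (Q i) (\<sigma> b) - poly (Q i) b) < absv (poly (Q i) b)"
      using near[OF Q(1)[OF i_le] i_le \<sigma>b] .
    then have dB: "absv (B' - B) < absv B"
      using absv_pos[OF c(2)] unfolding B_def B'_def by (simp add: right_diff_distrib[symmetric] absv_mult)
    have "absv A' = absv A" using dA absv_eq_of_diff_less[of A A'] by (simp add: absv_diff_commute)
    have B': "absv B' = absv B" using dB absv_eq_of_diff_less[of B B'] by (simp add: absv_diff_commute)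
    have nz: "B \<noteq> 0" "B' \<noteq> 0" using A0 AB B' by auto
    have "\<sigma> y - y = A' / B' - A / B"
      by (simp only: \<open>\<sigma> y = A' / B'\<close>) (simp add: y_def)
    also have "\<dots> = ((A' - A) * B - A * (B' - B)) / (B * B')"
      using nz by (simp add: field_simps)
    finally have "\<sigma> y - y = ((A' - A) * B - A * (B' - B)) / (B * B')" .
    moreover have "absv ((A' - A) * B - A * (B' - B)) < absv B * absv B"
    proof -
      have "absv ((A' - A) * B) < absv B * absv B"
        unfolding absv_mult using dA AB A0 by (intro mult_strict_right_mono) auto
      moreover have "absv (A * (B' - B)) < absv B * absv B"
        unfolding absv_mult AB using dB A0 AB by (intro mult_strict_left_mono) auto
      ultimately show ?thesis using absv_diff_le_max[of "(A' - A) * B" "A * (B' - B)"] by simp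
    qed
    ultimately show ?thesis using A0 AB B' by (simp add: absv_divide absv_mult)
  qed
  obtain z where z: "z \<in> F" "absv (y - z) < 1"
    using fixed_residue_lift[OF H, of y] inv y1 unfolding F_def by auto
  define Q' where "Q' = Q j - smult (c * z) (Q i)"
  have Qj: "poly_over F (Q j)" "lead_coeff (Q j) = 1" "degree (Q j) = j" using Q(1)[OF ij(2)] by (auto simp: \<P>_def)
  have Qi: "poly_over F (Q i)" "degree (Q i) = i" using Q(1)[OF i_le] by (auto simp: \<P>_def)
  have "degree (smult (c * z) (Q i)) < j" using Qi ij(1) degree_smult_le[of "c * z" "Q i"] by linarith
  then have "coeff (smult (c * z) (Q i)) j = 0" by (rule coeff_eq_0)
  then have cj: "coeff Q' j = 1" using Qj by (simp add: Q'_def)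
  have "degree Q' \<le> j"
    unfolding Q'_def using Qj \<open>degree (smult (c * z) (Q i)) < j\<close> by (intro degree_diff_le) auto
  moreover have "j \<le> degree Q'" using cj by (intro le_degree) simp
  ultimately have "degree Q' = j" by simp
  moreover have "poly_over F Q'"
    unfolding Q'_def using Qj Qi c z by (intro poly_over_diff[OF F] poly_over_smult[OF F] subfield_mult[OF F])
  ultimately have "Q' \<in> \<P> j" using cj by (simp add: \<P>_def)
  then have "absv A \<le> absv (poly Q' b)" unfolding A_def by (rule Q(2)[OF ij(2)])
  moreover have "poly Q' b = B * (y - z)"
  proof -
    have "B \<noteq> 0" using A0 AB by auto
    then have "A = B * y" by (simp add: y_def)
    then show ?thesis by (simp add: Q'_def A_def B_def algebra_simps)
  qed
  then have "absv (poly Q' b) < absv B"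
    using z(2) A0 AB by (simp add: absv_mult)
  ultimately show False using AB by simp
qed

end

section \<open>Complexity of a disk\<close>

lemma le_mult_trans:
  fixes a b c n :: nat
  assumes "a \<le> n * b" "b \<le> c"
  shows "a \<le> n * c"
  using mult_le_mono2[OF assms(2), of n] assms(1) by (rule order_trans[rotated])

lemma sum_over_image:
  fixes h :: "'b \<Rightarrow> 'a::field"
  assumes F: "is_subfield F" and "finite I" and c: "\<And>i. i \<in> I \<Longrightarrow> c i \<in> F"
  shows "\<exists>c'. (\<forall>b\<in>h ` I. c' b \<in> F) \<and> (\<Sum>i\<in>I. c i * h i) = (\<Sum>b\<in>h ` I. c' b * b)"
proof (intro exI conjI)
  let ?c' = "\<lambda>b. \<Sum>i\<in>{i\<in>I. h i = b}. c i"
  show "\<forall>b\<in>h ` I. ?c' b \<in> F" using c by (auto intro!: subfield_sum[OF F])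
  have "(\<Sum>i\<in>I. c i * h i) = (\<Sum>b\<in>h ` I. \<Sum>i\<in>{i\<in>I. h i = b}. c i * h i)"
    using \<open>finite I\<close> by (rule sum.image_gen)
  also have "\<dots> = (\<Sum>b\<in>h ` I. ?c' b * b)" by (simp add: sum_distrib_right)
  finally show "(\<Sum>i\<in>I. c i * h i) = (\<Sum>b\<in>h ` I. ?c' b * b)" .
qed

lemma finite_extension_refl: "is_subfield F \<Longrightarrow> finite_extension F F"
  unfolding finite_extension_def
  by (intro conjI exI[of _ "{1}"]) (auto intro: subfield_1)

lemma finite_extension_trans:
  assumes "finite_extension F K" "finite_extension K L"
  shows "finite_extension F L"
proof -
  obtain B where B: "finite B" "B \<subseteq> K" "\<And>x. x \<in> K \<Longrightarrow> \<exists>c. (\<forall>b\<in>B. c b \<in> F) \<and> x = (\<Sum>b\<in>B. c b * b)"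
    using assms(1) unfolding finite_extension_def by blast
  obtain B' where B': "finite B'" "B' \<subseteq> L" "\<And>x. x \<in> L \<Longrightarrow> \<exists>c. (\<forall>b\<in>B'. c b \<in> K) \<and> x = (\<Sum>b\<in>B'. c b * b)"
    using assms(2) unfolding finite_extension_def by blast
  have sub: "is_subfield F" "is_subfield L" "F \<subseteq> K" "K \<subseteq> L"
    using assms unfolding finite_extension_def by blast+
  define h :: "'a \<times> 'a \<Rightarrow> 'a" where "h = (\<lambda>(b', b). b' * b)"
  have "\<exists>c. (\<forall>b\<in>h ` (B' \<times> B). c b \<in> F) \<and> x = (\<Sum>b\<in>h ` (B' \<times> B). c b * b)" if x: "x \<in> L" for x
  proof -
    obtain c where c: "\<forall>b\<in>B'. c b \<in> K" "x = (\<Sum>b\<in>B'. c b * b)" using B'(3)[OF x] by blast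
    have "\<forall>b'\<in>B'. \<exists>d. (\<forall>b\<in>B. d b \<in> F) \<and> c b' = (\<Sum>b\<in>B. d b * b)" using c(1) B(3) by blast
    then obtain d where d: "\<And>b' b. b' \<in> B' \<Longrightarrow> b \<in> B \<Longrightarrow> d b' b \<in> F"
        "\<And>b'. b' \<in> B' \<Longrightarrow> c b' = (\<Sum>b\<in>B. d b' b * b)"
      by metis
    have "x = (\<Sum>b'\<in>B'. \<Sum>b\<in>B. d b' b * h (b', b))"
      unfolding c(2) by (intro sum.cong) (auto simp: d(2) sum_distrib_right sum_distrib_left h_def mult_ac)
    also have "\<dots> = (\<Sum>i\<in>B' \<times> B. (case i of (b', b) \<Rightarrow> d b' b) * h i)"
      by (simp add: sum.cartesian_product case_prod_unfold)
    finally show ?thesis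
      using sum_over_image[OF sub(1), of "B' \<times> B" "\<lambda>(b', b). d b' b" h] B(1) B'(1) d(1) by auto
  qed
  moreover have "h ` (B' \<times> B) \<subseteq> L"
  proof clarify
    fix b' b assume "b' \<in> B'" "b \<in> B"
    then have "b' \<in> L" "b \<in> L" using B(2) B'(2) sub by auto
    then show "h (b', b) \<in> L" using subfield_mult[OF sub(2)] by (simp add: h_def)
  qed
  ultimately show ?thesis
    unfolding finite_extension_def using sub B(1) B'(1)
    by (intro conjI exI[of _ "h ` (B' \<times> B)"]) auto
qed

lemma simple_extension_exists:
  fixes F :: "'a::{alg_closed_field, field_char_0} set"
  assumes F: "is_subfield F" and alg: "\<And>x. \<exists>f. f \<noteq> 0 \<and> poly_over F f \<and> poly f x = 0"
  obtains K where "finite_extension F K" "a \<in> K"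
proof -
  define K where "K = {poly f a | f. poly_over F f}"
  have KI: "poly f a \<in> K" if "poly_over F f" for f using that by (auto simp: K_def)
  have FK: "F \<subseteq> K"
  proof
    fix x assume "x \<in> F"
    then have "poly_over F [:x:]" using subfield_0[OF F] by (auto simp: poly_over_def coeff_pCons split: nat.split)
    from KI[OF this] show "x \<in> K" by simp
  qed
  have diff: "x - y \<in> K" and mult: "x * y \<in> K" if xy: "x \<in> K" "y \<in> K" for x y
  proof -
    obtain f g where "poly_over F f" "poly_over F g" "x = poly f a" "y = poly g a"
      using xy by (auto simp: K_def)
    then show "x - y \<in> K" "x * y \<in> K"
      using KI[OF poly_over_diff[OF F, of f g]] KI[OF poly_over_mult[OF F, of f g]] by auto
  qed
  have K01: "0 \<in> K" "1 \<in> K" using FK subfield_0[OF F] subfield_1[OF F] by auto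
  have add: "x + y \<in> K" if "x \<in> K" "y \<in> K" for x y
    using diff[OF that(1) diff[OF K01(1) that(2)]] by simp
  have pow: "x ^ n \<in> K" if "x \<in> K" for x n using that by (induction n) (auto intro: mult K01)
  have sum: "(\<Sum>i\<in>I. g i) \<in> K" if "\<And>i. i \<in> I \<Longrightarrow> g i \<in> K" for I :: "nat set" and g
    using that by (induction I rule: infinite_finite_induct) (auto intro: add K01)
  have inv: "inverse x \<in> K" if "x \<in> K" for x
  proof (cases "x = 0")
    case False
    obtain r where r: "poly_over F r" "poly r x = inverse x"
      using inverse_as_poly[OF F alg False] by blast
    have "poly r x \<in> K"
      unfolding poly_altdef using r(1) FK that by (intro sum mult pow) (auto simp: poly_over_def)
    then show ?thesis by (simp add: r(2))
  qed (simp add: K01)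
  have K: "is_subfield K" unfolding is_subfield_def using K01 diff mult inv by blast
  obtain f where f: "f \<noteq> 0" "poly_over F f" "poly f a = 0" using alg by blast
  define m where "m = smult (inverse (lead_coeff f)) f"
  have m: "poly_over F m" "poly m a = 0" "lead_coeff m = 1"
    unfolding m_def using f
    by (auto intro!: poly_over_smult[OF F] subfield_inverse[OF F]) (auto simp: poly_over_def)
  define d where "d = degree m"
  have d0: "d > 0"
  proof (rule ccontr)
    assume "\<not> d > 0"
    then have "degree m = 0" by (simp add: d_def)
    then obtain c where "m = [:c:]" by (elim degree_eq_zeroE)
    with m show False by auto
  qed
  have red: "\<exists>r. poly_over F r \<and> (\<forall>i\<ge>d. coeff r i = 0) \<and> poly r a = poly f a" if "poly_over F f" for f
    using that
  proof (induction f)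
    case 0
    then show ?case by (intro exI[of _ 0]) auto
  next
    case (pCons c f)
    have cf: "c \<in> F" "poly_over F f"
      using pCons.prems unfolding poly_over_def by (metis coeff_pCons_0, metis coeff_pCons_Suc)
    then obtain r where r: "poly_over F r" "\<forall>i\<ge>d. coeff r i = 0" "poly r a = poly f a"
      using pCons.IH by blast
    define r' where "r' = pCons c r - smult (coeff r (d - 1)) m"
    have "poly_over F (pCons c r)" using cf r by (auto simp: poly_over_def coeff_pCons split: nat.split)
    then have "poly_over F r'"
      unfolding r'_def using r(1) m(1) by (intro poly_over_diff[OF F] poly_over_smult[OF F]) (auto simp: poly_over_def)
    moreover have "coeff r' i = 0" if "i \<ge> d" for i
    proof (cases "i = d")
      case True
      then show ?thesis using m(3) d0 by (cases d) (auto simp: r'_def d_def)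
    next
      case False
      then have "coeff m i = 0" using that by (intro coeff_eq_0) (simp add: d_def)
      moreover have "coeff (pCons c r) i = 0"
        using False that r(2) by (cases i) auto
      ultimately show ?thesis by (simp add: r'_def)
    qed
    moreover have "poly r' a = poly (pCons c f) a" using r(3) m(2) by (simp add: r'_def)
    ultimately show ?case by blast
  qed
  define B where "B = (\<lambda>i. a ^ i) ` {..<d}"
  have aK: "a \<in> K"
  proof -
    have "poly_over F [:0, 1:]"
      using subfield_0[OF F] subfield_1[OF F] by (auto simp: poly_over_def coeff_pCons split: nat.split)
    from KI[OF this] show ?thesis by simp
  qed
  have "\<exists>c. (\<forall>b\<in>B. c b \<in> F) \<and> x = (\<Sum>b\<in>B. c b * b)" if x: "x \<in> K" for x
  proof -
    obtain f where "poly_over F f" "x = poly f a" using x by (auto simp: K_def)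
    then obtain r where r: "poly_over F r" "\<forall>i\<ge>d. coeff r i = 0" "poly r a = x" using red by blast
    have "x = (\<Sum>i<d. coeff r i * a ^ i)"
    proof -
      have "degree r < d"
        using r(2) d0 by (metis degree_less_if_less_eqI[of r] degree_0 leading_coeff_0_iff not_less)
      then have "(\<Sum>i\<le>degree r. coeff r i * a ^ i) = (\<Sum>i<d. coeff r i * a ^ i)"
        by (intro sum.mono_neutral_left) (auto simp: coeff_eq_0)
      then show ?thesis using r(3) by (simp add: poly_altdef)
    qed
    then show ?thesis
      using sum_over_image[OF F, of "{..<d}" "coeff r" "\<lambda>i. a ^ i"] r(1) by (simp add: B_def poly_over_def)
  qed
  moreover have "B \<subseteq> K" unfolding B_def using pow[OF aK] by auto
  ultimately have "finite_extension F K"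
    unfolding finite_extension_def using F K FK by (intro conjI exI[of _ B]) (auto simp: B_def)
  then show thesis using aK by (rule that)
qed

context Qp_algebraic_closure
begin

lemma algebraic_over_extension: "Qp absv \<subseteq> F \<Longrightarrow> \<exists>f. f \<noteq> 0 \<and> poly_over F f \<and> poly f x = 0"
  using algebraic_over_Qp[of x] unfolding poly_over_def by blast

lemma finite_extension_containing:
  assumes "finite A" "is_subfield F" "Qp absv \<subseteq> F"
  obtains K where "finite_extension F K" "A \<subseteq> K"
proof -
  have "\<exists>K. finite_extension F K \<and> A \<subseteq> K"
    using assms(1)
  proof (induction A)
    case empty
    then show ?case using finite_extension_refl assms(2) by blast
  next
    case (insert a A)
    then obtain K where K: "finite_extension F K" "A \<subseteq> K" by blast
    then have "is_subfield K" "F \<subseteq> K" unfolding finite_extension_def by blast+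
    then obtain L where L: "finite_extension K L" "a \<in> L"
      using simple_extension_exists[of K a] algebraic_over_extension assms(3) by (metis order_trans)
    have "K \<subseteq> L" using L(1) unfolding finite_extension_def by blast
    then show ?case using finite_extension_trans[OF K(1) L(1)] K(2) L(2) by blast
  qed
  then show thesis using that by blast
qed

definition disk :: "bool \<Rightarrow> 'a \<Rightarrow> real \<Rightarrow> 'a set" where
  "disk c a r = {x. if c then absv (x - a) \<le> r else absv (x - a) < r}"

lemma disk_center: "0 < r \<Longrightarrow> a \<in> disk c a r"
  by (simp add: disk_def)

lemma disk_recenter:
  assumes "b \<in> disk c a r"
  shows "disk c a r = disk c b r"
proof -
  have *: "disk c a r \<subseteq> disk c b r" if "b \<in> disk c a r" for a b
  proof
    fix x assume "x \<in> disk c a r"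
    then show "x \<in> disk c b r"
      using that absv_ultrametric[of x b a] absv_diff_commute[of a b]
      by (auto simp: disk_def split: if_splits)
  qed
  have "a \<in> disk c b r" using assms absv_diff_commute by (auto simp: disk_def)
  then show ?thesis using *[OF assms] *[of a b] by blast
qed

lemma disk_ultrametric:
  assumes "x \<in> disk c a r" "b \<in> disk c a r" "y \<notin> disk c a r"
  shows "absv (x - b) < absv (b - y)"
proof -
  have "x \<in> disk c b r" "y \<notin> disk c b r" using assms disk_recenter[OF assms(2)] by auto
  then show ?thesis using absv_diff_commute[of b y] by (auto simp: disk_def split: if_splits)
qed

lemma disk_image:
  assumes "\<sigma> \<in> GQ"
  shows "\<sigma> ` disk c a r = disk c (\<sigma> a) r"
proof -
  have eq: "absv (\<sigma> x - \<sigma> a) = absv (x - a)" for x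
    using Gal_absv[OF assms, of "x - a"] Gal_diff[OF assms] by simp
  show ?thesis
  proof
    show "\<sigma> ` disk c a r \<subseteq> disk c (\<sigma> a) r" using eq by (auto simp: disk_def)
    show "disk c (\<sigma> a) r \<subseteq> \<sigma> ` disk c a r"
    proof
      fix y assume y: "y \<in> disk c (\<sigma> a) r"
      define x where "x = inv \<sigma> y"
      have "y = \<sigma> x" using Gal_inv_apply[OF assms] by (simp add: x_def)
      then show "y \<in> \<sigma> ` disk c a r" using y eq[of x] by (auto simp: disk_def)
    qed
  qed
qed

lemma small_element:
  assumes "0 < r"
  obtains e where "e \<noteq> 0" "absv e < r"
proof -
  obtain n where "(1 / real p) ^ n < r" using real_arch_pow_inv[OF assms, of "1 / real p"] real_p_gt_1 by auto
  moreover have "(of_nat p ^ n :: 'a) \<noteq> 0" using p_gt_1 by simp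
  ultimately show thesis using that[of "of_nat p ^ n"] by (simp add: absv_power absv_p)
qed

lemma disk_nontrivial:
  assumes "0 < r"
  obtains x where "x \<in> disk c a r" "x \<noteq> b"
proof -
  obtain e where "e \<noteq> 0" "absv e < r" using small_element[OF assms] by blast
  then have "a + e \<in> disk c a r" "a + e \<noteq> a" by (auto simp: disk_def)
  then show thesis using that disk_center[OF assms, of a c] by (cases "b = a") auto
qed

definition rational_disk :: "'a set \<Rightarrow> bool" where
  "rational_disk D \<longleftrightarrow> (\<exists>c a e. e \<noteq> 0 \<and> D = disk c a (absv e))"

lemma rational_diskI:
  "open_rational_disk absv D \<Longrightarrow> rational_disk D"
  "closed_rational_disk absv D \<Longrightarrow> rational_disk D"
  unfolding rational_disk_def open_rational_disk_def closed_rational_disk_def value_group_def disk_def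
  by (force intro: exI[of _ False], force intro: exI[of _ True])

end

locale finite_extension_of_Qp = Qp_algebraic_closure p absv for p and absv :: "'a::{alg_closed_field, field_char_0} \<Rightarrow> real" +
  fixes E :: "'a set"
  assumes E_finite: "finite_extension (Qp absv) E"
begin

lemma E_subfield: "is_subfield E" and Qp_subset_E: "Qp absv \<subseteq> E"
  using E_finite by (auto simp: finite_extension_def)

lemma Galois_group_E: "Galois_group (Gal E)"
  by (rule Galois_group_Gal[OF Qp_subset_E])

lemma index_of_E: "\<exists>N. \<forall>x. card (orb GQ x) \<le> N * card (orb (Gal E) x)"
proof -
  have "Qp absv \<subseteq> fixed GQ" by (rule Qp_fixed[OF Galois_group_GQ])
  then obtain N where "\<And>x. card (orb GQ x) \<le> N * card (orb (pointwise_stabilizer GQ E) x)"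
    using finite_extension_index[OF Galois_group_GQ E_finite] by blast
  moreover have "pointwise_stabilizer GQ E = Gal E"
    unfolding pointwise_stabilizer_def[OF Galois_group_GQ] using Qp_subset_E by (auto simp: Gal_def)
  ultimately show ?thesis by auto
qed

definition E_index :: nat where
  "E_index = (SOME N. \<forall>x. card (orb GQ x) \<le> N * card (orb (Gal E) x))"

lemma E_index: "card (orb GQ x) \<le> E_index * card (orb (Gal E) x)"
  using someI_ex[OF index_of_E] unfolding E_index_def by blast

lemma bounded_E: "x \<in> E \<Longrightarrow> card (orb GQ x) \<le> E_index"
proof -
  assume "x \<in> E"
  then have "orb (Gal E) x = {x}"
    using fixed_iff_orb[OF Galois_group_E] fixed_Gal[OF E_subfield Qp_subset_E] by blast
  then show ?thesis using E_index[of x] by simp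
qed

definition uniformizer_absv :: real where
  "uniformizer_absv = Sup {r \<in> value_group absv E. r < 1}"

lemma uniformizer_absv: "0 < uniformizer_absv" "uniformizer_absv < 1"
proof -
  let ?V = "{r \<in> value_group absv E. r < 1}"
  define c where "c = root (fact E_index) (1 / real p)"
  have fpos: "0 < (fact E_index :: nat)" by simp
  have c: "c < 1" unfolding c_def using real_p_gt_1 fpos by simp
  have upper: "r \<le> c" if "r \<in> ?V" for r
  proof -
    have r: "r \<in> value_group absv E" "r < 1" "0 < r"
      using that value_group_pos[OF E_subfield] by auto
    obtain j where j: "r ^ fact E_index = real p powi j"
      using value_group_power_fact[OF E_subfield E_subfield order_refl Qp_subset_E bounded_E r(1)] by metis
    have "r ^ fact E_index < 1" using r fpos by (simp add: power_less_one_iff)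
    then have "j \<le> -1" using j powi_p_less_iff[of j 0] by simp
    then have "r ^ fact E_index \<le> real p powi (-1)"
      using j powi_p_less_iff[of "-1" j] by simp
    also have "real p powi (-1) = 1 / real p" by (simp add: power_int_def inverse_eq_divide)
    finally have "root (fact E_index) (r ^ fact E_index) \<le> c"
      unfolding c_def using fpos by simp
    then show ?thesis using r fpos by (simp add: real_root_power_cancel)
  qed
  have mem: "1 / real p \<in> ?V"
    using value_group_powi[OF E_subfield Qp_subset_E, of "-1"] real_p_gt_1
    by (simp add: power_int_def inverse_eq_divide)
  have "uniformizer_absv \<le> c"
    unfolding uniformizer_absv_def using mem upper by (intro cSup_least) auto
  then show "uniformizer_absv < 1" using c by simp
  have "1 / real p \<le> uniformizer_absv"
    unfolding uniformizer_absv_def using mem upper by (intro cSup_upper bdd_aboveI[of _ c]) auto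
  then show "0 < uniformizer_absv" using real_p_gt_1 by (simp add: less_le_trans[of 0 "1 / real p"])
qed

lemma log_uniformizer_le_iff:
  assumes "0 < x" "0 < y"
  shows "log uniformizer_absv x \<le> log uniformizer_absv y \<longleftrightarrow> y \<le> x"
  using uniformizer_absv assms by (simp add: log_def divide_le_cancel)

lemma valuation_compare:
  assumes "b \<noteq> 0" "0 < k"
  shows "ereal (real k) * normalized_valuation absv E y \<ge> normalized_valuation absv E b \<longleftrightarrow> absv y ^ k \<le> absv b"
    and "ereal (real k) * normalized_valuation absv E y > normalized_valuation absv E b \<longleftrightarrow> absv y ^ k < absv b"
proof -
  have b: "normalized_valuation absv E b = ereal (log uniformizer_absv (absv b))" "absv b > 0"
    using assms(1) absv_pos by (auto simp: normalized_valuation_def uniformizer_absv_def)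
  have "(ereal (real k) * normalized_valuation absv E y \<ge> normalized_valuation absv E b \<longleftrightarrow> absv y ^ k \<le> absv b) \<and>
    (ereal (real k) * normalized_valuation absv E y > normalized_valuation absv E b \<longleftrightarrow> absv y ^ k < absv b)"
  proof (cases "y = 0")
    case True
    then have "ereal (real k) * normalized_valuation absv E y = \<infinity>"
      using assms(2) by (simp add: normalized_valuation_def)
    then show ?thesis using True b assms(2) by (simp add: zero_power)
  next
    case False
    then have y: "absv y > 0" by (rule absv_pos)
    have "ereal (real k) * normalized_valuation absv E y = ereal (log uniformizer_absv (absv y ^ k))"
      using False y by (simp add: normalized_valuation_def uniformizer_absv_def log_nat_power)
    moreover have "0 < absv y ^ k" using y by simp
    ultimately show ?thesis
      using log_uniformizer_le_iff[of "absv b" "absv y ^ k"] log_uniformizer_le_iff[of "absv y ^ k" "absv b"] b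
      by (simp add: less_le_not_le)
  qed
  then show "ereal (real k) * normalized_valuation absv E y \<ge> normalized_valuation absv E b \<longleftrightarrow> absv y ^ k \<le> absv b"
    "ereal (real k) * normalized_valuation absv E y > normalized_valuation absv E b \<longleftrightarrow> absv y ^ k < absv b" by auto
qed

definition disk_stabilizer :: "'a set \<Rightarrow> ('a \<Rightarrow> 'a) set" where
  "disk_stabilizer D = {\<sigma>\<in>Gal E. \<sigma> ` D = D}"

definition conjugates :: "'a set \<Rightarrow> 'a set set" where
  "conjugates D = (\<lambda>\<sigma>. \<sigma> ` D) ` Gal E"

lemma map_option_Some_image: "map_option \<sigma> ` Some ` D = Some ` \<sigma> ` D"
  by (simp add: image_image)

lemma field_of_definition_eq: "field_of_definition E (Some ` D) = fixed (disk_stabilizer D)"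
  unfolding field_of_definition_def fixed_def disk_stabilizer_def map_option_Some_image
  by (auto simp: inj_image_eq_iff)

lemma Galois_group_disk_stabilizer: "Galois_group (disk_stabilizer D)"
proof -
  have "inv \<sigma> ` D = D" if "\<sigma> \<in> Gal E" "\<sigma> ` D = D" for \<sigma>
    using that Gal_inv_apply[OF that(1)] by (metis (no_types, lifting) image_comp image_cong image_ident comp_apply)
  moreover have "(\<sigma> \<circ> \<tau>) ` D = D" if "\<sigma> ` D = D" "\<tau> ` D = D" for \<sigma> \<tau> :: "'a \<Rightarrow> 'a"
    by (simp only: image_comp[symmetric] that)
  ultimately show ?thesis
    using Gal_mono[OF Qp_subset_E] Gal_id[of E] Gal_comp[of _ E] Gal_inv[of _ E]
    unfolding Galois_group_def disk_stabilizer_def by auto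
qed

context
  fixes D
  assumes D: "rational_disk D"
begin

lemma finite_conjugates: "finite (conjugates D)"
proof -
  obtain c a e where D_eq: "D = disk c a (absv e)" using D unfolding rational_disk_def by blast
  show ?thesis
    unfolding conjugates_def
  proof (rule finite_image_of_finite_image[of "\<lambda>\<sigma>. \<sigma> a"])
    show "finite ((\<lambda>\<sigma>. \<sigma> a) ` Gal E)" using orb_finite[OF Galois_group_E, of a] by (simp add: orb_def)
    fix \<sigma> \<tau> assume "\<sigma> \<in> Gal E" "\<tau> \<in> Gal E" "\<sigma> a = \<tau> a"
    then show "\<sigma> ` D = \<tau> ` D" unfolding D_eq using disk_image Gal_mono[OF Qp_subset_E] by (metis subsetD)
  qed
qed

lemma card_orb_disk_stabilizer:
  "card (orb (Gal E) x) \<le> card (conjugates D) * card (orb (disk_stabilizer D) x)"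
  unfolding conjugates_def
proof (rule card_orb_index[OF Galois_group_E Galois_group_disk_stabilizer])
  fix \<sigma> \<tau> assume *: "\<sigma> \<in> Gal E" "\<tau> \<in> Gal E" "\<sigma> ` D = \<tau> ` D"
  have "(inv \<tau> \<circ> \<sigma>) ` D = inv \<tau> ` \<tau> ` D" by (simp only: image_comp[symmetric] *(3))
  also have "\<dots> = D" using Gal_inv_apply[OF *(2)] by (auto simp: image_image)
  finally show "inv \<tau> \<circ> \<sigma> \<in> disk_stabilizer D"
    using Gal_comp[OF Gal_inv[OF *(2)] *(1)] by (simp add: disk_stabilizer_def)
qed (use finite_conjugates in \<open>simp add: conjugates_def\<close>)

lemma card_orb_GQ_disk_stabilizer:
  "card (orb GQ x) \<le> E_index * (card (conjugates D) * card (orb (disk_stabilizer D) x))"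
  by (rule le_mult_trans[OF E_index card_orb_disk_stabilizer])

abbreviation "disk_field \<equiv> fixed (disk_stabilizer D)"

lemma F_subfield: "is_subfield disk_field" and Qp_subset_F: "Qp absv \<subseteq> disk_field"
  by (rule fixed_subfield[OF Galois_group_disk_stabilizer])
    (rule Qp_fixed[OF Galois_group_disk_stabilizer])

lemma bounded_F: "x \<in> disk_field \<Longrightarrow> card (orb GQ x) \<le> E_index * card (conjugates D)"
proof -
  assume "x \<in> disk_field"
  then have "orb (disk_stabilizer D) x = {x}"
    by (rule fixed_iff_orb[OF Galois_group_disk_stabilizer, THEN iffD1])
  then show ?thesis using card_orb_GQ_disk_stabilizer[of x] by simp
qed

lemma bounded_finite_extension:
  assumes "finite_extension disk_field K"
  obtains M where "\<And>x. x \<in> K \<Longrightarrow> card (orb GQ x) \<le> M"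
proof -
  obtain N where N: "\<And>x. card (orb (disk_stabilizer D) x) \<le>
      N * card (orb (pointwise_stabilizer (disk_stabilizer D) K) x)"
    by (rule finite_extension_index[OF Galois_group_disk_stabilizer[of D] assms order_refl]) (rule that)
  have "card (orb GQ x) \<le> E_index * (card (conjugates D) * N)" if "x \<in> K" for x
  proof -
    have "x \<in> fixed (pointwise_stabilizer (disk_stabilizer D) K)"
      using that by (auto simp: fixed_def pointwise_stabilizer_def[OF Galois_group_disk_stabilizer])
    then have "orb (pointwise_stabilizer (disk_stabilizer D) K) x = {x}"
      using fixed_iff_orb[OF Galois_group_pointwise_stabilizer[OF Galois_group_disk_stabilizer[of D]], of x K] by simp
    then have "card (orb (disk_stabilizer D) x) \<le> N" using N[of x] by simp
    then have "card (conjugates D) * card (orb (disk_stabilizer D) x) \<le> card (conjugates D) * N"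
      by (rule mult_le_mono2)
    then show ?thesis by (rule le_mult_trans[OF card_orb_GQ_disk_stabilizer])
  qed
  then show thesis by (rule that)
qed

lemma ramification_index_pos_F:
  assumes "finite_extension disk_field K"
  shows "0 < ramification_index absv disk_field K"
proof -
  obtain M where M: "\<And>x. x \<in> K \<Longrightarrow> card (orb GQ x) \<le> M"
    by (rule bounded_finite_extension[OF assms]) (rule that)
  have "is_subfield K" "disk_field \<subseteq> K" using assms unfolding finite_extension_def by blast+
  then show ?thesis by (rule ramification_index_pos[OF F_subfield _ _ Qp_subset_F M])
qed

lemma disk_complexity_witness:
  obtains K a b s t where "finite_extension disk_field K" "K \<inter> D \<noteq> {}" "ramification_index absv disk_field K = s"
    "0 < s" "0 < t" "a \<in> K" "b \<in> K" "disk_complexity absv E D = s * t" "b \<noteq> 0"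
    "D = {x. absv (x - a) ^ (s * t) \<le> absv b} \<or> D = {x. absv (x - a) ^ (s * t) < absv b}"
proof -
  obtain c a\<^sub>0 e where e: "e \<noteq> 0" and D_eq: "D = disk c a\<^sub>0 (absv e)" using D unfolding rational_disk_def by blast
  then have r0: "0 < absv e" by (intro absv_pos)
  define s where "s = disk_min_ramification absv E D"
  let ?P = "\<lambda>s K. finite_extension disk_field K \<and> K \<inter> D \<noteq> {} \<and> ramification_index absv disk_field K = s"
  have s_eq: "s = (LEAST s. \<exists>K. ?P s K)"
    by (simp add: s_def disk_min_ramification_def field_of_definition_eq Let_def)
  obtain K\<^sub>0 where "finite_extension disk_field K\<^sub>0" "{a\<^sub>0} \<subseteq> K\<^sub>0"
    using finite_extension_containing[of "{a\<^sub>0}" disk_field] F_subfield Qp_subset_F by blast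
  then have "\<exists>s K. ?P s K" using disk_center[OF r0] D_eq by (metis disjoint_iff insert_subset)
  then have "\<exists>K. ?P s K" unfolding s_eq by (rule LeastI_ex)
  then obtain K where K: "?P s K" by blast
  have s0: "s > 0" using ramification_index_pos_F[of K] K by auto
  let ?v = "normalized_valuation absv E"
  let ?Q = "\<lambda>t. 0 < t \<and> (\<exists>K. finite_extension disk_field K \<and> K \<inter> D \<noteq> {} \<and> ramification_index absv disk_field K = s \<and>
            (\<exists>a\<in>K. \<exists>b\<in>K. D = {x. ereal (real (s * t)) * ?v (x - a) \<ge> ?v b} \<or>
              D = {x. ereal (real (s * t)) * ?v (x - a) > ?v b}))"
  define t where "t = disk_scale absv E D"
  have t_eq: "t = (LEAST t. ?Q t)"
    unfolding t_def disk_scale_def field_of_definition_eq Let_def s_def ..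
  have "\<exists>t. ?Q t"
  proof -
    obtain a where a: "a \<in> K" "a \<in> D" using K by blast
    have Da: "D = disk c a (absv e)" using disk_recenter a(2) unfolding D_eq by blast
    define t' where "t' = (fact (card (orb GQ e)) :: nat)"
    obtain j where j: "absv e ^ t' = real p powi j"
      using absv_power_fact[OF e order_refl] unfolding t'_def by blast
    have KQ: "is_subfield K" "Qp absv \<subseteq> K" using K Qp_subset_F unfolding finite_extension_def by blast+
    from value_group_powi[OF this, of j] obtain b where "b \<in> K - {0}" "real p powi j = absv b"
      unfolding value_group_def by (rule imageE)
    then have b: "b \<in> K" "b \<noteq> 0" "absv b = real p powi j" by auto
    have k0: "0 < s * t'" using s0 by (simp add: t'_def)
    have bs: "b ^ s \<in> K" "b ^ s \<noteq> 0" using b subfield_power[OF KQ(1)] by auto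
    have eq: "absv (b ^ s) = absv e ^ (s * t')"
      by (simp add: absv_power b(3) j[symmetric] power_mult[symmetric] mult.commute)
    have le: "absv x ^ (s * t') \<le> absv (b ^ s) \<longleftrightarrow> absv x \<le> absv e" for x
      unfolding eq using k0 absv_nonneg by (intro power_mono_iff) auto
    then have less: "absv x ^ (s * t') < absv (b ^ s) \<longleftrightarrow> absv x < absv e" for x
      unfolding eq using k0 absv_nonneg by (metis power_strict_mono power_less_imp_less_base)
    have "D = {x. ereal (real (s * t')) * ?v (x - a) \<ge> ?v (b ^ s)} \<or>
          D = {x. ereal (real (s * t')) * ?v (x - a) > ?v (b ^ s)}"
      unfolding valuation_compare[OF bs(2) k0] le less Da disk_def by (cases c) auto
    then have "?Q t'" using K a(1) bs(1) by (intro conjI exI[of _ K]) (auto simp: t'_def)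
    then show ?thesis by blast
  qed
  then have "?Q t" unfolding t_eq by (rule LeastI_ex)
  then obtain L a b where t0: "0 < t" and L: "finite_extension disk_field L" "L \<inter> D \<noteq> {}" "ramification_index absv disk_field L = s"
    and ab: "a \<in> L" "b \<in> L" and Dv: "D = {x. ereal (real (s * t)) * ?v (x - a) \<ge> ?v b} \<or>
              D = {x. ereal (real (s * t)) * ?v (x - a) > ?v b}" by blast
  have k0: "0 < s * t" using s0 t0 by simp
  have "b \<noteq> 0"
  proof
    assume "b = 0"
    then have vb: "?v b = \<infinity>" by (simp add: normalized_valuation_def)
    have "x = a" if "ereal (real (s * t)) * ?v (x - a) \<ge> \<infinity>" for x
      using that by (auto simp: normalized_valuation_def split: if_splits)
    then have "D \<subseteq> {a}" using Dv unfolding vb by auto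
    moreover obtain x where "x \<in> D" "x \<noteq> a" using disk_nontrivial[OF r0] unfolding D_eq by blast
    ultimately show False by blast
  qed
  moreover have "D = {x. absv (x - a) ^ (s * t) \<le> absv b} \<or> D = {x. absv (x - a) ^ (s * t) < absv b}"
    using Dv unfolding valuation_compare[OF \<open>b \<noteq> 0\<close> k0] .
  moreover have "disk_complexity absv E D = s * t" by (simp add: disk_complexity_def s_def t_def)
  ultimately show thesis using that L ab s0 t0 by blast
qed

lemma disk_complexity_pos: "0 < disk_complexity absv E D"
  by (rule disk_complexity_witness) simp

lemma disk_bounded_complexity:
  assumes m: "disk_complexity absv E D \<le> m" and conj: "card (conjugates D) \<le> m"
  obtains c a r j where "D = disk c a r" "0 < r" "card (orb (Gal E) a) \<le> m * m"
    "r ^ (fact m * fact m * fact (E_index * m)) = real p powi j"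
proof -
  obtain K a b s t where K: "finite_extension disk_field K" "K \<inter> D \<noteq> {}" "ramification_index absv disk_field K = s"
    and st: "0 < s" "0 < t" and ab: "a \<in> K" "b \<in> K" "b \<noteq> 0" and cx: "disk_complexity absv E D = s * t"
    and Dst: "D = {x. absv (x - a) ^ (s * t) \<le> absv b} \<or> D = {x. absv (x - a) ^ (s * t) < absv b}"
    by (rule disk_complexity_witness)
  have Ksub: "is_subfield K" "disk_field \<subseteq> K" using K(1) unfolding finite_extension_def by blast+
  obtain M where M: "\<And>x. x \<in> K \<Longrightarrow> card (orb GQ x) \<le> M"
    by (rule bounded_finite_extension[OF K(1)]) (rule that)
  note vg = F_subfield Ksub Qp_subset_F M
  have k0: "0 < s * t" using st by simp
  have km: "s * t \<le> m" using m cx by simp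
  have "s \<le> s * t" using st by simp
  then have sm: "s \<le> m" using km by (rule le_trans)
  define r where "r = root (s * t) (absv b)"
  have rpow: "r ^ (s * t) = absv b" unfolding r_def using k0 absv_nonneg by simp
  have r0: "0 < r" unfolding r_def using k0 absv_pos[OF ab(3)] by simp
  have le: "absv x ^ (s * t) \<le> absv b \<longleftrightarrow> absv x \<le> r" for x
    unfolding rpow[symmetric] using k0 absv_nonneg r0 by (intro power_mono_iff) auto
  then have less: "absv x ^ (s * t) < absv b \<longleftrightarrow> absv x < r" for x
    unfolding rpow[symmetric] using k0 absv_nonneg r0
    by (metis less_imp_le power_strict_mono power_less_imp_less_base)
  have "D = disk True a r \<or> D = disk False a r" using Dst unfolding le less by (simp add: disk_def)
  then obtain c where Dc: "D = disk c a r" by blast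
  obtain b\<^sub>0 where b0: "b\<^sub>0 \<in> K" "b\<^sub>0 \<in> D" using K(2) by blast
  obtain x0 where x0: "x0 \<in> D" "x0 \<noteq> b\<^sub>0" using disk_nontrivial[OF r0] Dc by blast
  obtain a' where a': "a' \<in> D" "card (orb (disk_stabilizer D) a') \<le> s"
  proof (rule root_in_disk[OF Galois_group_disk_stabilizer, where D = D and b = b\<^sub>0 and K = K and M = M])
    show "absv (x - b) < absv (b - a)" if "x \<in> D" "b \<in> D" "a \<notin> D" for x b a
      using disk_ultrametric that unfolding Dc by blast
    show "\<sigma> x \<in> D" if "\<sigma> \<in> disk_stabilizer D" "x \<in> D" for \<sigma> x
      using that by (auto simp: disk_stabilizer_def)
  qed (use b0 x0 Ksub M K(3) in auto)
  have "card (orb (Gal E) a') \<le> card (conjugates D) * s"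
    by (rule le_mult_trans[OF card_orb_disk_stabilizer a'(2)])
  also have "\<dots> \<le> m * m" using conj sm by (rule mult_le_mono)
  finally have orb: "card (orb (Gal E) a') \<le> m * m" .
  have bvg: "absv b \<in> value_group absv K" using ab unfolding value_group_def by blast
  obtain i j u where ij: "i < j" "j \<le> s" "u \<in> value_group absv disk_field" "absv b ^ j = absv b ^ i * u"
    by (rule ramification_pigeonhole[OF vg, of "\<lambda>i. absv b ^ i"])
      (use value_group_power[OF Ksub(1) bvg] K(3) in auto)
  define d where "d = j - i"
  have d: "0 < d" "d \<le> m" using ij sm by (auto simp: d_def)
  have "absv b ^ i * absv b ^ d = absv b ^ i * u"
    using ij(1,4) by (simp add: d_def power_add[symmetric])
  then have u: "absv b ^ d = u" using absv_pos[OF ab(3)] by simp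
  obtain f where f: "f \<in> disk_field" "f \<noteq> 0" "u = absv f" using ij(3) unfolding value_group_def by blast
  have "card (orb GQ f) \<le> E_index * m"
    by (rule le_mult_trans[OF bounded_F[OF f(1)] conj])
  then obtain l where l: "absv f ^ fact (E_index * m) = real p powi l"
    using absv_power_fact[OF f(2)] by blast
  have "s * t dvd fact m" "d dvd fact m" using k0 km d by (auto intro: dvd_fact)
  then obtain x y where xy: "fact m = s * t * x" "fact m = d * y" by (metis dvd_def)
  have "r ^ (fact m * fact m * fact (E_index * m)) =
      (((r ^ (s * t)) ^ d) ^ fact (E_index * m)) ^ (x * y)"
  proof -
    have "(fact m * fact m * fact (E_index * m) :: nat) = (s * t) * d * fact (E_index * m) * (x * y)"
      by (subst (1) xy(1), subst xy(2)) (simp add: mult_ac)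
    then show ?thesis by (simp only: power_mult)
  qed
  also have "\<dots> = real p powi (l * int (x * y))"
    unfolding rpow u f(3) l by (simp add: power_int_mult del: of_nat_mult)
  finally show thesis
    using that[of c a' r] Dc disk_recenter[of a' c a r] a'(1) r0 orb by blast
qed

end

end

section \<open>Uniqueness of presentations\<close>

context Qp_algebraic_closure
begin

lemma many_residues:
  obtains Z where "finite Z" "card Z = n" "\<And>z. z \<in> Z \<Longrightarrow> absv z \<le> 1"
    "\<And>z z'. z \<in> Z \<Longrightarrow> z' \<in> Z \<Longrightarrow> z \<noteq> z' \<Longrightarrow> absv (z - z') = 1"
proof -
  have "\<exists>Z. finite Z \<and> card Z = n \<and> (\<forall>z\<in>Z. absv z \<le> 1) \<and>
    (\<forall>z\<in>Z. \<forall>z'\<in>Z. z \<noteq> z' \<longrightarrow> absv (z - z') = 1)"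
  proof (induction n)
    case (Suc n)
    then obtain Z where Z: "finite Z" "card Z = n" "\<forall>z\<in>Z. absv z \<le> 1"
      "\<forall>z\<in>Z. \<forall>z'\<in>Z. z \<noteq> z' \<longrightarrow> absv (z - z') = 1" by blast
    have "\<exists>w. absv w \<le> 1 \<and> (\<forall>z\<in>Z. absv (w - z) = 1)"
    proof (cases "Z = {}")
      case False
      define f where "f = (\<Prod>z\<in>Z. [:-z, 1:])"
      have df: "degree f = n" unfolding f_def Z(2)[symmetric] by (subst degree_prod_sum_eq) auto
      have n0: "n > 0" using False Z(1,2) by (auto simp: card_gt_0_iff)
      have "degree (f + 1) = n" using df n0 by (subst degree_add_eq_left) auto
      then obtain w where "poly (f + 1) w = 0" using alg_closed_imp_poly_has_root[of "f + 1"] n0 by auto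
      then have fw: "(\<Prod>z\<in>Z. w - z) = - 1" by (simp add: f_def poly_prod eq_neg_iff_add_eq_0)
      have prod1: "(\<Prod>z\<in>Z. absv (w - z)) = 1" using arg_cong[OF fw, of absv] by (simp add: absv_prod)
      have w1: "absv w \<le> 1"
      proof (rule ccontr)
        assume "\<not> absv w \<le> 1"
        then have "absv (w - z) > 1" if "z \<in> Z" for z
          using absv_add_le_max[of "w - z" z] Z(3) that by fastforce
        then have "1 < (\<Prod>z\<in>Z. absv (w - z))" using Z(1) False by (intro less_1_prod)
        then show False using prod1 by simp
      qed
      then have le: "absv (w - z) \<le> 1" if "z \<in> Z" for z
        using absv_diff_le_max[of w z] Z(3) that by fastforce
      have "absv (w - z) = 1" if z: "z \<in> Z" for z
      proof -
        have "1 = absv (w - z) * (\<Prod>z\<in>Z - {z}. absv (w - z))"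
          using prod.remove[OF Z(1) z, of "\<lambda>z. absv (w - z)"] prod1 by simp
        also have "\<dots> \<le> absv (w - z) * 1"
          using le absv_nonneg by (intro mult_left_mono prod_le_1) auto
        finally show ?thesis using le[OF z] by simp
      qed
      then show ?thesis using w1 by blast
    qed (auto intro: exI[of _ 0])
    then obtain w where w: "absv w \<le> 1" "\<forall>z\<in>Z. absv (w - z) = 1" by blast
    then have "w \<notin> Z" by force
    then show ?case
      using Z w absv_diff_commute by (intro exI[of _ "insert w Z"]) auto
  qed (auto intro: exI[of _ "{}"])
  then show thesis using that by blast
qed

lemma absv_dense:
  assumes "0 \<le> s" "s < r"
  obtains e where "s < absv e" "absv e < r"
proof (cases "s = 0")
  case True
  then obtain e where "e \<noteq> 0" "absv e < r" using small_element assms by blast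
  then show thesis using that True absv_pos by blast
next
  case False
  then have s: "s > 0" "r > 0" using assms by auto
  obtain n where n: "(s / r) ^ n < 1 / real p"
    using real_arch_pow_inv[of "1 / real p" "s / r"] s assms real_p_gt_1 by auto
  have n0: "n \<noteq> 0" using n real_p_gt_1 by (cases n) auto
  obtain w where w: "w ^ n = (of_nat p :: 'a)" using nth_root_exists[of n "of_nat p :: 'a"] n0 by auto
  define q where "q = absv w"
  have q0: "q \<ge> 0" by (simp add: q_def absv_nonneg)
  have qn: "q ^ n = 1 / real p" unfolding q_def absv_power[symmetric] w by (rule absv_p)
  then have q: "s / r < q" using n q0 s by (metis not_le power_mono divide_nonneg_nonneg less_imp_le)
  have q1: "q < 1"
  proof (rule ccontr)
    assume "\<not> q < 1"
    then have "1 \<le> q ^ n" by simp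
    then show False using qn real_p_gt_1 by simp
  qed
  obtain j where j: "r < real p ^ j" using real_arch_pow[OF real_p_gt_1] by blast
  obtain k\<^sub>0 where "q ^ k\<^sub>0 < r / real p ^ j"
    using real_arch_pow_inv[of "r / real p ^ j" q] q1 s real_p_gt_1 by auto
  then have "\<exists>k. real p ^ j * q ^ k < r" using real_p_gt_1 by (auto simp: field_simps)
  then obtain k where k: "real p ^ j * q ^ k < r" "\<And>i. i < k \<Longrightarrow> \<not> real p ^ j * q ^ i < r"
    using exists_least_iff[of "\<lambda>k. real p ^ j * q ^ k < r"] by blast
  obtain i where i: "k = Suc i" using k j by (cases k) auto
  have "s < q * r" using q s by (simp add: field_simps)
  also have "\<dots> \<le> q * (real p ^ j * q ^ i)" using k(2)[of i] i q0 by (intro mult_left_mono) auto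
  finally have "s < real p ^ j * q ^ k" by (simp add: i mult_ac)
  moreover have "absv (w ^ k / of_nat p ^ j) = real p ^ j * q ^ k"
    by (simp add: absv_divide absv_power absv_p q_def power_one_over)
  ultimately show thesis using k(1) that by metis
qed

text \<open>The filters of the sets that are generic on the closed disk of centre \<open>a\<close> and radius \<open>r\<close>,
  respectively on the annuli just outside and just inside of it; they correspond to a point of
  type 2 of the Berkovich line and two of its tangent directions.  The disks presenting a set are
  those whose boundary point it misses although it contains the annulus just inside (for the open
  outer disks) or just outside (for the closed holes).\<close>

definition generic_on :: "'a \<Rightarrow> real \<Rightarrow> 'a set \<Rightarrow> bool" where
  "generic_on a r S \<longleftrightarrow> (\<exists>T. finite T \<and> (\<forall>x. absv (x - a) \<le> r \<longrightarrow> (\<forall>t\<in>T. r \<le> absv (x - t)) \<longrightarrow> x \<in> S))"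

definition generic_beside :: "bool \<Rightarrow> 'a \<Rightarrow> real \<Rightarrow> 'a set \<Rightarrow> bool" where
  "generic_beside out a r S \<longleftrightarrow> (\<exists>s\<ge>0. (if out then r < s else s < r) \<and>
    (\<forall>x. min r s < absv (x - a) \<and> absv (x - a) < max r s \<longrightarrow> x \<in> S))"

definition set_filter :: "('a set \<Rightarrow> bool) \<Rightarrow> bool" where
  "set_filter ev \<longleftrightarrow> ev UNIV \<and> (\<forall>A B. ev A \<longrightarrow> ev B \<longrightarrow> ev (A \<inter> B)) \<and>
    (\<forall>A B. ev A \<longrightarrow> A \<subseteq> B \<longrightarrow> ev B) \<and> \<not> ev {}"

lemma set_filter_generic_on:
  assumes "e \<noteq> 0" "r = absv e"
  shows "set_filter (generic_on a r)"
proof -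
  have r: "r > 0" using assms absv_pos by simp
  have "\<not> generic_on a r {}"
  proof
    assume "generic_on a r {}"
    then obtain T where T: "finite T" "\<And>x. absv (x - a) \<le> r \<Longrightarrow> \<exists>t\<in>T. absv (x - t) < r"
      unfolding generic_on_def by (metis empty_iff not_le)
    obtain Z where Z: "finite Z" "card Z = Suc (card T)" "\<And>z. z \<in> Z \<Longrightarrow> absv z \<le> 1"
      "\<And>z z'. z \<in> Z \<Longrightarrow> z' \<in> Z \<Longrightarrow> z \<noteq> z' \<Longrightarrow> absv (z - z') = 1"
      using many_residues[of "Suc (card T)"] by metis
    have "\<exists>t\<in>T. absv (a + e * z - t) < r" if "z \<in> Z" for z
      using T(2)[of "a + e * z"] Z(3)[OF that] r by (simp add: absv_mult assms(2) mult_left_le absv_nonneg)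
    then obtain t where t: "\<And>z. z \<in> Z \<Longrightarrow> t z \<in> T" "\<And>z. z \<in> Z \<Longrightarrow> absv (a + e * z - t z) < r" by metis
    have "inj_on t Z"
    proof (rule inj_onI, rule ccontr)
      fix z z' assume z: "z \<in> Z" "z' \<in> Z" "t z = t z'" "z \<noteq> z'"
      have "absv ((a + e * z) - (a + e * z')) < r"
        using absv_ultrametric[of "a + e * z" "a + e * z'" "t z"] t(2)[OF z(1)] t(2)[OF z(2)] z(3)
          absv_diff_commute[of "t z'"] by simp
      moreover have "(a + e * z) - (a + e * z') = e * (z - z')" by (simp add: algebra_simps)
      ultimately show False using Z(4)[OF z(1,2,4)] by (simp add: absv_mult assms(2))
    qed
    then have "card Z \<le> card T" using t(1) T(1) by (intro card_inj_on_le) auto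
    then show False using Z(2) by simp
  qed
  moreover have "generic_on a r (A \<inter> B)" if AB: "generic_on a r A" "generic_on a r B" for A B
  proof -
    obtain T T' where "finite T" "\<forall>x. absv (x - a) \<le> r \<longrightarrow> (\<forall>t\<in>T. r \<le> absv (x - t)) \<longrightarrow> x \<in> A"
      "finite T'" "\<forall>x. absv (x - a) \<le> r \<longrightarrow> (\<forall>t\<in>T'. r \<le> absv (x - t)) \<longrightarrow> x \<in> B"
      using AB unfolding generic_on_def by blast
    then show ?thesis unfolding generic_on_def by (intro exI[of _ "T \<union> T'"]) auto
  qed
  moreover have "generic_on a r UNIV" unfolding generic_on_def by blast
  moreover have "generic_on a r B" if "generic_on a r A" "A \<subseteq> B" for A B
    using that unfolding generic_on_def by (meson subsetD)
  ultimately show ?thesis unfolding set_filter_def by blast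
qed

lemma set_filter_generic_beside:
  assumes "0 < r"
  shows "set_filter (generic_beside out a r)"
proof -
  have "\<not> generic_beside out a r {}"
  proof
    assume "generic_beside out a r {}"
    then obtain s where s: "0 \<le> s" "if out then r < s else s < r"
        "\<And>x. min r s < absv (x - a) \<Longrightarrow> \<not> absv (x - a) < max r s"
      unfolding generic_beside_def by blast
    have "0 \<le> min r s" "min r s < max r s" using s assms by (auto split: if_splits)
    then obtain e where "min r s < absv e" "absv e < max r s" using absv_dense by blast
    then show False using s(3)[of "a + e"] by simp
  qed
  moreover have "generic_beside out a r (A \<inter> B)" if AB: "generic_beside out a r A" "generic_beside out a r B" for A B
  proof -
    obtain s s' where "0 \<le> s" "if out then r < s else s < r" "0 \<le> s'" "if out then r < s' else s' < r"
      "\<forall>x. min r s < absv (x - a) \<and> absv (x - a) < max r s \<longrightarrow> x \<in> A"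
      "\<forall>x. min r s' < absv (x - a) \<and> absv (x - a) < max r s' \<longrightarrow> x \<in> B"
      using AB unfolding generic_beside_def by blast
    then show ?thesis unfolding generic_beside_def
      by (intro exI[of _ "if out then min s s' else max s s'"]) (auto split: if_splits)
  qed
  moreover have "generic_beside out a r UNIV"
    unfolding generic_beside_def using assms by (intro exI[of _ "if out then r + 1 else 0"]) auto
  moreover have "generic_beside out a r B" if "generic_beside out a r A" "A \<subseteq> B" for A B
    using that unfolding generic_beside_def by (meson subsetD)
  ultimately show ?thesis unfolding set_filter_def by blast
qed

lemma absv_eq_of_not_in_disk:
  assumes "a \<notin> disk c b \<rho>" "x \<in> disk c b \<rho>"
  shows "absv (x - a) = absv (b - a)" "absv (x - b) < absv (b - a)"
proof -
  show *: "absv (x - b) < absv (b - a)"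
    using assms absv_diff_commute[of b a] by (auto simp: disk_def split: if_splits)
  then have "absv ((b - a) - (x - a)) < absv (b - a)" by (simp add: absv_diff_commute)
  then show "absv (x - a) = absv (b - a)" by (rule absv_eq_of_diff_less)
qed

lemma generic_on_disk:
  fixes a b e :: 'a and r \<rho> :: real
  assumes "e \<noteq> 0" "r = absv e"
  defines "P c \<equiv> a \<in> disk c b \<rho> \<and> (if c then r \<le> \<rho> else r < \<rho>)"
  shows "P c \<Longrightarrow> generic_on a r (disk c b \<rho>)" "\<not> P c \<Longrightarrow> generic_on a r (- disk c b \<rho>)"
proof -
  assume "P c"
  then have "disk c b \<rho> = disk c a \<rho>" "if c then r \<le> \<rho> else r < \<rho>" using disk_recenter by (auto simp: P_def)
  then show "generic_on a r (disk c b \<rho>)"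
    unfolding generic_on_def by (intro exI[of _ "{}"]) (auto simp: disk_def split: if_splits)
next
  assume notP: "\<not> P c"
  show "generic_on a r (- disk c b \<rho>)"
  proof (cases "a \<in> disk c b \<rho>")
    case True
    then have "disk c b \<rho> = disk c a \<rho>" "if c then \<rho> < r else \<rho> \<le> r"
      using disk_recenter notP by (auto simp: P_def)
    then show ?thesis
      unfolding generic_on_def by (intro exI[of _ "{a}"]) (auto simp: disk_def split: if_splits)
  next
    case False
    have "x \<in> - disk c b \<rho>" if "absv (x - a) \<le> r" "r \<le> absv (x - b)" for x
      using absv_eq_of_not_in_disk[OF False, of x] that by force
    then show ?thesis unfolding generic_on_def by (intro exI[of _ "{b}"]) auto
  qed
qed

lemma generic_beside_disk:
  fixes a b :: 'a and out :: bool and r \<rho> :: real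
  assumes "0 < r"
  defines "P c \<equiv> a \<in> disk c b \<rho> \<and> (if out then r < \<rho> else r \<le> \<rho>)"
  shows "P c \<Longrightarrow> generic_beside out a r (disk c b \<rho>)" "\<not> P c \<Longrightarrow> generic_beside out a r (- disk c b \<rho>)"
proof -
  assume "P c"
  then have "disk c b \<rho> = disk c a \<rho>" "if out then r < \<rho> else r \<le> \<rho>"
    using disk_recenter by (auto simp: P_def)
  then show "generic_beside out a r (disk c b \<rho>)"
    unfolding generic_beside_def using assms(1)
    by (intro exI[of _ "if out then \<rho> else 0"]) (auto simp: disk_def split: if_splits)
next
  assume notP: "\<not> P c"
  show "generic_beside out a r (- disk c b \<rho>)"
  proof (cases "a \<in> disk c b \<rho>")
    case True
    then have "disk c b \<rho> = disk c a \<rho>" "if out then \<rho> \<le> r else \<rho> < r"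
      using disk_recenter notP by (auto simp: P_def)
    then show ?thesis
      unfolding generic_beside_def using assms(1)
      by (intro exI[of _ "if out then r + 1 else max 0 \<rho>"]) (auto simp: disk_def split: if_splits)
  next
    case False
    define d where "d = absv (b - a)"
    define s where "s = (if (if out then r < d else d < r) then d else if out then r + 1 else 0)"
    have "x \<in> - disk c b \<rho>" if "min r s < absv (x - a) \<and> absv (x - a) < max r s" for x
    proof
      assume "x \<in> disk c b \<rho>"
      then have "absv (x - a) = d" using absv_eq_of_not_in_disk(1)[OF False] by (simp add: d_def)
      then show False using that assms(1) by (auto simp: s_def split: if_splits)
    qed
    then show ?thesis unfolding generic_beside_def
      using assms(1) absv_nonneg by (intro exI[of _ s]) (auto simp: s_def d_def)
  qed
qed

lemma set_filter_decided:
  assumes "set_filter ev" "P \<Longrightarrow> ev S" "\<not> P \<Longrightarrow> ev (- S)"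
  shows "ev S \<longleftrightarrow> P"
proof
  assume "ev S"
  show P
  proof (rule ccontr)
    assume "\<not> P"
    then have "ev (S \<inter> - S)" using assms \<open>ev S\<close> unfolding set_filter_def by blast
    then show False using assms(1) by (simp add: set_filter_def)
  qed
qed (rule assms(2))

lemma generic_on_disk_iff:
  assumes "e \<noteq> 0" "r = absv e"
  shows "generic_on a r (disk c b \<rho>) \<longleftrightarrow> a \<in> disk c b \<rho> \<and> (if c then r \<le> \<rho> else r < \<rho>)"
  by (rule set_filter_decided[OF set_filter_generic_on[OF assms]])
    (erule generic_on_disk[OF assms])+

lemma generic_beside_disk_iff:
  assumes "0 < r"
  shows "generic_beside out a r (disk c b \<rho>) \<longleftrightarrow> a \<in> disk c b \<rho> \<and> (if out then r < \<rho> else r \<le> \<rho>)"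
  by (rule set_filter_decided[OF set_filter_generic_beside[OF assms]])
    (erule generic_beside_disk[OF assms])+

definition decides :: "('a set \<Rightarrow> bool) \<Rightarrow> bool" where
  "decides ev \<longleftrightarrow> set_filter ev \<and> (\<forall>c b \<rho>. ev (disk c b \<rho>) \<or> ev (- disk c b \<rho>))"

lemma decides_generic_on:
  assumes "e \<noteq> 0" "r = absv e"
  shows "decides (generic_on a r)"
  unfolding decides_def
proof (intro conjI allI)
  show "set_filter (generic_on a r)" by (rule set_filter_generic_on[OF assms])
  show "generic_on a r (disk c b \<rho>) \<or> generic_on a r (- disk c b \<rho>)" for c b \<rho>
    using generic_on_disk(2)[OF assms, of a c b \<rho>] generic_on_disk_iff[OF assms, of a c b \<rho>] by argo
qed

lemma decides_generic_beside:
  assumes "0 < r"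
  shows "decides (generic_beside out a r)"
  unfolding decides_def
proof (intro conjI allI)
  show "set_filter (generic_beside out a r)" by (rule set_filter_generic_beside[OF assms])
  show "generic_beside out a r (disk c b \<rho>) \<or> generic_beside out a r (- disk c b \<rho>)" for c b \<rho>
    using generic_beside_disk(2)[OF assms, of a c b \<rho> out] generic_beside_disk_iff[OF assms, of out a c b \<rho>] by argo
qed

end

locale standard_presentation = Qp_algebraic_closure p absv
  for p and absv :: "'a::{alg_closed_field, field_char_0} \<Rightarrow> real" +
  fixes X :: "'a set" and \<C> :: "'i set" and outer :: "'i \<Rightarrow> 'a set" and holes :: "'i \<Rightarrow> 'a set set"
  assumes finite_\<C>: "finite \<C>"
    and outer: "Y \<in> \<C> \<Longrightarrow> open_rational_disk absv (outer Y)"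
    and finite_holes: "Y \<in> \<C> \<Longrightarrow> finite (holes Y)"
    and hole: "Y \<in> \<C> \<Longrightarrow> D \<in> holes Y \<Longrightarrow> closed_rational_disk absv D \<and> D \<subset> outer Y"
    and disjoint_holes: "Y \<in> \<C> \<Longrightarrow> disjoint (holes Y)"
    and disjoint_regions: "Y \<in> \<C> \<Longrightarrow> Z \<in> \<C> \<Longrightarrow> Y \<noteq> Z \<Longrightarrow>
      (outer Y - \<Union>(holes Y)) \<inter> (outer Z - \<Union>(holes Z)) = {}"
    and X_eq: "X = (\<Union>Y\<in>\<C>. outer Y - \<Union>(holes Y))"
begin

definition region :: "'i \<Rightarrow> 'a set" where
  "region Y = outer Y - \<Union>(holes Y)"

definition disks_at :: "bool \<Rightarrow> 'i \<Rightarrow> 'a set set" where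
  "disks_at c Y = (if c then holes Y else {outer Y})"

definition disks :: "'a set set" where
  "disks = outer ` \<C> \<union> \<Union>(holes ` \<C>)"

lemma disks_iff: "D \<in> disks \<longleftrightarrow> (\<exists>c. \<exists>Y\<in>\<C>. D \<in> disks_at c Y)"
  unfolding disks_def disks_at_def ex_bool_eq by auto

lemma finite_disks: "finite disks"
  unfolding disks_def using finite_\<C> finite_holes by auto

lemma outer_disk:
  assumes "Y \<in> \<C>"
  obtains b e where "e \<noteq> 0" "outer Y = disk False b (absv e)"
proof -
  obtain b r where "r \<in> absv ` (UNIV - {0})" "outer Y = {x. absv (x - b) < r}"
    using outer[OF assms] unfolding open_rational_disk_def value_group_def by blast
  moreover from this(1) obtain e where "e \<noteq> 0" "r = absv e" by blast
  ultimately show thesis using that[of e b] by (simp add: disk_def)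
qed

lemma hole_disk:
  assumes "Y \<in> \<C>" "D \<in> holes Y"
  obtains b e where "e \<noteq> 0" "D = disk True b (absv e)"
proof -
  have "closed_rational_disk absv D" using hole[OF assms] by (rule conjunct1)
  then obtain b r where "r \<in> absv ` (UNIV - {0})" "D = {x. absv (x - b) \<le> r}"
    unfolding closed_rational_disk_def value_group_def by blast
  moreover from this(1) obtain e where "e \<noteq> 0" "r = absv e" by blast
  ultimately show thesis using that[of e b] by (simp add: disk_def)
qed

lemma rational_disks:
  assumes "D \<in> disks"
  shows "rational_disk D"
proof -
  obtain Y where Y: "Y \<in> \<C>" "D = outer Y \<or> D \<in> holes Y" using assms unfolding disks_def by blast
  then show ?thesis using rational_diskI(1)[OF outer] rational_diskI(2)[of D] hole[of Y D] by blast
qed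

lemma region_decided:
  assumes ev: "decides ev" and Y: "Y \<in> \<C>"
  shows "ev (region Y) \<longleftrightarrow> ev (outer Y) \<and> (\<forall>D\<in>holes Y. \<not> ev D)"
    and "ev (region Y) \<or> ev (- region Y)"
proof -
  have f: "ev UNIV" "\<And>A B. ev A \<Longrightarrow> ev B \<Longrightarrow> ev (A \<inter> B)" "\<And>A B. ev A \<Longrightarrow> A \<subseteq> B \<Longrightarrow> ev B" "\<not> ev {}"
    using ev unfolding decides_def set_filter_def by blast+
  have no: "\<not> (ev A \<and> ev (- A))" for A using f(2)[of A "- A"] f(4) by auto
  have dec: "ev D \<or> ev (- D)" if "D \<in> holes Y" for D
    using hole_disk[OF Y that] ev unfolding decides_def by metis
  have inter: "ev (\<Inter>D\<in>\<D>. - D)" if "finite \<D>" "\<forall>D\<in>\<D>. ev (- D)" for \<D>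
    using that by (induction \<D>) (auto intro: f)
  have "ev (region Y)" if "ev (outer Y)" "\<forall>D\<in>holes Y. \<not> ev D"
  proof -
    have "ev (\<Inter>D\<in>holes Y. - D)" using inter finite_holes[OF Y] dec that(2) by blast
    then have "ev (outer Y \<inter> (\<Inter>D\<in>holes Y. - D))" using that(1) f(2) by blast
    moreover have "outer Y \<inter> (\<Inter>D\<in>holes Y. - D) = region Y" by (auto simp: region_def)
    ultimately show ?thesis by simp
  qed
  moreover have "ev (outer Y) \<and> (\<forall>D\<in>holes Y. \<not> ev D)" if "ev (region Y)"
  proof -
    have "ev (outer Y)" using f(3)[OF that] by (auto simp: region_def)
    moreover have "ev (- D)" if "D \<in> holes Y" for D
      using f(3)[OF \<open>ev (region Y)\<close>, of "- D"] that by (auto simp: region_def)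
    ultimately show ?thesis using no by blast
  qed
  ultimately show iff: "ev (region Y) \<longleftrightarrow> ev (outer Y) \<and> (\<forall>D\<in>holes Y. \<not> ev D)" by blast
  show "ev (region Y) \<or> ev (- region Y)"
  proof (cases "ev (outer Y)")
    case False
    then have "ev (- outer Y)" using outer_disk[OF Y] ev unfolding decides_def by metis
    then show ?thesis using f(3)[of "- outer Y" "- region Y"] by (auto simp: region_def)
  next
    case True
    show ?thesis
    proof (cases "\<forall>D\<in>holes Y. \<not> ev D")
      case True
      then show ?thesis using \<open>ev (outer Y)\<close> iff by blast
    next
      case False
      then obtain D where "D \<in> holes Y" "ev D" by blast
      then show ?thesis using f(3)[of D "- region Y"] by (auto simp: region_def)
    qed
  qed
qed

lemma X_decided:
  assumes ev: "decides ev"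
  shows "ev X \<longleftrightarrow> (\<exists>Y\<in>\<C>. ev (region Y))"
proof
  have f: "ev UNIV" "\<And>A B. ev A \<Longrightarrow> ev B \<Longrightarrow> ev (A \<inter> B)" "\<And>A B. ev A \<Longrightarrow> A \<subseteq> B \<Longrightarrow> ev B" "\<not> ev {}"
    using ev unfolding decides_def set_filter_def by blast+
  have X: "X = (\<Union>Y\<in>\<C>. region Y)" by (simp add: X_eq region_def)
  show "ev X" if "\<exists>Y\<in>\<C>. ev (region Y)" using that f(3)[of _ X] X by blast
  show "\<exists>Y\<in>\<C>. ev (region Y)" if "ev X"
  proof (rule ccontr)
    assume "\<not> ?thesis"
    then have all: "\<forall>Y\<in>\<C>. ev (- region Y)" using region_decided(2)[OF ev] by blast
    have "ev (\<Inter>Y\<in>\<B>. - region Y)" if "finite \<B>" "\<B> \<subseteq> \<C>" for \<B>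
      using that all by (induction \<B>) (auto intro: f)
    then have "ev (\<Inter>Y\<in>\<C>. - region Y)" using finite_\<C> by blast
    then have "ev (X \<inter> (\<Inter>Y\<in>\<C>. - region Y))" using \<open>ev X\<close> f(2) by blast
    moreover have "X \<inter> (\<Inter>Y\<in>\<C>. - region Y) = {}" using X by auto
    ultimately show False using f(4) by simp
  qed
qed

lemma region_unique:
  assumes ev: "decides ev" and "Y \<in> \<C>" "Z \<in> \<C>" "ev (region Y)" "ev (region Z)"
  shows "Y = Z"
proof (rule ccontr)
  assume "Y \<noteq> Z"
  then have "region Y \<inter> region Z = {}" using disjoint_regions assms(2,3) by (simp add: region_def)
  moreover have "ev (region Y \<inter> region Z)" using assms unfolding decides_def set_filter_def by blast
  ultimately show False using ev unfolding decides_def set_filter_def by simp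
qed

lemma generic_beside_if_generic_on:
  assumes e: "e \<noteq> 0" and Z: "Z \<in> \<C>" and ev: "generic_on a (absv e) (region Z)"
  shows "generic_beside c a (absv e) (region Z)"
proof -
  have r: "0 < absv e" using e by (rule absv_pos)
  note B = generic_beside_disk_iff[OF r] and G = generic_on_disk_iff[OF e refl]
  have on: "generic_on a (absv e) (outer Z)" "\<forall>k\<in>holes Z. \<not> generic_on a (absv e) k"
    using ev region_decided(1)[OF decides_generic_on[OF e refl] Z] by auto
  obtain b e' where "outer Z = disk False b (absv e')" using outer_disk[OF Z] by metis
  then have "generic_beside c a (absv e) (outer Z)" using on(1) B G by auto
  moreover have "\<not> generic_beside c a (absv e) k" if k: "k \<in> holes Z" for k
  proof -
    obtain b e' where "k = disk True b (absv e')" using hole_disk[OF Z k] by metis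
    then show ?thesis using on(2) k B G by auto
  qed
  ultimately show ?thesis using region_decided(1)[OF decides_generic_beside[OF r] Z] by blast
qed

lemma generic_of_disk:
  assumes Y: "Y \<in> \<C>" and e: "e \<noteq> 0" and D: "disk c a (absv e) \<in> disks_at c Y"
  shows "generic_beside c a (absv e) X \<and> \<not> generic_on a (absv e) X"
proof -
  define r where "r = absv e"
  have r: "0 < r" using e absv_pos by (simp add: r_def)
  note dB = decides_generic_beside[OF r, of c a] and dG = decides_generic_on[OF e r_def, of a]
  note B = generic_beside_disk_iff[OF r, of c a] and G = generic_on_disk_iff[OF e r_def, of a]
  have "generic_beside c a r (outer Y) \<and> (\<forall>h\<in>holes Y. \<not> generic_beside c a r h) \<and>
      \<not> generic_on a r (region Y)"
  proof (cases c)
    case True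
    then have Dr: "disk True a r \<in> holes Y" using D by (simp add: r_def disks_at_def)
    obtain b e' where oY: "outer Y = disk False b (absv e')" using outer_disk[OF Y] by metis
    have sub: "disk True a r \<subseteq> outer Y" using hole[OF Y Dr] by blast
    then have a: "a \<in> outer Y" using disk_center[OF r] by blast
    then have oY': "outer Y = disk False a (absv e')" using disk_recenter oY by metis
    have "a + e \<in> disk True a r" by (simp add: disk_def r_def)
    then have "a + e \<in> disk False a (absv e')" using sub unfolding oY' by blast
    then have "r < absv e'" by (simp add: disk_def r_def)
    then have "generic_beside c a r (outer Y)" using B a oY by auto
    moreover have "\<not> generic_beside c a r h" if h: "h \<in> holes Y" for h
    proof (cases "h = disk True a r")
      case False
      then have "h \<inter> disk True a r = {}" using disjointD[OF disjoint_holes[OF Y] h Dr] by blast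
      then have "a \<notin> h" using disk_center[OF r] by blast
      moreover obtain b e' where "h = disk True b (absv e')" using hole_disk[OF Y h] by metis
      ultimately show ?thesis using B by simp
    qed (use B True in simp)
    moreover have "generic_on a r (disk True a r)" using G disk_center[OF r] by simp
    ultimately show ?thesis using region_decided(1)[OF dG Y] Dr by blast
  next
    case False
    then have Dr: "outer Y = disk False a r" using D by (simp add: r_def disks_at_def)
    have "\<not> generic_beside c a r h" if h: "h \<in> holes Y" for h
    proof
      assume ev: "generic_beside c a r h"
      obtain b e' where h': "h = disk True b (absv e')" using hole_disk[OF Y h] by metis
      then have ah: "a \<in> h" "r \<le> absv e'" using ev False unfolding h' B by auto
      then have "h = disk True a (absv e')" using disk_recenter h' by metis
      then have "outer Y \<subseteq> h" unfolding Dr using ah(2) by (auto simp: disk_def)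
      then show False using hole[OF Y h] by blast
    qed
    moreover have "generic_beside c a r (outer Y)" unfolding Dr B using False disk_center[OF r] by simp
    moreover have "\<not> generic_on a r (outer Y)" unfolding Dr G by simp
    ultimately show ?thesis using region_decided(1)[OF dG Y] by blast
  qed
  then have RY: "generic_beside c a r (region Y)" "\<not> generic_on a r (region Y)"
    using region_decided(1)[OF dB Y] by auto
  have "\<not> generic_on a r (region Z)" if Z: "Z \<in> \<C>" for Z
  proof
    assume ev: "generic_on a r (region Z)"
    then have "generic_beside c a r (region Z)" using generic_beside_if_generic_on[OF e Z] by (simp add: r_def)
    then have "Z = Y" using region_unique[OF dB Z Y] RY(1) by blast
    then show False using ev RY(2) by simp
  qed
  then show ?thesis using X_decided[OF dB] X_decided[OF dG] RY(1) Y unfolding r_def by blast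
qed

lemma disk_of_generic:
  assumes e: "e \<noteq> 0" and ev: "generic_beside c a (absv e) X" "\<not> generic_on a (absv e) X"
  shows "disk c a (absv e) \<in> disks"
proof -
  define r where "r = absv e"
  have r: "0 < r" using e absv_pos by (simp add: r_def)
  note dB = decides_generic_beside[OF r, of c a] and dG = decides_generic_on[OF e r_def, of a]
  note B = generic_beside_disk_iff[OF r, of c a] and G = generic_on_disk_iff[OF e r_def, of a]
  obtain Y where Y: "Y \<in> \<C>" "generic_beside c a r (region Y)" "\<not> generic_on a r (region Y)"
    using X_decided[OF dB] X_decided[OF dG] ev unfolding r_def by blast
  have evB: "generic_beside c a r (outer Y)" "\<forall>k\<in>holes Y. \<not> generic_beside c a r k"
    using region_decided(1)[OF dB Y(1)] Y(2) by auto
  obtain b e' where oY: "outer Y = disk False b (absv e')" using outer_disk[OF Y(1)] by metis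
  have "disk c a r \<in> disks_at c Y"
  proof (cases c)
    case True
    then have "generic_on a r (outer Y)" using evB(1) B G oY by auto
    then obtain k where k: "k \<in> holes Y" "generic_on a r k" using region_decided(1)[OF dG Y(1)] Y(3) by blast
    obtain b' e'' where kb: "k = disk True b' (absv e'')" using hole_disk[OF Y(1) k(1)] by metis
    then have a: "a \<in> disk True b' (absv e'')" "r \<le> absv e''" using k(2) G by auto
    have "\<not> r < absv e''" using evB(2) k(1) kb B a True by auto
    then have "r = absv e''" using a by simp
    then have "k = disk True a r" using kb disk_recenter[OF a(1)] by simp
    then show ?thesis using k(1) True by (simp add: disks_at_def)
  next
    case False
    have a: "a \<in> disk False b (absv e')" "r \<le> absv e'" using evB(1) B oY False by auto
    have "\<not> generic_on a r k" if k: "k \<in> holes Y" for k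
    proof -
      obtain b e' where "k = disk True b (absv e')" using hole_disk[OF Y(1) k] by metis
      then show ?thesis using evB(2) k G B False by auto
    qed
    then have "\<not> generic_on a r (outer Y)" using region_decided(1)[OF dG Y(1)] Y(3) by blast
    then have "\<not> r < absv e'" using G oY a by auto
    then have "r = absv e'" using a by simp
    then have "outer Y = disk False a r" using oY disk_recenter[OF a(1)] by simp
    then show ?thesis using False by (simp add: disks_at_def)
  qed
  then show ?thesis using Y(1) unfolding disks_iff r_def by blast
qed

lemma generic_conjugate:
  assumes \<sigma>: "\<sigma> \<in> GQ" "\<sigma> ` X = X"
  shows "generic_on (\<sigma> a) r X \<longleftrightarrow> generic_on a r X"
    "generic_beside c a r X \<Longrightarrow> generic_beside c (\<sigma> a) r X"
proof -
  have mem: "\<sigma> x \<in> X \<longleftrightarrow> x \<in> X" for x using \<sigma>(2) Gal_inj[OF \<sigma>(1)] by (metis image_iff)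
  have dist: "absv (\<sigma> x - \<sigma> y) = absv (x - y)" for x y
    using Gal_absv[OF \<sigma>(1), of "x - y"] Gal_diff[OF \<sigma>(1)] by simp
  have all: "(\<forall>x. P x) \<longleftrightarrow> (\<forall>x. P (\<sigma> x))" for P using Gal_inv_apply(1)[OF \<sigma>(1)] by metis
  show "generic_on (\<sigma> a) r X \<longleftrightarrow> generic_on a r X"
  proof
    assume "generic_on a r X"
    then obtain T where "finite T" "\<forall>x. absv (x - a) \<le> r \<longrightarrow> (\<forall>t\<in>T. r \<le> absv (x - t)) \<longrightarrow> x \<in> X"
      unfolding generic_on_def by blast
    then show "generic_on (\<sigma> a) r X"
      unfolding generic_on_def by (intro exI[of _ "\<sigma> ` T"], subst all) (simp add: dist mem)
  next
    assume "generic_on (\<sigma> a) r X"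
    then obtain T where T: "finite T" "\<forall>x. absv (x - \<sigma> a) \<le> r \<longrightarrow> (\<forall>t\<in>T. r \<le> absv (x - t)) \<longrightarrow> x \<in> X"
      unfolding generic_on_def by blast
    have t: "absv (\<sigma> x - t) = absv (x - inv \<sigma> t)" for x t
      using dist[of x "inv \<sigma> t"] Gal_inv_apply(1)[OF \<sigma>(1)] by simp
    show "generic_on a r X"
      unfolding generic_on_def
    proof (intro exI[of _ "inv \<sigma> ` T"] conjI allI impI)
      show "finite (inv \<sigma> ` T)" using T(1) by simp
      fix x assume "absv (x - a) \<le> r" "\<forall>t\<in>inv \<sigma> ` T. r \<le> absv (x - t)"
      then have "\<sigma> x \<in> X" using T(2)[rule_format, of "\<sigma> x"] by (simp add: dist t Gal_inv_apply(2)[OF \<sigma>(1)])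
      then show "x \<in> X" by (simp add: mem)
    qed
  qed
  show "generic_beside c (\<sigma> a) r X" if "generic_beside c a r X"
    using that unfolding generic_beside_def by (subst all) (simp add: dist mem)
qed

lemma disks_stable:
  assumes \<sigma>: "\<sigma> \<in> GQ" "\<sigma> ` X = X" and D: "D \<in> disks"
  shows "\<sigma> ` D \<in> disks"
proof -
  obtain c Y where Y: "Y \<in> \<C>" "D \<in> disks_at c Y" using D unfolding disks_iff by blast
  then obtain a e where e: "e \<noteq> 0" "D = disk c a (absv e)"
    using outer_disk[of Y] hole_disk[of Y D] unfolding disks_at_def by (cases c) (simp, metis, simp, metis)
  have "\<sigma> ` D = disk c (\<sigma> a) (absv e)" using e(2) disk_image[OF \<sigma>(1)] by simp
  then show ?thesis
    using disk_of_generic[OF e(1)] generic_of_disk[OF Y(1) e(1)] Y(2) e(2) generic_conjugate[OF \<sigma>] by simp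
qed

lemma same_disks_imp_same_membership:
  assumes "\<And>D. D \<in> disks \<Longrightarrow> w \<in> D \<longleftrightarrow> z \<in> D"
  shows "w \<in> X \<longleftrightarrow> z \<in> X"
  unfolding X_eq using assms unfolding disks_def by blast

end

section \<open>Determination by points of bounded degree\<close>

context finite_extension_of_Qp
begin

lemma standard_presentation_exists:
  assumes "standard_subset absv (Some ` X)"
  obtains \<C> :: "'a option set set" and outer holes where "standard_presentation p absv X \<C> outer holes"
    "complexity absv E (Some ` X) =
      (\<Sum>Y\<in>\<C>. disk_complexity absv E (outer Y) + (\<Sum>D\<in>holes Y. disk_complexity absv E D))"
proof -
  define \<C> where "\<C> = connected_components absv (Some ` X)"
  have \<C>: "standard_decomposition absv \<C> (Some ` X)"
    using assms unfolding \<C>_def connected_components_def standard_subset_def by (rule someI_ex)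
  define pr where "pr Y = (SOME (D\<^sub>0, \<D>). connected_presentation absv D\<^sub>0 \<D> Y)" for Y
  define outer where "outer Y = Some -` fst (pr Y)" for Y
  define holes where "holes Y = snd (pr Y)" for Y
  have pres: "connected_presentation absv (Some ` outer Y) (holes Y) Y" "fst (pr Y) \<noteq> UNIV"
      "open_rational_disk absv (outer Y)" if Y: "Y \<in> \<C>" for Y
  proof -
    have "\<exists>q. case q of (D\<^sub>0, \<D>) \<Rightarrow> connected_presentation absv D\<^sub>0 \<D> Y"
      using \<C> Y unfolding standard_decomposition_def connected_standard_def by auto
    then have "case pr Y of (D\<^sub>0, \<D>) \<Rightarrow> connected_presentation absv D\<^sub>0 \<D> Y"
      unfolding pr_def by (rule someI_ex)
    then have cp: "connected_presentation absv (fst (pr Y)) (holes Y) Y"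
      by (simp add: holes_def case_prod_unfold)
    have "Y \<subseteq> Some ` X" using \<C> Y unfolding standard_decomposition_def by blast
    then have "None \<notin> Y" by blast
    then show ne: "fst (pr Y) \<noteq> UNIV" using cp unfolding connected_presentation_def by auto
    then obtain D where D: "open_rational_disk absv D" "fst (pr Y) = Some ` D"
      using cp unfolding connected_presentation_def by blast
    then have "outer Y = D" by (auto simp: outer_def)
    then show "connected_presentation absv (Some ` outer Y) (holes Y) Y" "open_rational_disk absv (outer Y)"
      using cp D by auto
  qed
  have Yeq: "Y = Some ` (outer Y - \<Union>(holes Y))" if "Y \<in> \<C>" for Y
  proof -
    have "Y = Some ` outer Y - Some ` \<Union>(holes Y)"
      using pres(1)[OF that] unfolding connected_presentation_def by (elim conjE)
    also have "\<dots> = Some ` (outer Y - \<Union>(holes Y))" by blast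
    finally show ?thesis .
  qed
  have "standard_presentation p absv X \<C> outer holes"
  proof (intro standard_presentation.intro standard_presentation_axioms.intro)
    show "Qp_algebraic_closure p absv" by unfold_locales
    show "finite \<C>" using \<C> by (simp add: standard_decomposition_def)
    show "open_rational_disk absv (outer Y)" "finite (holes Y)" "disjoint (holes Y)" if "Y \<in> \<C>" for Y
      using pres[OF that] unfolding connected_presentation_def by auto
    show "closed_rational_disk absv D \<and> D \<subset> outer Y" if "Y \<in> \<C>" "D \<in> holes Y" for Y D
      using pres(1)[OF that(1)] that(2) unfolding connected_presentation_def by blast
    show "(outer Y - \<Union>(holes Y)) \<inter> (outer Z - \<Union>(holes Z)) = {}" if "Y \<in> \<C>" "Z \<in> \<C>" "Y \<noteq> Z" for Y Z
    proof -
      have "Y \<inter> Z = {}" using \<C> that unfolding standard_decomposition_def by (blast dest: disjointD)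
      then show ?thesis using Yeq[OF that(1)] Yeq[OF that(2)] by blast
    qed
    have "Some ` X = (\<Union>Y\<in>\<C>. Some ` (outer Y - \<Union>(holes Y)))"
      using \<C> Yeq unfolding standard_decomposition_def by auto
    also have "\<dots> = Some ` (\<Union>Y\<in>\<C>. outer Y - \<Union>(holes Y))" by blast
    finally show "X = (\<Union>Y\<in>\<C>. outer Y - \<Union>(holes Y))" by (simp add: inj_image_eq_iff)
  qed
  moreover have "connected_complexity absv E Y =
      disk_complexity absv E (outer Y) + (\<Sum>D\<in>holes Y. disk_complexity absv E D)" if "Y \<in> \<C>" for Y
    using pres(2)[OF that] unfolding connected_complexity_def pr_def[symmetric] outer_complexity_def
    by (simp add: outer_def holes_def case_prod_unfold Let_def)
  ultimately show thesis using that unfolding complexity_def \<C>_def[symmetric] by simp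
qed

definition tame_disk :: "nat \<Rightarrow> nat \<Rightarrow> 'a set \<Rightarrow> bool" where
  "tame_disk M N D \<longleftrightarrow> (\<exists>c a r j. D = disk c a r \<and> 0 < r \<and> card (orb (Gal E) a) \<le> M \<and> r ^ N = real p powi j)"

lemma bounded_complexity_tame_disks:
  assumes X: "standard_subset absv (Some ` X)" "defined_over E (Some ` X)" "complexity absv E (Some ` X) \<le> m"
  obtains \<D> where "finite \<D>" "card \<D> \<le> m" "X \<subseteq> \<Union>\<D>"
    "\<And>D. D \<in> \<D> \<Longrightarrow> tame_disk (m * m) (fact m * fact m * fact (E_index * m)) D"
    "\<And>w z. (\<And>D. D \<in> \<D> \<Longrightarrow> w \<in> D \<longleftrightarrow> z \<in> D) \<Longrightarrow> w \<in> X \<longleftrightarrow> z \<in> X"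
proof -
  obtain \<C> :: "'a option set set" and outer holes where S: "standard_presentation p absv X \<C> outer holes"
    and cx: "complexity absv E (Some ` X) =
      (\<Sum>Y\<in>\<C>. disk_complexity absv E (outer Y) + (\<Sum>D\<in>holes Y. disk_complexity absv E D))"
    by (rule standard_presentation_exists[OF X(1)])
  interpret S: standard_presentation p absv X \<C> outer holes by (rule S)
  let ?c = "disk_complexity absv E"
  have pos: "1 \<le> ?c D" if "D \<in> S.disks" for D
    using disk_complexity_pos[OF S.rational_disks[OF that]] by simp
  have Yle: "?c (outer Y) + (\<Sum>D\<in>holes Y. ?c D) \<le> m" if "Y \<in> \<C>" for Y
    using member_le_sum[OF that, of "\<lambda>Y. ?c (outer Y) + (\<Sum>D\<in>holes Y. ?c D)"] S.finite_\<C> cx X(3) by simp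
  have le: "?c D \<le> m" if D: "D \<in> S.disks" for D
  proof -
    obtain Y where Y: "Y \<in> \<C>" "D = outer Y \<or> D \<in> holes Y" using D unfolding S.disks_def by blast
    then have "?c D \<le> ?c (outer Y) + (\<Sum>D\<in>holes Y. ?c D)"
      using member_le_sum[of D "holes Y" ?c] S.finite_holes[OF Y(1)] by (auto intro: trans_le_add2)
    then show ?thesis using Yle[OF Y(1)] by simp
  qed
  have card: "card S.disks \<le> m"
  proof -
    have "S.disks = (\<Union>Y\<in>\<C>. insert (outer Y) (holes Y))" unfolding S.disks_def by blast
    then have "card S.disks \<le> (\<Sum>Y\<in>\<C>. card (insert (outer Y) (holes Y)))"
      using card_UN_le[OF S.finite_\<C>] by metis
    also have "\<dots> \<le> (\<Sum>Y\<in>\<C>. ?c (outer Y) + (\<Sum>D\<in>holes Y. ?c D))"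
    proof (rule sum_mono)
      fix Y assume Y: "Y \<in> \<C>"
      have "card (holes Y) = (\<Sum>D\<in>holes Y. 1)" by simp
      also have "\<dots> \<le> (\<Sum>D\<in>holes Y. ?c D)"
        using Y by (intro sum_mono pos) (auto simp: S.disks_def)
      finally have "card (holes Y) \<le> (\<Sum>D\<in>holes Y. ?c D)" .
      moreover have "1 \<le> ?c (outer Y)" using Y by (intro pos) (auto simp: S.disks_def)
      moreover have "card (insert (outer Y) (holes Y)) \<le> Suc (card (holes Y))" by (rule card_insert_le_m1) auto
      ultimately show "card (insert (outer Y) (holes Y)) \<le> ?c (outer Y) + (\<Sum>D\<in>holes Y. ?c D)" by linarith
    qed
    finally show ?thesis using cx X(3) by simp
  qed
  have stable: "\<sigma> ` X = X" if "\<sigma> \<in> Gal E" for \<sigma>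
    using X(2) that unfolding defined_over_def map_option_Some_image by (simp add: inj_image_eq_iff)
  have conj: "card (conjugates D) \<le> m" if D: "D \<in> S.disks" for D
  proof -
    have "conjugates D \<subseteq> S.disks"
      unfolding conjugates_def using S.disks_stable[OF _ stable D] Gal_mono[OF Qp_subset_E] by blast
    then show ?thesis using card_mono[OF S.finite_disks] card by (meson le_trans)
  qed
  have tame: "tame_disk (m * m) (fact m * fact m * fact (E_index * m)) D" if D: "D \<in> S.disks" for D
    by (rule disk_bounded_complexity[OF S.rational_disks[OF D] le[OF D] conj[OF D]])
      (unfold tame_disk_def, blast)
  have "X \<subseteq> \<Union>S.disks" using S.X_eq unfolding S.disks_def by blast
  then show thesis using that S.finite_disks card tame S.same_disks_imp_same_membership by blast
qed

lemma disk_nested: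
  assumes "z \<in> disk c a r" "z \<in> disk c' a' r'"
  shows "disk c a r \<subseteq> disk c' a' r' \<or> disk c' a' r' \<subseteq> disk c a r"
proof -
  have "disk c z r \<subseteq> disk c' z r' \<or> disk c' z r' \<subseteq> disk c z r"
    by (cases r r' rule: linorder_cases; cases c; cases c') (auto simp: disk_def)
  then show ?thesis using disk_recenter[OF assms(1)] disk_recenter[OF assms(2)] by simp
qed

text \<open>The witness is chosen in the smallest disk containing \<open>z\<close>, at a distance from its centre
  for which every disk avoiding \<open>z\<close> meets at most one of the residue classes in \<open>Z\<close>.\<close>

lemma same_disks_witness:
  assumes \<D>: "finite \<D>" "\<And>D. D \<in> \<D> \<Longrightarrow> tame_disk M N D" and z: "z \<in> \<Union>\<D>" and N: "0 < N"
    and Z: "finite Z" "card \<D> < card Z" "\<And>\<zeta>. \<zeta> \<in> Z \<Longrightarrow> absv \<zeta> \<le> 1"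
      "\<And>\<zeta> \<zeta>'. \<zeta> \<in> Z \<Longrightarrow> \<zeta>' \<in> Z \<Longrightarrow> \<zeta> \<noteq> \<zeta>' \<Longrightarrow> absv (\<zeta> - \<zeta>') = 1"
  obtains a \<rho> \<zeta> l where "card (orb (Gal E) a) \<le> M" "\<rho> ^ (2 * N) = of_nat p powi l" "\<zeta> \<in> Z"
    "\<And>D. D \<in> \<D> \<Longrightarrow> a + \<rho> * \<zeta> \<in> D \<longleftrightarrow> z \<in> D"
proof -
  define \<D>z where "\<D>z = {D \<in> \<D>. z \<in> D}"
  have "finite \<D>z" "\<D>z \<noteq> {}" using \<D>(1) z by (auto simp: \<D>z_def)
  then obtain D where D: "D \<in> \<D>z" "\<And>D'. D' \<in> \<D>z \<Longrightarrow> D' \<subseteq> D \<Longrightarrow> D = D'"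
    using finite_has_minimal[of \<D>z] by blast
  have "D \<in> \<D>" using D(1) by (simp add: \<D>z_def)
  then have "tame_disk M N D" by (rule \<D>(2))
  then obtain c a r j where r: "D = disk c a r" "0 < r" "card (orb (Gal E) a) \<le> M" "r ^ N = real p powi j"
    unfolding tame_disk_def by (elim exE conjE)
  define l where "l = (if c then - (2 * j) else 1 - 2 * j)"
  obtain \<rho> where \<rho>: "\<rho> ^ (2 * N) = (of_nat p :: 'a) powi l"
    using nth_root_exists[of "2 * N" "(of_nat p :: 'a) powi l"] N by auto
  define s where "s = absv \<rho>"
  have "absv (x powi k) = absv x powi k" for x k
    by (simp add: power_int_def absv_power absv_inverse)
  then have powi: "absv (of_nat p powi l) = real p powi (- l)"
    by (simp add: absv_p power_int_minus power_int_one_over inverse_eq_divide)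
  have s_pow: "s ^ (2 * N) = real p powi (- l)" unfolding s_def absv_power[symmetric] \<rho> powi ..
  have sq: "x ^ (2 * N) = real p powi (2 * i)" if "x ^ N = real p powi i" for x i
  proof -
    have "x ^ (2 * N) = (real p powi i) ^ 2" by (simp only: power_even_eq that)
    also have "\<dots> = real p powi (i * 2)" using power_int_mult[of "real p" i 2] by simp
    finally show ?thesis by (simp only: mult.commute)
  qed
  have s_nonneg: "0 \<le> s" by (simp add: s_def absv_nonneg)
  have less_s: "s < r" if "\<not> c"
  proof -
    have "s ^ (2 * N) < r ^ (2 * N)"
      unfolding s_pow sq[OF r(4)] powi_p_less_iff using that by (simp add: l_def)
    then show ?thesis using r(2) by (simp add: power_less_imp_less_base)
  qed
  have eq_s: "s = r" if c
  proof -
    have "s ^ (2 * N) = r ^ (2 * N)" unfolding s_pow sq[OF r(4)] using that by (simp add: l_def)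
    then show ?thesis using r(2) s_nonneg N by (intro power_eq_imp_eq_base[of s "2 * N" r]) auto
  qed
  have \<rho>\<zeta>: "absv (\<rho> * \<zeta>) \<le> s" if "\<zeta> \<in> Z" for \<zeta>
    using Z(3)[OF that] absv_nonneg by (simp add: absv_mult s_def mult_left_le)
  have inD: "a + \<rho> * \<zeta> \<in> D" if "\<zeta> \<in> Z" for \<zeta>
    using \<rho>\<zeta>[OF that] less_s eq_s unfolding r(1) by (auto simp: disk_def)
  have one: "\<zeta> = \<zeta>'" if D': "D' \<in> \<D>" "z \<notin> D'" and \<zeta>: "\<zeta> \<in> Z" "\<zeta>' \<in> Z" "a + \<rho> * \<zeta> \<in> D'" "a + \<rho> * \<zeta>' \<in> D'" for D' \<zeta> \<zeta>'
  proof (rule ccontr)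
    assume "\<zeta> \<noteq> \<zeta>'"
    obtain c' a' r' j' where r': "D' = disk c' a' r'" "0 < r'" "r' ^ N = real p powi j'"
      using \<D>(2)[OF D'(1)] unfolding tame_disk_def by blast
    define w where "w = a + \<rho> * \<zeta>"
    have D'w: "D' = disk c' w r'" using disk_recenter[of w c' a' r'] \<zeta>(3) r'(1) w_def by simp
    have "a + \<rho> * \<zeta>' - w = \<rho> * (\<zeta>' - \<zeta>)" by (simp add: w_def algebra_simps)
    then have "absv (a + \<rho> * \<zeta>' - w) = s"
      using Z(4)[OF \<zeta>(2,1)] \<open>\<zeta> \<noteq> \<zeta>'\<close> by (simp add: absv_mult s_def)
    then have sr': "if c' then s \<le> r' else s < r'" using \<zeta>(4) unfolding D'w by (auto simp: disk_def)
    have "D \<subseteq> D'"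
    proof
      fix x assume "x \<in> D"
      then have xa: "if c then absv (x - a) \<le> r else absv (x - a) < r" unfolding r(1) by (simp add: disk_def)
      have "absv (a - w) \<le> s" using \<rho>\<zeta>[OF \<zeta>(1)] by (simp add: w_def)
      then have xw: "absv (x - w) \<le> max (absv (x - a)) s" using absv_ultrametric[of x w a] by simp
      show "x \<in> D'"
      proof (cases c)
        case True
        then have "absv (x - w) \<le> s" using xw xa eq_s by simp
        then show ?thesis unfolding D'w using sr' by (auto simp: disk_def split: if_splits)
      next
        case False
        have "s \<le> r'" using sr' by (auto split: if_splits)
        then have "s ^ (2 * N) \<le> r' ^ (2 * N)" using s_nonneg by (rule power_mono)
        then have "\<not> 2 * j' < - l" unfolding s_pow sq[OF r'(3)] using powi_p_less_iff[of "2 * j'" "- l"] by simp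
        then have "j \<le> j'" using False by (simp add: l_def)
        then have "r ^ N \<le> r' ^ N" using r(4) r'(3) powi_p_less_iff[of j' j] by simp
        then have "r \<le> r'" using N r(2) r'(2) power_mono_iff[of r r' N] by simp
        then have "absv (x - w) < r'" using xw xa less_s False by simp
        then show ?thesis unfolding D'w by (simp add: disk_def)
      qed
    qed
    then show False using D(1) D'(2) by (auto simp: \<D>z_def)
  qed
  have "\<exists>\<zeta>\<in>Z. \<forall>D'\<in>\<D>. z \<notin> D' \<longrightarrow> a + \<rho> * \<zeta> \<notin> D'"
  proof (rule ccontr)
    assume "\<not> ?thesis"
    then have "\<forall>\<zeta>\<in>Z. \<exists>D'\<in>\<D>. z \<notin> D' \<and> a + \<rho> * \<zeta> \<in> D'" by blast
    then obtain f where f: "\<And>\<zeta>. \<zeta> \<in> Z \<Longrightarrow> f \<zeta> \<in> \<D> \<and> z \<notin> f \<zeta> \<and> a + \<rho> * \<zeta> \<in> f \<zeta>" by metis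
    have "inj_on f Z"
    proof (rule inj_onI)
      fix \<zeta> \<zeta>' assume "\<zeta> \<in> Z" "\<zeta>' \<in> Z" "f \<zeta> = f \<zeta>'"
      then show "\<zeta> = \<zeta>'" using one[of "f \<zeta>" \<zeta> \<zeta>'] f[of \<zeta>] f[of \<zeta>'] by simp
    qed
    then have "card Z \<le> card \<D>" using f \<D>(1) by (intro card_inj_on_le) auto
    then show False using Z(2) by simp
  qed
  then obtain \<zeta> where \<zeta>: "\<zeta> \<in> Z" "\<And>D'. D' \<in> \<D> \<Longrightarrow> z \<notin> D' \<Longrightarrow> a + \<rho> * \<zeta> \<notin> D'" by blast
  have "a + \<rho> * \<zeta> \<in> D'" if D': "D' \<in> \<D>" "z \<in> D'" for D'
  proof -
    obtain c' a' r' where r': "D' = disk c' a' r'" using \<D>(2)[OF D'(1)] unfolding tame_disk_def by blast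
    have "z \<in> D" using D(1) by (simp add: \<D>z_def)
    then have "D \<subseteq> D' \<or> D' \<subseteq> D" using disk_nested D'(2) unfolding r' r(1) by blast
    then have "D \<subseteq> D'" using D(2)[of D'] D' by (auto simp: \<D>z_def)
    then show ?thesis using inD[OF \<zeta>(1)] by blast
  qed
  then show thesis using that[OF r(3) \<rho> \<zeta>(1)] \<zeta>(2) by blast
qed

lemma determining_extension:
  obtains F where "finite_extension E F"
    "\<And>X X'. standard_subset absv (Some ` X) \<Longrightarrow> defined_over E (Some ` X) \<Longrightarrow> complexity absv E (Some ` X) \<le> m \<Longrightarrow>
      standard_subset absv (Some ` X') \<Longrightarrow> defined_over E (Some ` X') \<Longrightarrow> complexity absv E (Some ` X') \<le> m \<Longrightarrow>
      X \<inter> F = X' \<inter> F \<Longrightarrow> X \<subseteq> X'"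
proof -
  define N :: nat where "N = fact m * fact m * fact (E_index * m)"
  have N0: "0 < N" by (simp add: N_def)
  obtain Z where Z: "finite Z" "card Z = Suc (m + m)" "\<And>z. z \<in> Z \<Longrightarrow> absv z \<le> 1"
    "\<And>z z'. z \<in> Z \<Longrightarrow> z' \<in> Z \<Longrightarrow> z \<noteq> z' \<Longrightarrow> absv (z - z') = 1"
    using many_residues[of "Suc (m + m)"] by metis
  define B where "B = (\<Sum>z\<in>Z. card (orb (Gal E) z))"
  define M where "M = E_index * ((m * m) * ((2 * N) * B))"
  obtain A where A: "finite A"
    "\<And>\<sigma> w. \<sigma> \<in> GQ \<Longrightarrow> (\<And>z. z \<in> A \<Longrightarrow> \<sigma> z = z) \<Longrightarrow> card (orb GQ w) \<le> M \<Longrightarrow> \<sigma> w = w"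
    using bounded_orbits_finitely_generated[of M] by blast
  obtain F where F: "finite_extension E F" "A \<subseteq> F"
    using finite_extension_containing[OF A(1) E_subfield Qp_subset_E] by blast
  have Fsub: "is_subfield F" "Qp absv \<subseteq> F" using F(1) Qp_subset_E unfolding finite_extension_def by blast+
  have inF: "w \<in> F" if "card (orb (Gal E) w) \<le> (m * m) * ((2 * N) * B)" for w
  proof -
    have "card (orb GQ w) \<le> M" unfolding M_def by (rule le_mult_trans[OF E_index that])
    then have "\<sigma> w = w" if "\<sigma> \<in> Gal F" for \<sigma>
      using A(2)[of \<sigma> w] that Gal_mono[OF Fsub(2)] Gal_fixed[OF that] F(2) by blast
    then show ?thesis using fixed_Gal[OF Fsub] by (auto simp: fixed_def)
  qed
  have "X \<subseteq> X'" if X: "standard_subset absv (Some ` X)" "defined_over E (Some ` X)" "complexity absv E (Some ` X) \<le> m"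
    and X': "standard_subset absv (Some ` X')" "defined_over E (Some ` X')" "complexity absv E (Some ` X') \<le> m"
    and eq: "X \<inter> F = X' \<inter> F" for X X'
  proof
    fix z assume z: "z \<in> X"
    obtain \<D> where \<D>: "finite \<D>" "card \<D> \<le> m" "X \<subseteq> \<Union>\<D>" "\<And>D. D \<in> \<D> \<Longrightarrow> tame_disk (m * m) N D"
      "\<And>w z. (\<And>D. D \<in> \<D> \<Longrightarrow> w \<in> D \<longleftrightarrow> z \<in> D) \<Longrightarrow> w \<in> X \<longleftrightarrow> z \<in> X"
      using bounded_complexity_tame_disks[OF X] unfolding N_def by metis
    obtain \<D>' where \<D>': "finite \<D>'" "card \<D>' \<le> m" "\<And>D. D \<in> \<D>' \<Longrightarrow> tame_disk (m * m) N D"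
      "\<And>w z. (\<And>D. D \<in> \<D>' \<Longrightarrow> w \<in> D \<longleftrightarrow> z \<in> D) \<Longrightarrow> w \<in> X' \<longleftrightarrow> z \<in> X'"
      using bounded_complexity_tame_disks[OF X'] unfolding N_def by metis
    have "card (\<D> \<union> \<D>') \<le> m + m" using card_Un_le[of \<D> \<D>'] \<D>(2) \<D>'(2) by linarith
    then have card: "card (\<D> \<union> \<D>') < card Z" using Z(2) by simp
    obtain a \<rho> \<zeta> l where w: "card (orb (Gal E) a) \<le> m * m" "\<rho> ^ (2 * N) = of_nat p powi l" "\<zeta> \<in> Z"
      and same: "\<And>D. D \<in> \<D> \<union> \<D>' \<Longrightarrow> a + \<rho> * \<zeta> \<in> D \<longleftrightarrow> z \<in> D"
    proof (rule same_disks_witness[where \<D> = "\<D> \<union> \<D>'" and M = "m * m" and N = N and z = z and Z = Z])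
      show "z \<in> \<Union>(\<D> \<union> \<D>')" using z \<D>(3) by blast
    qed (use \<D> \<D>' N0 Z card in auto)
    have "card (orb (Gal E) \<rho>) \<le> 2 * N"
    proof -
      define k :: 'a where "k = of_nat p powi l"
      have "k \<in> Qp absv"
        unfolding k_def power_int_def
        using subfield_power[OF Qp_subfield] subfield_inverse[OF Qp_subfield] subfield_of_nat[OF Qp_subfield] by simp
      then have kE: "k \<in> fixed (Gal E)" using Qp_fixed[OF Galois_group_E] by blast
      have fs: "is_subfield (fixed (Gal E))" by (rule fixed_subfield[OF Galois_group_E])
      define f where "f = monom 1 (2 * N) - [:k:]"
      have cf: "coeff f i = (if i = 2 * N then 1 else 0) - (if i = 0 then k else 0)" for i
        by (simp add: f_def coeff_pCons split: nat.split)
      have "poly_over (fixed (Gal E)) f"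
        unfolding poly_over_def cf using kE subfield_0[OF fs] subfield_1[OF fs]
        by (intro allI subfield_diff[OF fs]) auto
      moreover have "f \<noteq> 0"
      proof
        assume "f = 0"
        then show False using cf[of "2 * N"] N0 by simp
      qed
      moreover have "poly f \<rho> = 0" using w(2) by (simp add: f_def poly_monom k_def)
      moreover have "degree f \<le> 2 * N" using N0 by (intro degree_le) (auto simp: cf)
      ultimately show ?thesis using orb_roots(2)[OF Galois_group_E, of f \<rho>] by simp
    qed
    moreover have "card (orb (Gal E) \<zeta>) \<le> B"
      unfolding B_def using w(3) Z(1) by (intro member_le_sum) auto
    ultimately have "card (orb (Gal E) (\<rho> * \<zeta>)) \<le> (2 * N) * B"
      by (intro order_trans[OF card_orb_mult[OF Galois_group_E]] mult_le_mono)
    with w(1) have "card (orb (Gal E) (a + \<rho> * \<zeta>)) \<le> (m * m) * ((2 * N) * B)"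
      by (intro order_trans[OF card_orb_add[OF Galois_group_E]] mult_le_mono)
    then have wF: "a + \<rho> * \<zeta> \<in> F" by (rule inF)
    have "a + \<rho> * \<zeta> \<in> X" using \<D>(5)[of "a + \<rho> * \<zeta>" z] same z by blast
    then have "a + \<rho> * \<zeta> \<in> X'" using wF eq by blast
    then show "z \<in> X'" using \<D>'(4)[of "a + \<rho> * \<zeta>" z] same by blast
  qed
  with F(1) show thesis by (rule that)
qed

end

theorem theorem4p16:
  fixes p m :: nat
    and absv :: "'a::{alg_closed_field, field_char_0} \<Rightarrow> real"
    and E :: "'a set"
  assumes "Qp_algebraic_closure p absv"
    and "finite_extension (Qp absv) E"
    and "0 < m"
  shows "\<exists>\<E>. finite \<E> \<and> (\<forall>F\<in>\<E>. finite_extension E F) \<and>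
    (\<forall>X X' :: 'a set.
      standard_subset absv (Some ` X) \<and> defined_over E (Some ` X) \<and>
      complexity absv E (Some ` X) \<le> m \<and>
      standard_subset absv (Some ` X') \<and> defined_over E (Some ` X') \<and>
      complexity absv E (Some ` X') \<le> m \<and>
      (\<forall>F\<in>\<E>. X \<inter> F = X' \<inter> F)
      \<longrightarrow> X = X')"
proof -
  interpret finite_extension_of_Qp p absv E
    using assms by (intro finite_extension_of_Qp.intro finite_extension_of_Qp_axioms.intro)
  obtain F where F: "finite_extension E F"
    and sub: "\<And>X X'. standard_subset absv (Some ` X) \<Longrightarrow> defined_over E (Some ` X) \<Longrightarrow> complexity absv E (Some ` X) \<le> m \<Longrightarrow>
      standard_subset absv (Some ` X') \<Longrightarrow> defined_over E (Some ` X') \<Longrightarrow> complexity absv E (Some ` X') \<le> m \<Longrightarrow>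
      X \<inter> F = X' \<inter> F \<Longrightarrow> X \<subseteq> X'"
    using determining_extension[of m] by blast
  show ?thesis
  proof (intro exI[of _ "{F}"] conjI allI impI)
    fix X X' assume "standard_subset absv (Some ` X) \<and> defined_over E (Some ` X) \<and>
      complexity absv E (Some ` X) \<le> m \<and>
      standard_subset absv (Some ` X') \<and> defined_over E (Some ` X') \<and>
      complexity absv E (Some ` X') \<le> m \<and> (\<forall>F\<in>{F}. X \<inter> F = X' \<inter> F)"
    then show "X = X'" using sub[of X X'] sub[of X' X] by auto
  qed (use F in auto)
qed

end
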